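(* Consider the initial value problem for the compressible Euler equations for a polytropic ideal gas, $$\tau_t-u_x=0,\qquad u_t+p_x=0,\qquad \left(\tfrac12u^2+e\right)_t+(up)_x=0,$$ with smooth initial data. Assume (bounds) that there exist positive constants $Z_L,Z_U,M_1,M_2,M_3,M_4$ such that $$Z_L<z<Z_U\quad\text{for all }x\text{ and }t,$$ $$M_1<m^0<M_2,\qquad |m^0_x|<M_3,\qquad |m^0_{xx}|<M_4,$$ where $m^0(x)=m(0,x)$. Furthermore, assume that there exists a point $A\in\mathbb{R}$ such that the initial entropy profile satisfies $$\left(m^{-\frac{2}{3\gamma-1}}\right)_{xx}\geq 0\quad\text{for }x>A.$$ If, in the initial data, $y_0=y(0,A^* )<0$ at some point $x=A^*$ with $A^*>A$, then $|u_x|$ and/or $|\tau_x|$ blow up before some finite time $T_*$, where $$0<T_*\leq-\frac{1}{y_0\,\min(-a_2)},$$ and $\min(-a_2)$ is a positive constant depending on $Z_L$ and $M_1$ when $1<\gamma<3$, and on $Z_U$ and $M_2$ when $\gamma>3$. When $\gamma=3$, all the results hold without the (bounds) assumption. Symmetrically for $q$: if instead $\left(m^{-\frac{2}{3\gamma-1}}\right)_{xx}\geq 0$ for $x<A$ in the initial entropy profile and $q_0=q(0,A^* )<0$ at some point $A^*<A$, then the same conclusions hold with $y_0$ replaced by $q_0$.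
   Context: Unknowns are functions of $(t,x)$, with one space dimension $x\in\mathbb{R}$ in Lagrangian coordinates: $\tau=\rho^{-1}>0$ is the specific volume ($\rho$ is the density), $u$ the velocity, $S$ the entropy, $p$ the pressure, $e$ the internal energy. Polytropic ideal gas: $p=Ke^{S/c_v}\tau^{-\gamma}$ and $e=\frac{1}{\gamma-1}p\tau$, where $K,c_v>0$ and $\gamma>1$ are constants, fixed throughout. For $C^1$ solutions the energy equation is equivalently replaced by $S_t=0$, so the entropy profile is stationary as long as the solution is smooth. New variables: $z=\frac{2\sqrt{K\gamma}}{\gamma-1}\tau^{-\frac{\gamma-1}{2}}$ and $m=e^{\frac{S}{2c_v}}$. Smooth means that $u,\tau,S$ are $C^2$ (equivalently $u,z,m$ are $C^2$ with $z,m$ both positive). The bounds on $z$ are assumed on the solution, for all $x$ and $t$; the bounds on $m^0$ are on the prescribed initial entropy profile. Gradient variables: $$y=m^{-\frac{3(3-\gamma)}{2(3\gamma-1)}}z^{\frac{\gamma+1}{2(\gamma-1)}}\left((u+mz)_x-\frac{2}{3\gamma-1}m_xz\right),$$ $$q=m^{-\frac{3(3-\gamma)}{2(3\gamma-1)}}z^{\frac{\gamma+1}{2(\gamma-1)}}\left((u-mz)_x+\frac{2}{3\gamma-1}m_xz\right).$$ The function $a_2$ is $$a_2=-K_c\,\frac{\gamma+1}{2(\gamma-1)}\,m^{\frac{3(3-\gamma)}{2(3\gamma-1)}}\,z^{\frac{\gamma+1}{2(\gamma-1)}-1}<0,$$ where $K_c=\sqrt{K\gamma}\,K_\tau^{-\frac{\gamma+1}{2}}$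 and $K_\tau=\left(\frac{2\sqrt{K\gamma}}{\gamma-1}\right)^{\frac{2}{\gamma-1}}$. Here $\min(-a_2)$ denotes the minimum of the expression $-a_2$ over $Z_L\le z\le Z_U$, $M_1\le m\le M_2$; when $\gamma=3$, $-a_2$ is the constant $K_c$.
   Formalization: For γ=3 "without the (bounds) assumption" fails as stated (τ=1−t, u=−x, S=0 has y<0 but bounded u_x, τ_x); the results for γ=3, for y and for q, are proved assuming instead only that the Lagrangian sound speed √(−p_τ) is bounded above on the solution. *)

theory Defs
  imports "HOL-Analysis.Analysis"
begin

text \<open>Fields are curried functions of time and the Lagrangian space variable. Time derivatives
  are taken within the time interval \<open>J\<close>, so they are one-sided at an endpoint belonging to \<open>J\<close>.\<close>

definition Dt :: "real set \<Rightarrow> (real \<Rightarrow> real \<Rightarrow> real) \<Rightarrow> real \<Rightarrow> real \<Rightarrow> real" where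
  "Dt J f t x = vector_derivative (\<lambda>s. f s x) (at t within J)"

definition Dx :: "(real \<Rightarrow> real \<Rightarrow> real) \<Rightarrow> real \<Rightarrow> real \<Rightarrow> real" where
  "Dx f t x = deriv (\<lambda>y. f t y) x"

definition C1_on :: "real set \<Rightarrow> (real \<Rightarrow> real \<Rightarrow> real) \<Rightarrow> bool" where
  "C1_on J f \<longleftrightarrow>
     (\<forall>t\<in>J. \<forall>x. (\<lambda>s. f s x) differentiable (at t within J) \<and> (\<lambda>y. f t y) differentiable (at x)) \<and>
     continuous_on (J \<times> UNIV) (\<lambda>(t, x). f t x) \<and>
     continuous_on (J \<times> UNIV) (\<lambda>(t, x). Dt J f t x) \<and>
     continuous_on (J \<times> UNIV) (\<lambda>(t, x). Dx f t x)"

definition C2_on :: "real set \<Rightarrow> (real \<Rightarrow> real \<Rightarrow> real) \<Rightarrow> bool" where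
  "C2_on J f \<longleftrightarrow> C1_on J f \<and> C1_on J (Dt J f) \<and> C1_on J (Dx f)"

definition pressure :: "real \<Rightarrow> real \<Rightarrow> real \<Rightarrow> (real \<Rightarrow> real \<Rightarrow> real) \<Rightarrow> (real \<Rightarrow> real \<Rightarrow> real)
    \<Rightarrow> real \<Rightarrow> real \<Rightarrow> real" where
  "pressure K cv \<gamma> \<tau> S t x = K * exp (S t x / cv) * \<tau> t x powr (- \<gamma>)"

definition internal_energy :: "real \<Rightarrow> real \<Rightarrow> real \<Rightarrow> (real \<Rightarrow> real \<Rightarrow> real) \<Rightarrow> (real \<Rightarrow> real \<Rightarrow> real)
    \<Rightarrow> real \<Rightarrow> real \<Rightarrow> real" where
  "internal_energy K cv \<gamma> \<tau> S t x = 1 / (\<gamma> - 1) * pressure K cv \<gamma> \<tau> S t x * \<tau> t x"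

text \<open>The Lagrangian speed of sound, the square root of \<open>- \<partial>p/\<partial>\<tau>\<close>. For \<open>\<gamma> = 3\<close> its boundedness
  replaces \<open>bounds\<close>. Without any such condition there are counterexamples: \<open>\<tau> = 1 - t\<close>,
  \<open>u = - x\<close>, \<open>S = 0\<close> ends at \<open>t = 1\<close> with bounded gradients, and a steady state with constant
  pressure, \<open>m = (1 + x\<^sup>2) powr - 2\<close>, exists forever although \<open>y < 0\<close> for \<open>x > 0\<close>, because its
  characteristics reach infinity in finite time.\<close>

definition sound_speed :: "real \<Rightarrow> real \<Rightarrow> real \<Rightarrow> (real \<Rightarrow> real \<Rightarrow> real) \<Rightarrow> (real \<Rightarrow> real \<Rightarrow> real)
    \<Rightarrow> real \<Rightarrow> real \<Rightarrow> real" where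
  "sound_speed K cv \<gamma> \<tau> S t x = sqrt (K * \<gamma> * exp (S t x / cv) * \<tau> t x powr (- \<gamma> - 1))"

definition smooth_solution :: "real \<Rightarrow> real \<Rightarrow> real \<Rightarrow> real set \<Rightarrow> (real \<Rightarrow> real \<Rightarrow> real)
    \<Rightarrow> (real \<Rightarrow> real \<Rightarrow> real) \<Rightarrow> (real \<Rightarrow> real \<Rightarrow> real) \<Rightarrow> bool" where
  "smooth_solution K cv \<gamma> J u \<tau> S \<longleftrightarrow>
     C2_on J u \<and> C2_on J \<tau> \<and> C2_on J S \<and>
     (\<forall>t\<in>J. \<forall>x.
        0 < \<tau> t x \<and>
        Dt J \<tau> t x - Dx u t x = 0 \<and>
        Dt J u t x + Dx (pressure K cv \<gamma> \<tau> S) t x = 0 \<and>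
        Dt J (\<lambda>t x. 1 / 2 * (u t x)\<^sup>2 + internal_energy K cv \<gamma> \<tau> S t x) t x
          + Dx (\<lambda>t x. u t x * pressure K cv \<gamma> \<tau> S t x) t x = 0)"

definition lifespan :: "ereal \<Rightarrow> real set" where
  "lifespan T = {t. 0 \<le> t \<and> ereal t < T}"

definition zvar :: "real \<Rightarrow> real \<Rightarrow> (real \<Rightarrow> real \<Rightarrow> real) \<Rightarrow> real \<Rightarrow> real \<Rightarrow> real" where
  "zvar K \<gamma> \<tau> t x = 2 * sqrt (K * \<gamma>) / (\<gamma> - 1) * \<tau> t x powr (- ((\<gamma> - 1) / 2))"

definition mvar :: "real \<Rightarrow> (real \<Rightarrow> real \<Rightarrow> real) \<Rightarrow> real \<Rightarrow> real \<Rightarrow> real" where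
  "mvar cv S t x = exp (S t x / (2 * cv))"

definition yvar :: "real \<Rightarrow> real \<Rightarrow> real \<Rightarrow> (real \<Rightarrow> real \<Rightarrow> real) \<Rightarrow> (real \<Rightarrow> real \<Rightarrow> real)
    \<Rightarrow> (real \<Rightarrow> real \<Rightarrow> real) \<Rightarrow> real \<Rightarrow> real \<Rightarrow> real" where
  "yvar K cv \<gamma> u \<tau> S t x =
     mvar cv S t x powr (- (3 * (3 - \<gamma>) / (2 * (3 * \<gamma> - 1))))
     * zvar K \<gamma> \<tau> t x powr ((\<gamma> + 1) / (2 * (\<gamma> - 1)))
     * (Dx (\<lambda>t x. u t x + mvar cv S t x * zvar K \<gamma> \<tau> t x) t x
        - 2 / (3 * \<gamma> - 1) * Dx (mvar cv S) t x * zvar K \<gamma> \<tau> t x)"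

definition qvar :: "real \<Rightarrow> real \<Rightarrow> real \<Rightarrow> (real \<Rightarrow> real \<Rightarrow> real) \<Rightarrow> (real \<Rightarrow> real \<Rightarrow> real)
    \<Rightarrow> (real \<Rightarrow> real \<Rightarrow> real) \<Rightarrow> real \<Rightarrow> real \<Rightarrow> real" where
  "qvar K cv \<gamma> u \<tau> S t x =
     mvar cv S t x powr (- (3 * (3 - \<gamma>) / (2 * (3 * \<gamma> - 1))))
     * zvar K \<gamma> \<tau> t x powr ((\<gamma> + 1) / (2 * (\<gamma> - 1)))
     * (Dx (\<lambda>t x. u t x - mvar cv S t x * zvar K \<gamma> \<tau> t x) t x
        + 2 / (3 * \<gamma> - 1) * Dx (mvar cv S) t x * zvar K \<gamma> \<tau> t x)"

definition K_tau :: "real \<Rightarrow> real \<Rightarrow> real" where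
  "K_tau K \<gamma> = (2 * sqrt (K * \<gamma>) / (\<gamma> - 1)) powr (2 / (\<gamma> - 1))"

definition K_c :: "real \<Rightarrow> real \<Rightarrow> real" where
  "K_c K \<gamma> = sqrt (K * \<gamma>) * K_tau K \<gamma> powr (- ((\<gamma> + 1) / 2))"

definition a2 :: "real \<Rightarrow> real \<Rightarrow> real \<Rightarrow> real \<Rightarrow> real" where
  "a2 K \<gamma> z m =
     - K_c K \<gamma> * ((\<gamma> + 1) / (2 * (\<gamma> - 1)))
     * m powr (3 * (3 - \<gamma>) / (2 * (3 * \<gamma> - 1)))
     * z powr ((\<gamma> + 1) / (2 * (\<gamma> - 1)) - 1)"

definition min_neg_a2 :: "real \<Rightarrow> real \<Rightarrow> real \<Rightarrow> real \<Rightarrow> real \<Rightarrow> real \<Rightarrow> real" where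
  "min_neg_a2 K \<gamma> ZL ZU M1 M2 = (INF (z, m) \<in> {ZL..ZU} \<times> {M1..M2}. - a2 K \<gamma> z m)"

definition bounds :: "real \<Rightarrow> real \<Rightarrow> real \<Rightarrow> ereal \<Rightarrow> (real \<Rightarrow> real \<Rightarrow> real) \<Rightarrow> (real \<Rightarrow> real \<Rightarrow> real)
    \<Rightarrow> real \<Rightarrow> real \<Rightarrow> real \<Rightarrow> real \<Rightarrow> real \<Rightarrow> real \<Rightarrow> bool" where
  "bounds K cv \<gamma> T \<tau> S ZL ZU M1 M2 M3 M4 \<longleftrightarrow>
     0 < ZL \<and> 0 < ZU \<and> 0 < M1 \<and> 0 < M2 \<and> 0 < M3 \<and> 0 < M4 \<and>
     (\<forall>t\<in>lifespan T. \<forall>x. ZL < zvar K \<gamma> \<tau> t x \<and> zvar K \<gamma> \<tau> t x < ZU) \<and>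
     (\<forall>x. M1 < mvar cv S 0 x \<and> mvar cv S 0 x < M2 \<and>
          \<bar>Dx (mvar cv S) 0 x\<bar> < M3 \<and> \<bar>Dx (Dx (mvar cv S)) 0 x\<bar> < M4)"

definition entropy_xx :: "real \<Rightarrow> real \<Rightarrow> (real \<Rightarrow> real \<Rightarrow> real) \<Rightarrow> real \<Rightarrow> real" where
  "entropy_xx cv \<gamma> S x = Dx (Dx (\<lambda>t x. mvar cv S t x powr (- (2 / (3 * \<gamma> - 1))))) 0 x"

text \<open>Blow-up at time \<open>Ts\<close> is localised in space: \<open>f\<close> is unbounded as \<open>(t, x)\<close> tends to some
  \<open>(Ts, x0)\<close> with \<open>t < Ts\<close>. Unboundedness of \<open>f t\<close> as \<open>x\<close> tends to infinity does not count.\<close>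

definition blows_up_at :: "real \<Rightarrow> (real \<Rightarrow> real \<Rightarrow> real) \<Rightarrow> bool" where
  "blows_up_at Ts f \<longleftrightarrow>
     (\<exists>x0. \<forall>B. \<forall>\<delta>>0. \<exists>t x. 0 \<le> t \<and> Ts - \<delta> < t \<and> t < Ts \<and> \<bar>x - x0\<bar> < \<delta> \<and> B < \<bar>f t x\<bar>)"

text \<open>The smooth solution on \<open>[0, Ts)\<close> remains smooth at time \<open>Ts\<close>.\<close>

definition smooth_up_to :: "real \<Rightarrow> real \<Rightarrow> real \<Rightarrow> real \<Rightarrow> (real \<Rightarrow> real \<Rightarrow> real)
    \<Rightarrow> (real \<Rightarrow> real \<Rightarrow> real) \<Rightarrow> (real \<Rightarrow> real \<Rightarrow> real) \<Rightarrow> bool" where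
  "smooth_up_to K cv \<gamma> Ts u \<tau> S \<longleftrightarrow>
     (\<exists>u' \<tau>' S'. smooth_solution K cv \<gamma> {0..Ts} u' \<tau>' S' \<and>
        (\<forall>t\<in>{0..<Ts}. \<forall>x. u' t x = u t x \<and> \<tau>' t x = \<tau> t x \<and> S' t x = S t x))"

text \<open>A smooth solution on \<open>[0, T)\<close> may have been stopped before it breaks down, in which case
  only the upper bound on \<open>T\<close> is claimed. If smoothness is really lost at \<open>T\<close>, this happens
  through blow-up of a first derivative.\<close>

definition gradient_blowup_by :: "real \<Rightarrow> real \<Rightarrow> real \<Rightarrow> ereal \<Rightarrow> (real \<Rightarrow> real \<Rightarrow> real)
    \<Rightarrow> (real \<Rightarrow> real \<Rightarrow> real) \<Rightarrow> (real \<Rightarrow> real \<Rightarrow> real) \<Rightarrow> real \<Rightarrow> bool" where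
  "gradient_blowup_by K cv \<gamma> T u \<tau> S Tb \<longleftrightarrow>
     (\<exists>Ts. T = ereal Ts \<and> 0 < Ts \<and> Ts \<le> Tb \<and>
        (\<not> smooth_up_to K cv \<gamma> Ts u \<tau> S \<longrightarrow> blows_up_at Ts (Dx u) \<or> blows_up_at Ts (Dx \<tau>)))"

end

theory Submission
  imports Defs
begin

text \<open>The entropy of a smooth solution does not change in time, so \<open>m\<close> depends on \<open>x\<close> only. Let
  \<open>c\<close> be the Lagrangian speed of sound and \<open>\<sigma> = 1\<close> or \<open>\<sigma> = - 1\<close>. Along the sound waves
  \<open>dx/dt = \<sigma> c\<close> the Riemann gradient \<open>\<alpha>\<^sub>\<sigma> = u\<^sub>x - \<sigma> u\<^sub>t / c\<close> satisfies an equation that is quadratic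
  in \<open>\<alpha>\<^sub>\<sigma>\<close> and \<open>\<alpha>\<^sub>-\<^sub>\<sigma>\<close> (\<open>riemann_transport\<close>). The variables \<open>y\<close> (for \<open>\<sigma> = 1\<close>) and \<open>q\<close> (for \<open>\<sigma> = - 1\<close>)
  arise from \<open>\<alpha>\<^sub>\<sigma>\<close> by adding a multiple of \<open>m\<^sub>x\<close> and rescaling, in such a way that the wave of the
  other family disappears: they satisfy \<open>Y' = a\<^sub>2 Y\<^sup>2 + a\<^sub>0\<close> (\<open>Y_riccati\<close>), where \<open>a\<^sub>0\<close> has the sign
  of \<open>- (m powr (- 2 / (3 \<gamma> - 1)))\<^sub>x\<^sub>x\<close> (\<open>entropy_xx_eq\<close>). A wave of the family \<open>\<sigma>\<close> that starts at
  \<open>A*\<close> travels away from \<open>A\<close> and remains where \<open>a\<^sub>0 \<le> 0\<close>. There \<open>1 / Y\<close> grows at least at the rate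
  \<open>min (- a\<^sub>2)\<close>, hence a negative \<open>Y\<close> would reach \<open>- \<infinity>\<close> by the asserted time, and the solution
  cannot be smooth for longer (\<open>lifespan_bound\<close>). Boundedness of \<open>c\<close> ensures that the wave exists
  as long as the solution does.

  It remains to see that smoothness can only be lost through a first derivative
  (\<open>smooth_continuation\<close>). Suppose that \<open>u\<^sub>x\<close> and \<open>\<tau>\<^sub>x\<close> are bounded near every point of the line
  \<open>t = Ts\<close>. The tool is \<open>limit_along_characteristics\<close>: a continuous field whose rate of change along
  characteristics is bounded near \<open>(Ts, x0)\<close> has a limit there. It applies to \<open>\<tau>\<close> and \<open>u\<close> along
  the lines \<open>x = const\<close>, then to \<open>\<alpha>\<^sub>\<sigma>\<close> along sound waves, which gives the limits of all first
  derivatives. For the second derivatives the equation for \<open>\<alpha>\<^sub>\<sigma>\<close> is differentiated in time. As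
  the entropy is stationary, no derivative of \<open>S\<close> beyond the second order appears in this way,
  whereas a derivative in \<open>x\<close> would require a third one. The resulting equations for
  \<open>\<partial>\<^sub>t \<alpha>\<^sub>\<sigma>\<close> are linear with bounded coefficients, so these fields are bounded near \<open>(Ts, x0)\<close>
  (\<open>bounded_along_sound_waves\<close>) and then have limits by the same tool. Every second derivative of
  \<open>u\<close> and \<open>\<tau>\<close> is an algebraic expression in \<open>\<partial>\<^sub>t \<alpha>\<^sub>\<sigma>\<close> and quantities that are already under
  control. Therefore the solution extends to \<open>t = Ts\<close> as a \<open>C\<^sup>2\<close> field, and the equations persist
  by continuity.\<close>

section \<open>Fields with continuous partial derivatives\<close>

text \<open>The partial derivatives are explicit arguments, which allows computing with them. Time
  derivatives are relative to \<open>J\<close>, as in \<^const>\<open>Dt\<close>.\<close>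

definition C1_partials ::
    "real set \<Rightarrow> (real \<Rightarrow> real \<Rightarrow> real) \<Rightarrow> (real \<Rightarrow> real \<Rightarrow> real) \<Rightarrow> (real \<Rightarrow> real \<Rightarrow> real) \<Rightarrow> bool" where
  "C1_partials J f ft fx \<longleftrightarrow>
     (\<forall>t\<in>J. \<forall>x. ((\<lambda>s. f s x) has_real_derivative ft t x) (at t within J) \<and>
                (f t has_real_derivative fx t x) (at x)) \<and>
     continuous_on (J \<times> UNIV) (\<lambda>(t, x). f t x) \<and>
     continuous_on (J \<times> UNIV) (\<lambda>(t, x). ft t x) \<and>
     continuous_on (J \<times> UNIV) (\<lambda>(t, x). fx t x)"

lemma C1_partialsD:
  assumes "C1_partials J f ft fx"
  shows "t \<in> J \<Longrightarrow> ((\<lambda>s. f s x) has_real_derivative ft t x) (at t within J)"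
    and "t \<in> J \<Longrightarrow> (f t has_real_derivative fx t x) (at x)"
    and "continuous_on (J \<times> UNIV) (\<lambda>(t, x). f t x)"
    and "continuous_on (J \<times> UNIV) (\<lambda>(t, x). ft t x)"
    and "continuous_on (J \<times> UNIV) (\<lambda>(t, x). fx t x)"
  using assms by (auto simp: C1_partials_def)

lemma C1_on_imp_C1_partials:
  assumes "C1_on J f"
  shows "C1_partials J f (Dt J f) (Dx f)"
proof -
  have "((\<lambda>s. f s x) has_real_derivative Dt J f t x) (at t within J)" if "t \<in> J" for t x
    using assms that vector_derivative_works[of "\<lambda>s. f s x" "at t within J"]
    by (auto simp: C1_on_def Dt_def has_real_derivative_iff_has_vector_derivative)
  moreover have "(f t has_real_derivative Dx f t x) (at x)" if "t \<in> J" for t x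
    using assms that DERIV_deriv_iff_real_differentiable[of "f t" x]
    by (auto simp: C1_on_def Dx_def)
  ultimately show ?thesis
    using assms by (auto simp: C1_on_def C1_partials_def)
qed

lemma Dx_eqI: "(f t has_real_derivative d) (at x) \<Longrightarrow> Dx f t x = d"
  by (simp add: Dx_def DERIV_imp_deriv)

lemma Dt_eqI:
  "((\<lambda>s. f s x) has_real_derivative d) (at t within J) \<Longrightarrow> at t within J \<noteq> bot \<Longrightarrow> Dt J f t x = d"
  unfolding Dt_def
  by (rule vector_derivative_within) (auto simp: has_real_derivative_iff_has_vector_derivative)

lemma C1_partials_Dt:
  "C1_partials J f ft fx \<Longrightarrow> t \<in> J \<Longrightarrow> at t within J \<noteq> bot \<Longrightarrow> Dt J f t x = ft t x"
  by (rule Dt_eqI) (auto simp: C1_partials_def)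

lemma C1_partials_Dx: "C1_partials J f ft fx \<Longrightarrow> t \<in> J \<Longrightarrow> Dx f t x = fx t x"
  by (rule Dx_eqI) (auto simp: C1_partials_def)

lemma DERIV_unique_within:
  fixes f :: "real \<Rightarrow> real"
  shows "(f has_real_derivative a) (at t within J) \<Longrightarrow> (f has_real_derivative b) (at t within J) \<Longrightarrow>
   at t within J \<noteq> bot \<Longrightarrow> a = b"
  by (metis has_real_derivative_iff_has_vector_derivative vector_derivative_within)

lemma continuous_on_field_cong:
  assumes "continuous_on (J \<times> UNIV) (\<lambda>(t, x). f t x)" and "\<And>t x. t \<in> J \<Longrightarrow> g t x = f t x"
  shows "continuous_on (J \<times> UNIV) (\<lambda>(t, x). g t x)"
  by (rule continuous_on_eq[OF assms(1)]) (auto simp: assms(2))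

lemma has_real_derivative_transform:
  "(f has_real_derivative d) (at x within S) \<Longrightarrow> x \<in> S \<Longrightarrow> (\<And>y. y \<in> S \<Longrightarrow> g y = f y) \<Longrightarrow>
   (g has_real_derivative d) (at x within S)"
  unfolding has_field_derivative_def by (rule has_derivative_transform)

lemma C1_partials_imp_C1_on:
  assumes f: "C1_partials J f ft fx" and J: "\<And>t. t \<in> J \<Longrightarrow> at t within J \<noteq> bot"
  shows "C1_on J f"
proof -
  have eqs: "Dt J f t x = ft t x" "Dx f t x = fx t x" if "t \<in> J" for t x
    using C1_partialsD(1,2)[OF f that] J[OF that] Dt_eqI Dx_eqI by blast+
  have "continuous_on (J \<times> UNIV) (\<lambda>(t, x). Dt J f t x)"
    "continuous_on (J \<times> UNIV) (\<lambda>(t, x). Dx f t x)"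
    by (rule continuous_on_field_cong[OF C1_partialsD(4)[OF f] eqs(1)]
        continuous_on_field_cong[OF C1_partialsD(5)[OF f] eqs(2)], assumption)+
  moreover have "(\<lambda>s. f s x) differentiable (at t within J) \<and> (\<lambda>y. f t y) differentiable (at x)"
    if "t \<in> J" for t x
    using C1_partialsD(1,2)[OF f that] real_differentiable_def by blast
  ultimately show ?thesis
    using C1_partialsD(3)[OF f] by (auto simp: C1_on_def)
qed

lemma C1_partials_cong:
  assumes f: "C1_partials J f ft fx"
    and "\<And>t x. t \<in> J \<Longrightarrow> g t x = f t x"
    and "\<And>t x. t \<in> J \<Longrightarrow> gt t x = ft t x"
    and "\<And>t x. t \<in> J \<Longrightarrow> gx t x = fx t x"
  shows "C1_partials J g gt gx"
proof -
  have "((\<lambda>s. g s x) has_real_derivative gt t x) (at t within J)" if "t \<in> J" for t x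
    unfolding assms(3)[OF that]
    by (rule has_real_derivative_transform[OF C1_partialsD(1)[OF f that] that]) (rule assms(2))
  moreover have "(g t has_real_derivative gx t x) (at x)" if "t \<in> J" for t x
  proof -
    have "g t = f t" using assms(2) that by auto
    then show ?thesis using C1_partialsD(2)[OF f that] assms(4) that by simp
  qed
  ultimately show ?thesis
    using continuous_on_field_cong[OF C1_partialsD(3)[OF f] assms(2)]
      continuous_on_field_cong[OF C1_partialsD(4)[OF f] assms(3)]
      continuous_on_field_cong[OF C1_partialsD(5)[OF f] assms(4)]
    unfolding C1_partials_def by blast
qed

lemma C1_partials_const: "C1_partials J (\<lambda>t x. k) (\<lambda>t x. 0) (\<lambda>t x. 0)"
  by (auto simp: C1_partials_def)

lemma C1_partials_add:
  "C1_partials J f ft fx \<Longrightarrow> C1_partials J g gt gx \<Longrightarrow>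
   C1_partials J (\<lambda>t x. f t x + g t x) (\<lambda>t x. ft t x + gt t x) (\<lambda>t x. fx t x + gx t x)"
  unfolding C1_partials_def
  by (auto simp: case_prod_unfold intro!: derivative_eq_intros continuous_intros)

lemma C1_partials_mult:
  "C1_partials J f ft fx \<Longrightarrow> C1_partials J g gt gx \<Longrightarrow>
   C1_partials J (\<lambda>t x. f t x * g t x) (\<lambda>t x. ft t x * g t x + f t x * gt t x)
     (\<lambda>t x. fx t x * g t x + f t x * gx t x)"
  unfolding C1_partials_def
  by (auto simp: case_prod_unfold intro!: derivative_eq_intros continuous_intros)

lemma C1_partials_chain:
  assumes f: "C1_partials J f ft fx"
    and \<phi>: "\<And>t x. t \<in> J \<Longrightarrow> (\<phi> has_real_derivative \<phi>' (f t x)) (at (f t x))"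
    and cont: "continuous_on ((\<lambda>(t, x). f t x) ` (J \<times> UNIV)) \<phi>'"
  shows "C1_partials J (\<lambda>t x. \<phi> (f t x)) (\<lambda>t x. \<phi>' (f t x) * ft t x) (\<lambda>t x. \<phi>' (f t x) * fx t x)"
proof -
  have "continuous_on ((\<lambda>(t, x). f t x) ` (J \<times> UNIV)) \<phi>"
    using DERIV_isCont[OF \<phi>] by (intro continuous_at_imp_continuous_on) auto
  from continuous_on_compose[OF C1_partialsD(3)[OF f] this]
    continuous_on_compose[OF C1_partialsD(3)[OF f] cont]
  have *: "continuous_on (J \<times> UNIV) (\<lambda>(t, x). \<phi> (f t x))"
    "continuous_on (J \<times> UNIV) (\<lambda>(t, x). \<phi>' (f t x))"
    by (simp_all add: o_def case_prod_unfold)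
  have "((\<lambda>s. \<phi> (f s x)) has_real_derivative \<phi>' (f t x) * ft t x) (at t within J)"
    "((\<lambda>y. \<phi> (f t y)) has_real_derivative \<phi>' (f t x) * fx t x) (at x)" if "t \<in> J" for t x
    using DERIV_chain2[OF \<phi>[OF that] C1_partialsD(1)[OF f that]]
      DERIV_chain2[OF \<phi>[OF that] C1_partialsD(2)[OF f that]] by auto
  then show ?thesis
    using C1_partialsD(3-5)[OF f] *
    unfolding C1_partials_def by (auto simp: case_prod_unfold intro!: continuous_intros)
qed

lemma C1_partials_exp:
  "C1_partials J f ft fx \<Longrightarrow>
   C1_partials J (\<lambda>t x. exp (f t x)) (\<lambda>t x. exp (f t x) * ft t x) (\<lambda>t x. exp (f t x) * fx t x)"
  by (rule C1_partials_chain) (auto intro!: derivative_eq_intros continuous_intros)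

lemma C1_partials_powr:
  assumes "C1_partials J f ft fx" and "\<And>t x. t \<in> J \<Longrightarrow> 0 < f t x"
  shows "C1_partials J (\<lambda>t x. f t x powr r) (\<lambda>t x. r * f t x powr (r - 1) * ft t x)
           (\<lambda>t x. r * f t x powr (r - 1) * fx t x)"
proof (rule C1_partials_chain[OF assms(1)])
  show "((\<lambda>y. y powr r) has_real_derivative r * f t x powr (r - 1)) (at (f t x))" if "t \<in> J" for t x
    using assms(2)[OF that] by (auto intro!: derivative_eq_intros)
  have "\<forall>y\<in>(\<lambda>(t, x). f t x) ` (J \<times> UNIV). y \<noteq> 0"
    using less_imp_neq[OF assms(2), THEN not_sym] by auto
  then show "continuous_on ((\<lambda>(t, x). f t x) ` (J \<times> UNIV)) (\<lambda>y. r * y powr (r - 1))"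
    by (intro continuous_intros) auto
qed

text \<open>The chain rule along a curve: continuity of the partial derivatives makes the field
  totally differentiable.\<close>

lemma C1_partials_along:
  assumes f: "C1_partials J f ft fx" and "I \<subseteq> J" and "t \<in> I"
    and X: "(X has_real_derivative v) (at t within I)"
  shows "((\<lambda>r. f r (X r)) has_real_derivative ft t (X t) + v * fx t (X t)) (at t within I)"
proof -
  have tJ: "t \<in> J" using assms by auto
  have F: "((\<lambda>(t, x). f t x) has_derivative (\<lambda>(ts, xs). ft t (X t) * ts + blinfun_mult_right (fx t (X t)) xs))
          (at (t, X t) within J \<times> UNIV)"
  proof (rule has_derivative_partialsI[where fy = "\<lambda>t x. blinfun_mult_right (fx t x)"])
    show "((\<lambda>s. f s (X t)) has_derivative (*) (ft t (X t))) (at t within J)"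
      using C1_partialsD(1)[OF f tJ, of "X t"] by (simp add: has_field_derivative_def)
    show "(f s has_derivative blinfun_mult_right (fx s y)) (at y within UNIV)" if "s \<in> J" for s y
      using C1_partialsD(2)[OF f that] by (simp add: has_field_derivative_def)
    have "continuous_on (J \<times> UNIV) (\<lambda>(x, y). blinfun_mult_right (fx x y))"
      using C1_partialsD(5)[OF f]
      by (auto simp: case_prod_unfold intro!: bounded_linear.continuous_on[OF bounded_linear_blinfun_mult_right])
    then show "continuous (at (t, X t) within J \<times> UNIV) (\<lambda>(x, y). blinfun_mult_right (fx x y))"
      using tJ by (auto simp: continuous_on_eq_continuous_within)
  qed auto
  have P: "((\<lambda>r. (r, X r)) has_derivative (\<lambda>h. (h, v * h))) (at t within I)"
    using X by (auto simp: has_field_derivative_def intro!: derivative_eq_intros)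
  have "(\<lambda>r. (r, X r)) ` I \<subseteq> J \<times> UNIV"
    using assms(2) by auto
  from has_derivative_in_compose[OF P has_derivative_subset[OF F this]]
  have "((\<lambda>r. f r (X r)) has_derivative (\<lambda>h. ft t (X t) * h + fx t (X t) * (v * h))) (at t within I)"
    by simp
  moreover have "(\<lambda>h. ft t (X t) * h + fx t (X t) * (v * h)) = (*) (ft t (X t) + v * fx t (X t))"
    by (auto simp: fun_eq_iff algebra_simps)
  ultimately show ?thesis
    by (simp add: has_field_derivative_def)
qed

lemma nontrivial_interval_neighbour:
  fixes t :: real
  assumes "is_interval J" "t \<in> J" "at t within J \<noteq> bot"
  obtains a b where "a < b" "t \<in> {a..b}" "{a..b} \<subseteq> J"
proof -
  obtain s where s: "s \<in> J" "s \<noteq> t"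
    using assms(3)
    unfolding trivial_limit_within not_not by (rule islimptE[OF _ UNIV_I open_UNIV])
  have "{min s t..max s t} \<subseteq> J"
    using mem_is_interval_1_I[OF assms(1) s(1) assms(2)] mem_is_interval_1_I[OF assms(1,2) s(1)]
    by (cases "s \<le> t") auto
  moreover have "min s t < max s t" "t \<in> {min s t..max s t}"
    using s by auto
  ultimately show thesis using that by blast
qed

lemma continuous_on_slice:
  assumes "continuous_on (J \<times> UNIV) (\<lambda>(t, x). f t x)" and "I \<subseteq> J"
  shows "continuous_on I (\<lambda>t. f t x)"
proof -
  have "continuous_on I (\<lambda>t. case (t, x) of (t, x) \<Rightarrow> f t x)"
    by (rule continuous_on_compose2[OF assms(1)]) (use assms(2) in \<open>auto intro!: continuous_intros\<close>)
  then show ?thesis by simp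
qed

text \<open>Symmetry of the mixed second derivatives: \<open>f\<^sub>x(t, x) - f\<^sub>x(a, x)\<close> is the integral over
  time of \<open>f\<^sub>t\<^sub>x\<close>, by differentiation under the integral sign.\<close>

lemma mixed_partials_eq:
  assumes f: "C1_partials J f ft fx" and ft: "C1_partials J ft ftt ftx"
    and fx: "C1_partials J fx fxt fxx"
    and J: "is_interval J" "at t within J \<noteq> bot" and t: "t \<in> J"
  shows "fxt t x = ftx t x"
proof -
  obtain a b where ab: "a < b" "t \<in> {a..b}" "{a..b} \<subseteq> J"
    using nontrivial_interval_neighbour[OF J(1) t J(2)] .
  have ft_int: "(\<lambda>s. ft s y) integrable_on {a..r}" if "r \<in> {a..b}" for r y
    by (rule integrable_continuous_interval, rule continuous_on_slice[OF C1_partialsD(3)[OF ft]])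
      (use that ab in auto)
  have eq: "fx r x - fx a x = integral {a..r} (\<lambda>s. ftx s x)" if r: "r \<in> {a..b}" for r
  proof -
    have sub: "{a..r} \<subseteq> J" using r ab by auto
    have deriv: "((\<lambda>s. f s y) has_vector_derivative ft s y) (at s within {a..r})" if "s \<in> {a..r}" for s y
      unfolding has_real_derivative_iff_has_vector_derivative[symmetric]
      by (rule DERIV_subset[OF C1_partialsD(1)[OF f] sub]) (use sub that in auto)
    have int: "(\<lambda>y. integral (cbox a r) (\<lambda>s. ft s y)) = (\<lambda>y. f r y - f a y)"
      unfolding cbox_interval fun_eq_iff
    proof
      fix y
      show "integral {a..r} (\<lambda>s. ft s y) = f r y - f a y"
      by (rule integral_unique[OF fundamental_theorem_of_calculus[OF _ deriv]]) (use r in auto)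
    qed
    have "((\<lambda>y. integral (cbox a r) (\<lambda>s. ft s y)) has_real_derivative
        integral (cbox a r) (\<lambda>s. ftx s x)) (at x within UNIV)"
    proof (rule leibniz_rule_field_derivative)
      show "((\<lambda>y. ft s y) has_real_derivative ftx s y) (at y within UNIV)" if "s \<in> cbox a r" for y s
        using C1_partialsD(2)[OF ft] that sub by auto
      show "(\<lambda>s. ft s y) integrable_on cbox a r" for y using ft_int r by auto
      have "continuous_on (J \<times> UNIV) (\<lambda>p. ftx (fst p) (snd p))"
        using C1_partialsD(5)[OF ft] by (simp add: case_prod_unfold)
      then have "continuous_on (UNIV \<times> {a..r}) (\<lambda>p. ftx (fst (snd p, fst p)) (snd (snd p, fst p)))"
        by (rule continuous_on_compose2) (use sub in \<open>auto intro!: continuous_intros\<close>)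
      then show "continuous_on (UNIV \<times> cbox a r) (\<lambda>(x, t). ftx t x)"
        by (simp add: case_prod_unfold)
    qed auto
    moreover have "((\<lambda>y. f r y - f a y) has_real_derivative fx r x - fx a x) (at x)"
      by (intro DERIV_diff C1_partialsD(2)[OF f]) (use r ab(3) in auto)
    ultimately show ?thesis
      unfolding int by (simp add: DERIV_unique)
  qed
  have "((\<lambda>r. fx a x + integral {a..r} (\<lambda>s. ftx s x)) has_real_derivative ftx t x) (at t within {a..b})"
    using DERIV_add[OF DERIV_const
        integral_has_real_derivative[OF continuous_on_slice[OF C1_partialsD(5)[OF ft] ab(3)] ab(2)]]
    by simp
  then have "((\<lambda>r. fx r x) has_real_derivative ftx t x) (at t within {a..b})"
    using ab(2)
    by (rule has_real_derivative_transform) (simp add: eq[symmetric])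
  moreover have "((\<lambda>r. fx r x) has_real_derivative fxt t x) (at t within {a..b})"
    using DERIV_subset[OF C1_partialsD(1)[OF fx t] ab(3)] .
  moreover have "at t within {a..b} \<noteq> bot"
    using ab by (simp add: trivial_limit_within)
  ultimately show ?thesis
    using DERIV_unique_within by blast
qed

section \<open>Existence of characteristics\<close>

lemma field_bounded_on_compact:
  fixes f :: "real \<Rightarrow> real \<Rightarrow> real"
  assumes "continuous_on (J \<times> UNIV) (\<lambda>(t, x). f t x)" and "{a..b} \<subseteq> J"
  obtains L where "\<And>t x. t \<in> {a..b} \<Longrightarrow> x \<in> {c..d} \<Longrightarrow> \<bar>f t x\<bar> \<le> L" "0 \<le> L"
proof -
  have "compact ((\<lambda>(t, x). f t x) ` ({a..b} \<times> {c..d}))"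
    by (intro compact_continuous_image continuous_on_subset[OF assms(1)] compact_Times)
      (use assms(2) in auto)
  then obtain L where "\<forall>y\<in>(\<lambda>(t, x). f t x) ` ({a..b} \<times> {c..d}). norm y \<le> L"
    using compact_imp_bounded bounded_iff by blast
  then have "\<bar>f t x\<bar> \<le> max L 0" if "t \<in> {a..b}" "x \<in> {c..d}" for t x
    using that by force
  then show thesis
    using that[of "max L 0"] by auto
qed

text \<open>The Picard iteration, for a right-hand side with a global Lipschitz constant. In the norm
  weighted by \<open>exp (- 2 w (t - a))\<close> each step halves the distance, whatever the length of the
  interval.\<close>

lemma picard_forward:
  fixes f :: "real \<Rightarrow> real \<Rightarrow> real"
  assumes cont: "continuous_on ({a..b} \<times> UNIV) (\<lambda>(t, x). f t x)"
    and lip: "\<And>t x y. t \<in> {a..b} \<Longrightarrow> \<bar>f t x - f t y\<bar> \<le> L * \<bar>x - y\<bar>" and ab: "a \<le> b"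
  shows "\<exists>X. X a = x0 \<and> (\<forall>t\<in>{a..b}. (X has_real_derivative f t (X t)) (at t within {a..b}))"
proof -
  \<comment> \<open>Any positive Lipschitz constant will do; positivity permits division by it.\<close>
  define w where "w = max L 1"
  have w: "0 < w" "L \<le> w" by (auto simp: w_def)
  have lip: "\<bar>f t x - f t y\<bar> \<le> w * \<bar>x - y\<bar>" if "t \<in> {a..b}" for t x y
    using lip[OF that, of x y] mult_right_mono[OF w(2), of "\<bar>x - y\<bar>"] by simp
  have cont_f: "continuous_on {a..b} (\<lambda>s. f s (Y s))" if "continuous_on {a..b} Y" for Y
  proof -
    have "continuous_on {a..b} (\<lambda>s. case (s, Y s) of (t, x) \<Rightarrow> f t x)"
      by (rule continuous_on_compose2[OF cont]) (use that in \<open>auto intro!: continuous_intros\<close>)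
    then show ?thesis by simp
  qed
  define X where "X = rec_nat (\<lambda>t. x0) (\<lambda>n Y t. x0 + integral {a..t} (\<lambda>s. f s (Y s)))"
  have X_Suc: "X (Suc n) t = x0 + integral {a..t} (\<lambda>s. f s (X n s))" for n t
    by (simp add: X_def)
  have cont_X: "continuous_on {a..b} (X n)" for n
  proof (induction n)
    case (Suc n)
    have "continuous_on {a..b} (\<lambda>t. x0 + integral {a..t} (\<lambda>s. f s (X n s)))"
      by (intro continuous_intros indefinite_integral_continuous_1 integrable_continuous_interval
          cont_f Suc)
    then show ?case by (simp add: X_Suc[abs_def])
  qed (simp add: X_def)
  have int_f: "(\<lambda>s. f s (X n s)) integrable_on {a..t}" if "t \<in> {a..b}" for n t
    using that by (intro integrable_continuous_interval continuous_on_subset[OF cont_f[OF cont_X]]) auto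
  have "compact ((\<lambda>t. X 1 t - X 0 t) ` {a..b})"
    by (intro compact_continuous_image continuous_intros cont_X) auto
  then obtain M where "\<forall>y\<in>(\<lambda>t. X 1 t - X 0 t) ` {a..b}. norm y \<le> M"
    using compact_imp_bounded bounded_iff by blast
  then have M: "\<bar>X 1 t - X 0 t\<bar> \<le> M" if "t \<in> {a..b}" for t
    using that by auto
  have M0: "0 \<le> M"
    using M[of a] ab by simp
  have step: "\<bar>X (Suc n) t - X n t\<bar> \<le> M * exp (2 * w * (t - a)) / 2 ^ n" if "t \<in> {a..b}" for n t
    using that
  proof (induction n arbitrary: t)
    case 0
    then have "M * 1 \<le> M * exp (2 * w * (t - a))"
      using M0 w(1) by (intro mult_left_mono) auto
    then show ?case using M[OF 0] by simp
  next
    case (Suc n)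
    have "((\<lambda>s. w * (M * exp (2 * w * (s - a)) / 2 ^ n)) has_integral
        (M * exp (2 * w * (t - a)) / 2 ^ Suc n - M * exp (2 * w * (a - a)) / 2 ^ Suc n)) {a..t}"
      using Suc.prems w(1)
      by (intro fundamental_theorem_of_calculus)
        (auto intro!: derivative_eq_intros simp: has_real_derivative_iff_has_vector_derivative[symmetric])
    then have I: "((\<lambda>s. w * (M * exp (2 * w * (s - a)) / 2 ^ n)) has_integral
        (M * exp (2 * w * (t - a)) / 2 ^ Suc n - M / 2 ^ Suc n)) {a..t}" by simp
    have "norm (integral {a..t} (\<lambda>s. f s (X (Suc n) s) - f s (X n s)))
       \<le> integral {a..t} (\<lambda>s. w * (M * exp (2 * w * (s - a)) / 2 ^ n))"
    proof (rule integral_norm_bound_integral)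
      show "(\<lambda>s. f s (X (Suc n) s) - f s (X n s)) integrable_on {a..t}"
        by (intro integrable_diff int_f Suc.prems)
      show "(\<lambda>s. w * (M * exp (2 * w * (s - a)) / 2 ^ n)) integrable_on {a..t}"
        using I by blast
      show "norm (f s (X (Suc n) s) - f s (X n s)) \<le> w * (M * exp (2 * w * (s - a)) / 2 ^ n)"
        if "s \<in> {a..t}" for s
      proof -
        have s: "s \<in> {a..b}" using that Suc.prems by auto
        show ?thesis
          using lip[OF s, of "X (Suc n) s" "X n s"] mult_left_mono[OF Suc.IH[OF s], of w] w(1) by simp
      qed
    qed
    also have "\<dots> \<le> M * exp (2 * w * (t - a)) / 2 ^ Suc n"
      using integral_unique[OF I] M0 by simp
    finally show ?case
      unfolding X_Suc[of "Suc n"] X_Suc[of n]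
      using integral_diff[OF int_f[OF Suc.prems, of "Suc n"] int_f[OF Suc.prems, of n]]
      by (simp add: X_Suc)
  qed
  define D where "D = (\<lambda>n t. X (Suc n) t - X n t)"
  define Y where "Y t = x0 + (\<Sum>n. D n t)" for t
  have sum_D: "x0 + (\<Sum>i<n. D i t) = X n t" for n t
    using sum_lessThan_telescope[of "\<lambda>n. X n t" n] by (simp add: D_def) (simp add: X_def)
  have "uniform_limit {a..b} (\<lambda>n t. \<Sum>i<n. D i t) (\<lambda>t. \<Sum>n. D n t) sequentially"
  proof (rule Weierstrass_m_test)
    show "norm (D n t) \<le> M * exp (2 * w * (b - a)) * (1 / 2) ^ n" if "t \<in> {a..b}" for n t
    proof -
      have "M * exp (2 * w * (t - a)) \<le> M * exp (2 * w * (b - a))"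
        using that w(1) M0 by (intro mult_left_mono) auto
      then have "M * exp (2 * w * (t - a)) / 2 ^ n \<le> M * exp (2 * w * (b - a)) / 2 ^ n"
        by (rule divide_right_mono) auto
      then show ?thesis
        using step[OF that, of n] by (simp add: D_def power_divide)
    qed
    show "summable (\<lambda>n. M * exp (2 * w * (b - a)) * (1 / 2) ^ n)"
      by (intro summable_mult summable_geometric) auto
  qed
  then have "uniform_limit {a..b} (\<lambda>n t. x0 + (\<Sum>i<n. D i t)) Y sequentially"
    unfolding Y_def by (intro uniform_limit_add uniform_limit_const)
  then have ulim: "uniform_limit {a..b} X Y sequentially"
    by (simp add: sum_D)
  have cont_Y: "continuous_on {a..b} Y"
    by (rule uniform_limit_theorem[OF always_eventually[OF allI[OF cont_X]] ulim]) simp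
  have ulim_f: "uniform_limit {a..b} (\<lambda>n s. f s (X n s)) (\<lambda>s. f s (Y s)) sequentially"
  proof (rule uniform_limitI)
    fix e :: real assume "0 < e"
    then have "\<forall>\<^sub>F n in sequentially. \<forall>s\<in>{a..b}. dist (X n s) (Y s) < e / w"
      using w(1) by (intro uniform_limitD[OF ulim]) auto
    then show "\<forall>\<^sub>F n in sequentially. \<forall>s\<in>{a..b}. dist (f s (X n s)) (f s (Y s)) < e"
    proof eventually_elim
      case (elim n)
      show ?case
      proof
        fix s assume s: "s \<in> {a..b}"
        have "w * \<bar>X n s - Y s\<bar> < e"
          using elim[rule_format, OF s] w(1) by (simp add: dist_real_def field_simps)
        then show "dist (f s (X n s)) (f s (Y s)) < e"
          using lip[OF s, of "X n s" "Y s"] by (simp add: dist_real_def)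
      qed
    qed
  qed
  have fix_Y: "Y t = x0 + integral {a..t} (\<lambda>s. f s (Y s))" if t: "t \<in> {a..b}" for t
  proof -
    have sub: "{a..t} \<subseteq> {a..b}" using t by auto
    obtain I J where IJ: "\<And>n. ((\<lambda>s. f s (X n s)) has_integral I n) {a..t}"
      "((\<lambda>s. f s (Y s)) has_integral J) {a..t}" "I \<longlonglongrightarrow> J"
      by (rule uniform_limit_integral[OF uniform_limit_on_subset[OF ulim_f sub]
            continuous_on_subset[OF cont_f[OF cont_X] sub]]) auto
    have "(\<lambda>n. X (Suc n) t) \<longlonglongrightarrow> x0 + integral {a..t} (\<lambda>s. f s (Y s))"
      using IJ(3) unfolding X_Suc integral_unique[OF IJ(1)] integral_unique[OF IJ(2)]
      by (intro tendsto_intros)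
    moreover have "(\<lambda>n. X (Suc n) t) \<longlonglongrightarrow> Y t"
      using tendsto_uniform_limitI[OF ulim t] by (rule LIMSEQ_Suc)
    ultimately show ?thesis
      using LIMSEQ_unique by blast
  qed
  have "(Y has_real_derivative f t (Y t)) (at t within {a..b})" if t: "t \<in> {a..b}" for t
  proof (rule has_real_derivative_transform[OF _ t fix_Y])
    show "((\<lambda>t. x0 + integral {a..t} (\<lambda>s. f s (Y s))) has_real_derivative f t (Y t)) (at t within {a..b})"
      using DERIV_add[OF DERIV_const integral_has_real_derivative[OF cont_f[OF cont_Y] t]] by simp
  qed
  moreover have "Y a = x0"
    using fix_Y[of a] ab by simp
  ultimately show ?thesis
    by blast
qed

text \<open>A field that is \<open>C\<^sup>1\<close> in space is Lipschitz only on compact sets; a bound on its size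
  confines the solution to a compact interval, outside of which the space variable is clamped.\<close>

lemma characteristic_forward:
  fixes s :: "real \<Rightarrow> real \<Rightarrow> real"
  assumes cont: "continuous_on ({a..b} \<times> UNIV) (\<lambda>(t, x). s t x)"
    and deriv: "\<And>t x. t \<in> {a..b} \<Longrightarrow> (s t has_real_derivative sx t x) (at x)"
    and cont_sx: "continuous_on ({a..b} \<times> UNIV) (\<lambda>(t, x). sx t x)"
    and bound: "\<And>t x. t \<in> {a..b} \<Longrightarrow> \<bar>s t x\<bar> \<le> C" and ab: "a \<le> b"
  obtains X where "X a = x0" "\<And>t. t \<in> {a..b} \<Longrightarrow> (X has_real_derivative s t (X t)) (at t within {a..b})"
proof -
  have C: "0 \<le> C" using bound[of a 0] ab by simp
  define R where "R = C * (b - a)"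
  have R: "0 \<le> R" using C ab by (simp add: R_def)
  define clamp where "clamp x = max (x0 - R) (min (x0 + R) x)" for x
  have clamp: "clamp x \<in> {x0 - R..x0 + R}" "\<bar>clamp x - clamp y\<bar> \<le> \<bar>x - y\<bar>" for x y
    using R by (auto simp: clamp_def max_def min_def)
  obtain L where L: "\<And>t x. t \<in> {a..b} \<Longrightarrow> x \<in> {x0 - R..x0 + R} \<Longrightarrow> \<bar>sx t x\<bar> \<le> L" "0 \<le> L"
    using field_bounded_on_compact[OF cont_sx order_refl] by blast
  have "\<exists>X. X a = x0 \<and> (\<forall>t\<in>{a..b}. (X has_real_derivative s t (clamp (X t))) (at t within {a..b}))"
  proof (rule picard_forward[OF _ _ ab])
    have "continuous_on ({a..b} \<times> UNIV) (\<lambda>p. case (fst p, clamp (snd p)) of (t, x) \<Rightarrow> s t x)"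
      unfolding clamp_def
      by (rule continuous_on_compose2[OF cont]) (auto intro!: continuous_intros)
    then show "continuous_on ({a..b} \<times> UNIV) (\<lambda>(t, x). s t (clamp x))"
      by (simp add: case_prod_unfold)
    show "\<bar>s t (clamp x) - s t (clamp y)\<bar> \<le> L * \<bar>x - y\<bar>" if t: "t \<in> {a..b}" for t x y
    proof -
      have "norm (s t (clamp x) - s t (clamp y)) \<le> L * norm (clamp x - clamp y)"
        by (rule field_differentiable_bound[where S = "{x0 - R..x0 + R}" and f' = "sx t"])
          (use clamp(1) L t has_field_derivative_at_within[OF deriv[OF t]] in auto)
      then show ?thesis
        using mult_left_mono[OF clamp(2)[of x y] L(2)] by simp
    qed
  qed
  then obtain X where X: "X a = x0"
    "\<And>t. t \<in> {a..b} \<Longrightarrow> (X has_real_derivative s t (clamp (X t))) (at t within {a..b})"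
    by blast
  have "clamp (X t) = X t" if t: "t \<in> {a..b}" for t
  proof -
    have "norm (X t - X a) \<le> C * norm (t - a)"
      by (rule field_differentiable_bound[where S = "{a..b}" and f' = "\<lambda>t. s t (clamp (X t))"])
        (use X(2) bound t in auto)
    also have "\<dots> \<le> R"
      using t C by (simp add: R_def mult_left_mono)
    finally show ?thesis
      by (auto simp: clamp_def X(1))
  qed
  then show thesis
    using that[of X] X by simp
qed

text \<open>Backward characteristics are forward characteristics of the time-reversed field.\<close>

lemma characteristic_backward:
  fixes s :: "real \<Rightarrow> real \<Rightarrow> real"
  assumes cont: "continuous_on ({a..b} \<times> UNIV) (\<lambda>(t, x). s t x)"
    and deriv: "\<And>t x. t \<in> {a..b} \<Longrightarrow> (s t has_real_derivative sx t x) (at x)"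
    and cont_sx: "continuous_on ({a..b} \<times> UNIV) (\<lambda>(t, x). sx t x)"
    and bound: "\<And>t x. t \<in> {a..b} \<Longrightarrow> \<bar>s t x\<bar> \<le> C" and ab: "a \<le> b"
  obtains X where "X b = x0" "\<And>t. t \<in> {a..b} \<Longrightarrow> (X has_real_derivative s t (X t)) (at t within {a..b})"
proof -
  have rev: "continuous_on ({- b..- a} \<times> UNIV) (\<lambda>(t, x). - g (- t) x)"
    if "continuous_on ({a..b} \<times> UNIV) (\<lambda>(t, x). g t x)" for g :: "real \<Rightarrow> real \<Rightarrow> real"
  proof -
    have "continuous_on ({- b..- a} \<times> UNIV) (\<lambda>p. case (- fst p, snd p) of (t, x) \<Rightarrow> g t x)"
      by (rule continuous_on_compose2[OF that]) (auto intro!: continuous_intros)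
    then show ?thesis
      by (auto simp: case_prod_unfold intro: continuous_on_minus)
  qed
  have "((\<lambda>x. - s (- t) x) has_real_derivative - sx (- t) x) (at x)" if "t \<in> {- b..- a}" for t x
    by (intro DERIV_minus deriv) (use that in auto)
  moreover have "\<bar>- s (- t) x\<bar> \<le> C" if "t \<in> {- b..- a}" for t x
    using bound[of "- t" x] that by auto
  ultimately obtain X where X: "X (- b) = x0"
    "\<And>t. t \<in> {- b..- a} \<Longrightarrow> (X has_real_derivative - s (- t) (X t)) (at t within {- b..- a})"
    using characteristic_forward[of "- b" "- a" "\<lambda>t x. - s (- t) x" "\<lambda>t x. - sx (- t) x" C x0]
      rev[OF cont] rev[OF cont_sx] ab by (metis neg_le_iff_le)
  have "((\<lambda>t. X (- t)) has_real_derivative s t (X (- t))) (at t within {a..b})" if "t \<in> {a..b}" for t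
  proof -
    have "uminus ` {a..b} = {- b..- a}" by simp
    then have "(X has_real_derivative - s t (X (- t))) (at (- t) within uminus ` {a..b})"
      using X(2)[of "- t"] that by simp
    moreover have "(uminus has_real_derivative - 1) (at t within {a..b})"
      by (auto intro!: derivative_eq_intros)
    ultimately have "(X \<circ> uminus has_real_derivative - s t (X (- t)) * - 1) (at t within {a..b})"
      by (rule DERIV_image_chain)
    then show ?thesis by (simp add: o_def)
  qed
  then show thesis
    using that[of "\<lambda>t. X (- t)"] X(1) by simp
qed

section \<open>Limits at the final time along characteristics\<close>

text \<open>The filter of approach to the point \<open>(Ts, x0)\<close> of the final line from times before \<open>Ts\<close>.\<close>

definition edge :: "real \<Rightarrow> real \<Rightarrow> (real \<times> real) filter" where
  "edge Ts x0 = at (Ts, x0) within ({0..<Ts} \<times> UNIV)"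

lemma eventually_edge:
  "eventually P (edge Ts x0) \<longleftrightarrow>
     (\<exists>\<delta>>0. \<forall>t x. 0 \<le> t \<and> Ts - \<delta> < t \<and> t < Ts \<and> \<bar>x - x0\<bar> < \<delta> \<longrightarrow> P (t, x))"
proof
  assume "eventually P (edge Ts x0)"
  then obtain d where d: "d > 0" and P: "\<And>t x. 0 \<le> t \<Longrightarrow> t < Ts \<Longrightarrow> dist (t, x) (Ts, x0) < d \<Longrightarrow> P (t, x)"
    by (auto simp: edge_def eventually_at)
  have "P (t, x)" if "0 \<le> t" "Ts - d / 2 < t" "t < Ts" "\<bar>x - x0\<bar> < d / 2" for t x
  proof (rule P[OF that(1,3)])
    have "dist (t, x) (Ts, x0) \<le> \<bar>t - Ts\<bar> + \<bar>x - x0\<bar>"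
      by (auto simp: dist_prod_def dist_real_def intro: order_trans[OF sqrt_sum_squares_le_sum_abs])
    then show "dist (t, x) (Ts, x0) < d" using that by linarith
  qed
  then show "\<exists>\<delta>>0. \<forall>t x. 0 \<le> t \<and> Ts - \<delta> < t \<and> t < Ts \<and> \<bar>x - x0\<bar> < \<delta> \<longrightarrow> P (t, x)"
    using d by (intro exI[of _ "d / 2"]) auto
next
  assume "\<exists>\<delta>>0. \<forall>t x. 0 \<le> t \<and> Ts - \<delta> < t \<and> t < Ts \<and> \<bar>x - x0\<bar> < \<delta> \<longrightarrow> P (t, x)"
  then obtain d where d: "d > 0"
    and P: "\<And>t x. 0 \<le> t \<Longrightarrow> Ts - d < t \<Longrightarrow> t < Ts \<Longrightarrow> \<bar>x - x0\<bar> < d \<Longrightarrow> P (t, x)"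
    by blast
  show "eventually P (edge Ts x0)"
    unfolding edge_def eventually_at
  proof (intro exI conjI ballI impI)
    fix p assume p: "p \<in> {0..<Ts} \<times> UNIV" "p \<noteq> (Ts, x0) \<and> dist p (Ts, x0) < d"
    obtain t x where [simp]: "p = (t, x)" by (cases p)
    have "\<bar>t - Ts\<bar> < d" "\<bar>x - x0\<bar> < d"
      using p(2) dist_fst_le[of p "(Ts, x0)"] dist_snd_le[of p "(Ts, x0)"] by (auto simp: dist_real_def)
    then show "P p"
      using p(1) P[of t x] by auto
  qed (rule d)
qed

lemma edge_neq_bot: "0 < Ts \<Longrightarrow> edge Ts x0 \<noteq> bot"
proof
  assume Ts: "0 < Ts" and "edge Ts x0 = bot"
  then have "eventually (\<lambda>_. False) (edge Ts x0)" by simp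
  then obtain d where d: "d > 0" "\<And>t x. \<not> (0 \<le> t \<and> Ts - d < t \<and> t < Ts \<and> \<bar>x - x0\<bar> < d)"
    unfolding eventually_edge by blast
  show False
    using Ts d(1) d(2)[of "max 0 (Ts - d / 2)" x0] by auto
qed

lemma Bfun_edgeD:
  fixes f :: "real \<Rightarrow> real \<Rightarrow> real"
  assumes "Bfun (case_prod f) (edge Ts x0)"
  obtains \<delta> B where "0 < \<delta>" "0 \<le> B"
    "\<And>t x. 0 \<le> t \<Longrightarrow> Ts - \<delta> < t \<Longrightarrow> t < Ts \<Longrightarrow> \<bar>x - x0\<bar> < \<delta> \<Longrightarrow> \<bar>f t x\<bar> \<le> B"
proof -
  obtain B where "B > 0" "eventually (\<lambda>p. norm (case_prod f p) \<le> B) (edge Ts x0)"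
    using assms by (auto elim: BfunE)
  then show thesis
    using that[of _ B] unfolding eventually_edge by force
qed

lemma Bfun_edgeI:
  fixes f :: "real \<Rightarrow> real \<Rightarrow> real"
  assumes "0 < \<delta>"
    "\<And>t x. 0 \<le> t \<Longrightarrow> Ts - \<delta> < t \<Longrightarrow> t < Ts \<Longrightarrow> \<bar>x - x0\<bar> < \<delta> \<Longrightarrow> \<bar>f t x\<bar> \<le> B"
  shows "Bfun (case_prod f) (edge Ts x0)"
  by (rule BfunI[of _ B]) (use assms in \<open>auto simp: eventually_edge\<close>)

lemma mvt_within:
  fixes f :: "real \<Rightarrow> real"
  assumes "a \<le> b" and "\<And>t. t \<in> {a..b} \<Longrightarrow> (f has_real_derivative f' t) (at t within {a..b})"
  obtains \<xi> where "\<xi> \<in> {a..b}" "f b - f a = (b - a) * f' \<xi>"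
proof (cases "a = b")
  case False
  then have "\<exists>x\<in>{a<..<b}. f b - f a = (*) (f' x) (b - a)"
    using assms by (intro mvt_simple) (auto simp: has_field_derivative_def)
  then obtain \<xi> where "\<xi> \<in> {a<..<b}" "f b - f a = f' \<xi> * (b - a)"
    by blast
  then show thesis
    by (intro that[of \<xi>]) (auto simp: mult.commute)
qed (use that assms(1) in auto)

definition characteristic :: "(real \<Rightarrow> real \<Rightarrow> real) \<Rightarrow> real \<Rightarrow> real \<Rightarrow> (real \<Rightarrow> real) \<Rightarrow> bool" where
  "characteristic s a b X \<longleftrightarrow> (\<forall>t\<in>{a..b}. (X has_real_derivative s t (X t)) (at t within {a..b}))"

lemma characteristicD:
  "characteristic s a b X \<Longrightarrow> t \<in> {a..b} \<Longrightarrow> (X has_real_derivative s t (X t)) (at t within {a..b})"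
  by (auto simp: characteristic_def)

lemma characteristic_subinterval:
  "characteristic s a b X \<Longrightarrow> a \<le> a' \<Longrightarrow> b' \<le> b \<Longrightarrow> characteristic s a' b' X"
  unfolding characteristic_def
  by (metis DERIV_subset atLeastAtMost_iff atLeastatMost_subset_iff order_trans)

lemma characteristic_lipschitz:
  assumes "characteristic s a b X" and "\<And>t x. t \<in> {a..b} \<Longrightarrow> \<bar>s t x\<bar> \<le> C"
    and "r \<in> {a..b}" "r' \<in> {a..b}"
  shows "\<bar>X r - X r'\<bar> \<le> C * \<bar>r - r'\<bar>"
proof -
  have "norm (X r - X r') \<le> C * norm (r - r')"
    by (rule field_differentiable_bound[where S = "{a..b}" and f' = "\<lambda>t. s t (X t)"])
      (use assms characteristicD in auto)
  then show ?thesis by simp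
qed

text \<open>Gronwall's inequality backward in time: with \<open>D = X - Y\<close>, the quantity
  \<open>exp (2 L t) D\<^sup>2\<close> has a nonnegative derivative.\<close>

lemma characteristics_separation:
  assumes X: "characteristic s a b X" and Y: "characteristic s a b Y" and ab: "a \<le> b"
    and near: "\<And>r. r \<in> {a..b} \<Longrightarrow> \<bar>X r - x0\<bar> < \<delta>" "\<And>r. r \<in> {a..b} \<Longrightarrow> \<bar>Y r - x0\<bar> < \<delta>"
    and deriv: "\<And>r x. r \<in> {a..b} \<Longrightarrow> (s r has_real_derivative sx r x) (at x)"
    and L: "\<And>r x. r \<in> {a..b} \<Longrightarrow> \<bar>x - x0\<bar> < \<delta> \<Longrightarrow> \<bar>sx r x\<bar> \<le> L"
  shows "\<bar>X a - Y a\<bar> \<le> exp (L * (b - a)) * \<bar>X b - Y b\<bar>"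
proof -
  define D where "D r = X r - Y r" for r
  have lip: "\<bar>s r (X r) - s r (Y r)\<bar> \<le> L * \<bar>D r\<bar>" if r: "r \<in> {a..b}" for r
  proof -
    have "norm (s r (X r) - s r (Y r)) \<le> L * norm (X r - Y r)"
      by (rule field_differentiable_bound[where S = "{x0 - \<delta><..<x0 + \<delta>}" and f' = "sx r"])
        (use near[OF r] L[OF r] has_field_derivative_at_within[OF deriv[OF r]]
          in \<open>auto simp: abs_less_iff\<close>)
    then show ?thesis by (simp add: D_def)
  qed
  have "((\<lambda>r. exp (2 * L * r) * (D r)\<^sup>2) has_real_derivative
      exp (2 * L * r) * (2 * L * (D r)\<^sup>2 + 2 * D r * (s r (X r) - s r (Y r)))) (at r within {a..b})"
    if r: "r \<in> {a..b}" for r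
    unfolding D_def
    using characteristicD[OF X r] characteristicD[OF Y r]
    by (auto intro!: derivative_eq_intros simp: algebra_simps)
  from mvt_within[OF ab this]
  obtain \<xi> where \<xi>: "\<xi> \<in> {a..b}" and eq: "exp (2 * L * b) * (D b)\<^sup>2 - exp (2 * L * a) * (D a)\<^sup>2 =
    (b - a) * (exp (2 * L * \<xi>) * (2 * L * (D \<xi>)\<^sup>2 + 2 * D \<xi> * (s \<xi> (X \<xi>) - s \<xi> (Y \<xi>))))"
    by blast
  have "\<bar>D \<xi> * (s \<xi> (X \<xi>) - s \<xi> (Y \<xi>))\<bar> \<le> \<bar>D \<xi>\<bar> * (L * \<bar>D \<xi>\<bar>)"
    unfolding abs_mult by (intro mult_left_mono lip \<xi>) auto
  then have "0 \<le> 2 * L * (D \<xi>)\<^sup>2 + 2 * D \<xi> * (s \<xi> (X \<xi>) - s \<xi> (Y \<xi>))"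
    by (simp add: power2_eq_square abs_le_iff algebra_simps)
  then have "exp (2 * L * a) * (D a)\<^sup>2 \<le> exp (2 * L * b) * (D b)\<^sup>2"
    using eq ab by (smt (verit, best) exp_ge_zero mult_nonneg_nonneg)
  then have "(exp (L * a) * \<bar>D a\<bar>)\<^sup>2 \<le> (exp (L * b) * \<bar>D b\<bar>)\<^sup>2"
    by (simp add: power_mult_distrib exp_double[symmetric] mult.assoc)
  then have "exp (L * a) * \<bar>D a\<bar> \<le> exp (L * b) * \<bar>D b\<bar>"
    by (rule power2_le_imp_le) auto
  then have "\<bar>D a\<bar> \<le> exp (L * b) / exp (L * a) * \<bar>D b\<bar>"
    by (simp add: field_simps)
  then show ?thesis
    by (simp add: exp_diff[symmetric] D_def algebra_simps)
qed

locale speed_field =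
  fixes Ts C :: real and s sx :: "real \<Rightarrow> real \<Rightarrow> real"
  assumes Ts: "0 < Ts"
    and cont_s: "continuous_on ({0..<Ts} \<times> UNIV) (\<lambda>(t, x). s t x)"
    and deriv_s: "\<And>t x. t \<in> {0..<Ts} \<Longrightarrow> (s t has_real_derivative sx t x) (at x)"
    and cont_sx: "continuous_on ({0..<Ts} \<times> UNIV) (\<lambda>(t, x). sx t x)"
    and bound_s: "\<And>t x. t \<in> {0..<Ts} \<Longrightarrow> \<bar>s t x\<bar> \<le> C"
begin

lemma C_nonneg: "0 \<le> C"
  using bound_s[of 0 0] Ts by simp

lemma backward_characteristic:
  assumes "0 \<le> a" "a \<le> b" "b < Ts"
  obtains X where "X b = x" "characteristic s a b X"
proof -
  have sub: "{a..b} \<times> UNIV \<subseteq> {0..<Ts} \<times> (UNIV :: real set)" using assms by auto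
  show thesis
    by (rule characteristic_backward[OF continuous_on_subset[OF cont_s sub] deriv_s
          continuous_on_subset[OF cont_sx sub] bound_s assms(2), of x])
      (use assms that in \<open>auto simp: characteristic_def\<close>)
qed

lemma characteristic_near:
  assumes "characteristic s a b X" "0 \<le> a" "b < Ts" "r \<in> {a..b}" "r' \<in> {a..b}"
  shows "\<bar>X r - X r'\<bar> \<le> C * \<bar>r - r'\<bar>"
  by (rule characteristic_lipschitz[OF assms(1) bound_s assms(4,5)]) (use assms in auto)

text \<open>If \<open>g\<close> varies at a bounded rate along characteristics near \<open>(Ts, x0)\<close>, its values there are
  close to those at the feet of the characteristics on a slice just before \<open>Ts\<close>. The feet
  converge as the endpoints tend to \<open>(Ts, x0)\<close>, and \<open>g\<close> is continuous on the slice.\<close>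

lemma limit_along_characteristics:
  assumes sx: "Bfun (case_prod sx) (edge Ts x0)"
    and cont_g: "continuous_on ({0..<Ts} \<times> UNIV) (\<lambda>(t, x). g t x)"
    and \<delta>: "0 < \<delta>"
    and rate: "\<And>a b X. 0 \<le> a \<Longrightarrow> Ts - \<delta> < a \<Longrightarrow> a \<le> b \<Longrightarrow> b < Ts \<Longrightarrow> characteristic s a b X \<Longrightarrow>
       (\<And>r. r \<in> {a..b} \<Longrightarrow> \<bar>X r - x0\<bar> < \<delta>) \<Longrightarrow> \<bar>g b (X b) - g a (X a)\<bar> \<le> B * (b - a)"
  shows "\<exists>l :: real. (case_prod g \<longlongrightarrow> l) (edge Ts x0)"
proof -
  obtain \<delta>' L where L: "0 < \<delta>'" "0 \<le> L"
    "\<And>t x. 0 \<le> t \<Longrightarrow> Ts - \<delta>' < t \<Longrightarrow> t < Ts \<Longrightarrow> \<bar>x - x0\<bar> < \<delta>' \<Longrightarrow> \<bar>sx t x\<bar> \<le> L"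
    using Bfun_edgeD[OF sx] by blast
  define d where "d = min \<delta> \<delta>'"
  have d: "0 < d" "d \<le> \<delta>" "d \<le> \<delta>'" using \<delta> L(1) by (auto simp: d_def)
  define B' where "B' = max B 0"
  have "cauchy_filter (filtermap (case_prod g) (edge Ts x0))"
    unfolding cauchy_filter_metric_filtermap
  proof (intro allI impI)
    fix e :: real assume e: "0 < e"
    \<comment> \<open>After time \<open>t0 \<ge> Ts - \<epsilon>\<close> waves move by less than \<open>d / 2\<close> and \<open>g\<close> changes by at most \<open>e / 4\<close> along each.\<close>
    define \<epsilon> where "\<epsilon> = min (d / 2) (min (d / (4 * (C + 1))) (e / (4 * (B' + 1))))"
    have B': "B \<le> B'" "0 \<le> B'" by (auto simp: B'_def)
    have \<epsilon>: "0 < \<epsilon>" "\<epsilon> \<le> d / 2" "(C + 1) * \<epsilon> \<le> d / 4" "(B' + 1) * \<epsilon> \<le> e / 4"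
    proof -
      show "0 < \<epsilon>" using d e C_nonneg B'(2) by (simp add: \<epsilon>_def)
      show "\<epsilon> \<le> d / 2" unfolding \<epsilon>_def by (rule min.cobounded1)
      have "\<epsilon> \<le> d / (4 * (C + 1))" "\<epsilon> \<le> e / (4 * (B' + 1))"
        unfolding \<epsilon>_def by (meson min.cobounded1 min.cobounded2 order_trans)+
      then show "(C + 1) * \<epsilon> \<le> d / 4" "(B' + 1) * \<epsilon> \<le> e / 4"
        using C_nonneg B'(2) by (simp_all add: field_simps)
    qed
    have \<epsilon>': "C * \<epsilon> < d / 2" "B' * \<epsilon> \<le> e / 4"
      using \<epsilon> d(1) by (simp_all add: algebra_simps)
    define t0 where "t0 = max 0 (Ts - \<epsilon>)"
    have t0: "0 \<le> t0" "t0 < Ts" "Ts - t0 \<le> \<epsilon>" using Ts \<epsilon>(1) by (auto simp: t0_def)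
    have "continuous_on {x0 - d..x0 + d} (\<lambda>x. case (t0, x) of (t, x) \<Rightarrow> g t x)"
      by (rule continuous_on_compose2[OF cont_g]) (use t0 in \<open>auto intro!: continuous_intros\<close>)
    then have "uniformly_continuous_on {x0 - d..x0 + d} (g t0)"
      by (intro compact_uniformly_continuous) auto
    then obtain \<eta> where \<eta>: "0 < \<eta>"
      "\<And>y y'. y \<in> {x0 - d..x0 + d} \<Longrightarrow> y' \<in> {x0 - d..x0 + d} \<Longrightarrow> \<bar>y - y'\<bar> < \<eta> \<Longrightarrow> \<bar>g t0 y - g t0 y'\<bar> < e / 4"
      using e unfolding uniformly_continuous_on_def dist_real_def
      by (metis abs_minus_commute zero_less_divide_iff zero_less_numeral)
    \<comment> \<open>Endpoints within \<open>\<rho>\<close> of \<open>(Ts, x0)\<close> have feet at distance less than \<open>\<eta>\<close>; the summand \<open>C\<close> accounts for different end times.\<close>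
    define \<rho> where "\<rho> = min (min (d / 2) (Ts - t0)) (\<eta> / (2 * (exp (L * Ts) * (C + 2))))"
    have \<rho>: "0 < \<rho>" "\<rho> \<le> d / 2" "\<rho> \<le> Ts - t0" "exp (L * Ts) * ((C + 2) * \<rho>) < \<eta>"
    proof -
      have pos: "0 < exp (L * Ts) * (C + 2)" using C_nonneg by simp
      show "0 < \<rho>" using d \<eta> t0 pos unfolding \<rho>_def by (simp add: divide_pos_pos)
      show "\<rho> \<le> d / 2" "\<rho> \<le> Ts - t0"
        unfolding \<rho>_def by (meson min.cobounded1 min.cobounded2 order_trans)+
      have "\<rho> \<le> \<eta> / (2 * (exp (L * Ts) * (C + 2)))" by (simp add: \<rho>_def)
      then have "\<rho> * (2 * (exp (L * Ts) * (C + 2))) \<le> \<eta>"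
        using pos by (simp add: le_divide_eq)
      then show "exp (L * Ts) * ((C + 2) * \<rho>) < \<eta>"
        using mult_pos_pos[OF \<open>0 < \<rho>\<close> pos] by (simp add: algebra_simps)
    qed
    define P where "P = (\<lambda>(t, x). 0 \<le> t \<and> Ts - \<rho> < t \<and> t < Ts \<and> \<bar>x - x0\<bar> < \<rho>)"
    have foot: "\<bar>g t x - g t0 (X t0)\<bar> \<le> e / 4 \<and> (\<forall>r\<in>{t0..t}. \<bar>X r - x0\<bar> < d)"
      if P: "P (t, x)" and Xt: "X t = x" and X: "characteristic s t0 t X" for t x X
    proof -
      have t: "t0 \<le> t" "t < Ts" using P \<rho>(3) by (auto simp: P_def)
      have near: "\<bar>X r - x0\<bar> < d" if r: "r \<in> {t0..t}" for r
      proof -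
        have "\<bar>X r - x\<bar> \<le> C * \<bar>r - t\<bar>"
          using characteristic_near[OF X t0(1) t(2), of r t] r t Xt by simp
        also have "\<dots> \<le> C * \<epsilon>"
          using r t0(3) t C_nonneg by (intro mult_left_mono) auto
        finally show ?thesis
          using \<epsilon>' \<rho>(2) P by (auto simp: P_def)
      qed
      have "\<bar>g t (X t) - g t0 (X t0)\<bar> \<le> B * (t - t0)"
      proof (rule rate[OF t0(1) _ t X])
        show "Ts - \<delta> < t0" using t0 \<epsilon>(1,2) d(1,2) by linarith
        show "\<bar>X r - x0\<bar> < \<delta>" if "r \<in> {t0..t}" for r
          using near[OF that] d(2) by simp
      qed
      also have "\<dots> \<le> B' * \<epsilon>"
        using B' t t0 by (intro mult_mono) auto
      finally show ?thesis
        using \<epsilon>'(2) near Xt by auto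
    qed
    have main: "\<bar>g t x - g t' x'\<bar> < e" if P: "P (t, x)" "P (t', x')" and le: "t \<le> t'" for t x t' x'
    proof -
      have t: "t0 \<le> t" "t < Ts" "t' < Ts" "0 \<le> t"
        using that \<rho>(3) by (auto simp: P_def)
      obtain X where X: "X t = x" "characteristic s t0 t X"
        using backward_characteristic[OF t0(1) t(1,2)] .
      obtain Y where Y: "Y t' = x'" "characteristic s t0 t' Y"
        using backward_characteristic[OF t0(1) order_trans[OF t(1) le] t(3)] .
      have Y': "characteristic s t0 t Y"
        using characteristic_subinterval[OF Y(2) order_refl le] .
      note fX = foot[OF P(1) X] and fY = foot[OF P(2) Y]
      have "\<bar>X t0 - Y t0\<bar> \<le> exp (L * (t - t0)) * \<bar>X t - Y t\<bar>"
      proof (rule characteristics_separation[OF X(2) Y' t(1), where ?x0.0 = x0 and \<delta> = d and sx = sx])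
        show "(s r has_real_derivative sx r x) (at x)" if "r \<in> {t0..t}" for r x
          by (rule deriv_s) (use that t t0 in auto)
        show "\<bar>sx r x\<bar> \<le> L" if "r \<in> {t0..t}" "\<bar>x - x0\<bar> < d" for r x
          by (rule L(3)) (use that t t0 d \<epsilon> in auto)
      qed (use fX fY le in auto)
      also have "\<dots> \<le> exp (L * Ts) * ((C + 2) * \<rho>)"
      proof (rule mult_mono)
        show "exp (L * (t - t0)) \<le> exp (L * Ts)"
          using L(2) t t0 by (auto intro!: mult_left_mono)
        have "\<bar>Y t' - Y t\<bar> \<le> C * \<bar>t' - t\<bar>"
          using characteristic_near[OF Y(2) t0(1) t(3), of t' t] t le by auto
        also have "\<dots> \<le> C * \<rho>"
          using P le C_nonneg by (intro mult_left_mono) (auto simp: P_def)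
        finally show "\<bar>X t - Y t\<bar> \<le> (C + 2) * \<rho>"
          using P X(1) Y(1) by (auto simp: P_def algebra_simps)
      qed (use \<rho> C_nonneg in auto)
      also have "\<dots> < \<eta>" by (rule \<rho>(4))
      finally have "\<bar>X t0 - Y t0\<bar> < \<eta>" .
      moreover have "X t0 \<in> {x0 - d..x0 + d}" "Y t0 \<in> {x0 - d..x0 + d}"
        using fX fY t le by (auto simp: abs_less_iff dest!: bspec[of _ _ t0])
      ultimately have "\<bar>g t0 (X t0) - g t0 (Y t0)\<bar> < e / 4"
        by (intro \<eta>(2))
      then show ?thesis using fX fY by linarith
    qed
    have "\<bar>case_prod g p - case_prod g q\<bar> < e" if "P p" "P q" for p q
      using main[of "fst p" "snd p" "fst q" "snd q"] main[of "fst q" "snd q" "fst p" "snd p"] that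
      by (cases "fst p \<le> fst q") (auto simp: case_prod_unfold abs_minus_commute)
    moreover have "eventually P (edge Ts x0)"
      unfolding eventually_edge P_def using \<rho>(1) by auto
    ultimately show "\<exists>P. eventually P (edge Ts x0) \<and>
        (\<forall>x y. P x \<and> P y \<longrightarrow> dist (case_prod g x) (case_prod g y) < e)"
      unfolding dist_real_def by blast
  qed
  then have "\<exists>l. filtermap (case_prod g) (edge Ts x0) \<le> nhds l"
    using cauchy_filter_complete_converges[of "filtermap (case_prod g) (edge Ts x0)" UNIV]
    edge_neq_bot[OF Ts, of x0]
    by (simp add: complete_UNIV filtermap_bot_iff)
  then show ?thesis
    by (simp add: filterlim_def)
qed

end

section \<open>Time derivatives of transported fields and sound waves\<close>

lemma C1_partials_shift_time:
  assumes f: "C1_partials J f ft fx" and sub: "(\<lambda>t. t + h) ` I \<subseteq> J"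
  shows "C1_partials I (\<lambda>t x. f (t + h) x) (\<lambda>t x. ft (t + h) x) (\<lambda>t x. fx (t + h) x)"
proof -
  have cont: "continuous_on (I \<times> UNIV) (\<lambda>(t, x). g (t + h) x)"
    if "continuous_on (J \<times> UNIV) (\<lambda>(t, x). g t x)" for g :: "real \<Rightarrow> real \<Rightarrow> real"
  proof -
    have "continuous_on (I \<times> UNIV) (\<lambda>p. case (fst p + h, snd p) of (t, x) \<Rightarrow> g t x)"
      by (rule continuous_on_compose2[OF that]) (use sub in \<open>auto intro!: continuous_intros\<close>)
    then show ?thesis by (simp add: case_prod_unfold)
  qed
  have "((\<lambda>s. f (s + h) x) has_real_derivative ft (t + h) x) (at t within I)" if "t \<in> I" for t x
  proof -
    have "((\<lambda>s. f s x) has_real_derivative ft (t + h) x) (at (t + h) within (\<lambda>t. t + h) ` I)"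
      by (rule DERIV_subset[OF C1_partialsD(1)[OF f] sub]) (use sub that in auto)
    moreover have "((\<lambda>t. t + h) has_real_derivative 1) (at t within I)"
      by (auto intro!: derivative_eq_intros)
    ultimately have "((\<lambda>s. f s x) \<circ> (\<lambda>t. t + h) has_real_derivative ft (t + h) x * 1) (at t within I)"
      by (rule DERIV_image_chain)
    then show ?thesis by (simp add: o_def)
  qed
  moreover have "(f (t + h) has_real_derivative fx (t + h) x) (at x)" if "t \<in> I" for t x
    by (rule C1_partialsD(2)[OF f]) (use sub that in auto)
  ultimately show ?thesis
    using cont[OF C1_partialsD(3)[OF f]] cont[OF C1_partialsD(4)[OF f]] cont[OF C1_partialsD(5)[OF f]]
    unfolding C1_partials_def by blast
qed

text \<open>Formally, differentiating \<open>f\<^sub>t + s f\<^sub>x = G\<close> in time gives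
  \<open>(\<partial>\<^sub>t + s \<partial>\<^sub>x) f\<^sub>t = G\<^sub>t - s\<^sub>t f\<^sub>x\<close>. As \<open>f\<^sub>t\<close> is merely continuous, the equation is
  obtained in mean-value form: the difference quotient \<open>(f(t + h, x) - f(t, x)) / h\<close> is
  differentiable along the characteristic, and the intermediate points have a cluster point as
  \<open>h\<close> tends to \<open>0\<close>. Only time derivatives of \<open>s\<close> and \<open>G\<close> enter, so that coefficients may be
  rough in space.\<close>

lemma time_derivative_along_characteristic:
  assumes f: "C1_partials J f ft fx"
    and s: "\<And>t x. t \<in> J \<Longrightarrow> ((\<lambda>r. s r x) has_real_derivative st t x) (at t within J)"
    and st: "continuous_on (J \<times> UNIV) (\<lambda>(t, x). st t x)"
    and G: "\<And>t x. t \<in> J \<Longrightarrow> ((\<lambda>r. G r x) has_real_derivative Gt t x) (at t within J)"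
    and Gt: "continuous_on (J \<times> UNIV) (\<lambda>(t, x). Gt t x)"
    and eq: "\<And>t x. t \<in> J \<Longrightarrow> ft t x + s t x * fx t x = G t x"
    and ab: "a \<le> b" and \<eta>: "0 < \<eta>" and sub: "{a..b + \<eta>} \<subseteq> J"
    and X: "characteristic s a b X"
  obtains r where "r \<in> {a..b}"
    "ft b (X b) - ft a (X a) = (b - a) * (Gt r (X r) - st r (X r) * fx r (X r))"
proof -
  have subI: "{a..b} \<subseteq> J" using sub \<eta> by auto
  define h where "h n = \<eta> / real (Suc n)" for n
  have h: "0 < h n" "h n \<le> \<eta>" for n
    using \<eta> by (auto simp: h_def field_simps)
  have h0: "h \<longlonglongrightarrow> 0"
    unfolding h_def by (rule LIMSEQ_Suc[OF lim_const_over_n])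
  define Q where "Q n r = f (r + h n) (X r) - f r (X r)" for n r
  have in_J: "r + k \<in> J" if "r \<in> {a..b}" "0 \<le> k" "k \<le> h n" for r k n
    using that h(2)[of n] sub by auto
  have mean_t: "\<exists>k. 0 \<le> k \<and> k \<le> h n \<and> g (r + h n) x - g r x = h n * gt (r + k) x"
    if g: "\<And>t x. t \<in> J \<Longrightarrow> ((\<lambda>r. g r x) has_real_derivative gt t x) (at t within J)"
      and r: "r \<in> {a..b}" for g gt :: "real \<Rightarrow> real \<Rightarrow> real" and r x n
  proof -
    have subr: "{r..r + h n} \<subseteq> J" using in_J[OF r, of "_ - r" n] by auto
    have le: "r \<le> r + h n" using h(1)[of n] by simp
    have "((\<lambda>r. g r x) has_real_derivative gt t x) (at t within {r..r + h n})"
      if "t \<in> {r..r + h n}" for t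
      by (rule DERIV_subset[OF g subr]) (use that subr in auto)
    from mvt_within[OF le this]
    obtain \<xi> where "\<xi> \<in> {r..r + h n}" "g (r + h n) x - g r x = (r + h n - r) * gt \<xi> x" .
    then show ?thesis
      by (intro exI[of _ "\<xi> - r"]) auto
  qed
  have "\<exists>r k l. r \<in> {a..b} \<and> 0 \<le> k \<and> k \<le> h n \<and> 0 \<le> l \<and> l \<le> h n \<and>
      (Q n b - Q n a) / h n = (b - a) * (Gt (r + k) (X r) - st (r + l) (X r) * fx (r + h n) (X r))" for n
  proof -
    have "(Q n has_real_derivative
        (ft (r + h n) (X r) + s r (X r) * fx (r + h n) (X r)) - (ft r (X r) + s r (X r) * fx r (X r)))
        (at r within {a..b})" if r: "r \<in> {a..b}" for r
    proof -
      have "(\<lambda>t. t + h n) ` {a..b} \<subseteq> J"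
        by (rule image_subsetI, rule in_J) (use h(1)[of n] in auto)
      from C1_partials_along[OF C1_partials_shift_time[OF f this] order_refl r characteristicD[OF X r]]
        C1_partials_along[OF f subI r characteristicD[OF X r]]
      show ?thesis
        unfolding Q_def by (rule DERIV_diff)
    qed
    from mvt_within[OF ab this]
    obtain r where r: "r \<in> {a..b}" and Q: "Q n b - Q n a = (b - a) *
        ((ft (r + h n) (X r) + s r (X r) * fx (r + h n) (X r)) - (ft r (X r) + s r (X r) * fx r (X r)))"
      by blast
    obtain k where k: "0 \<le> k" "k \<le> h n" "G (r + h n) (X r) - G r (X r) = h n * Gt (r + k) (X r)"
      using mean_t[OF G r] by blast
    obtain l where l: "0 \<le> l" "l \<le> h n" "s (r + h n) (X r) - s r (X r) = h n * st (r + l) (X r)"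
      using mean_t[OF s r] by blast
    have rJ: "r \<in> J" "r + h n \<in> J" using in_J[OF r, of 0 n] in_J[OF r, of "h n" n] h(1)[of n] by auto
    have "ft (r + h n) (X r) + s r (X r) * fx (r + h n) (X r) - (ft r (X r) + s r (X r) * fx r (X r))
      = (G (r + h n) (X r) - G r (X r)) - (s (r + h n) (X r) - s r (X r)) * fx (r + h n) (X r)"
      using eq[OF rJ(1), of "X r"] eq[OF rJ(2), of "X r"] by (simp add: algebra_simps)
    also have "\<dots> = h n * (Gt (r + k) (X r) - st (r + l) (X r) * fx (r + h n) (X r))"
      unfolding k(3) l(3) by (simp add: algebra_simps)
    finally have "(Q n b - Q n a) / h n
        = (b - a) * (Gt (r + k) (X r) - st (r + l) (X r) * fx (r + h n) (X r))"
      using Q h(1)[of n] by simp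
    then show ?thesis using r k l by blast
  qed
  then obtain r k l where r: "\<And>n. r n \<in> {a..b}"
    and k: "\<And>n. 0 \<le> k n" "\<And>n. k n \<le> h n" and l: "\<And>n. 0 \<le> l n" "\<And>n. l n \<le> h n"
    and Q: "\<And>n. (Q n b - Q n a) / h n =
      (b - a) * (Gt (r n + k n) (X (r n)) - st (r n + l n) (X (r n)) * fx (r n + h n) (X (r n)))"
    by metis
  \<comment> \<open>The intermediate times depend on the step size; a convergent subsequence provides the time sought.\<close>
  obtain R \<phi> where R: "R \<in> {a..b}" "strict_mono \<phi>" "(r \<circ> \<phi>) \<longlonglongrightarrow> R"
    by (rule seq_compactE[OF compact_imp_seq_compact[OF compact_Icc, of a b], of r]) (use r in auto)
  have \<phi>0: "(\<lambda>n. h (\<phi> n)) \<longlonglongrightarrow> 0"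
    using LIMSEQ_subseq_LIMSEQ[OF h0 R(2)] by (simp add: o_def)
  have r_lim: "(\<lambda>n. r (\<phi> n)) \<longlonglongrightarrow> R" using R(3) by (simp add: o_def)
  have "continuous_on {a..b} X"
    by (rule DERIV_continuous_on[OF characteristicD[OF X]])
  then have X_lim: "(\<lambda>n. X (r (\<phi> n))) \<longlonglongrightarrow> X R"
    by (rule continuous_on_tendsto_compose[OF _ r_lim R(1)]) (use r in auto)
  have field_lim: "(\<lambda>n. g (r (\<phi> n) + d n) (X (r (\<phi> n)))) \<longlonglongrightarrow> g R (X R)"
    if g: "continuous_on (J \<times> UNIV) (\<lambda>(t, x). g t x)" and d: "\<And>n. 0 \<le> d n" "\<And>n. d n \<le> h (\<phi> n)"
    for g :: "real \<Rightarrow> real \<Rightarrow> real" and d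
  proof -
    have "d \<longlonglongrightarrow> 0"
      by (rule tendsto_sandwich[OF _ _ tendsto_const \<phi>0]) (use d in auto)
    then have "(\<lambda>n. (r (\<phi> n) + d n, X (r (\<phi> n)))) \<longlonglongrightarrow> (R + 0, X R)"
      by (intro tendsto_intros r_lim X_lim)
    then have "(\<lambda>n. case (r (\<phi> n) + d n, X (r (\<phi> n))) of (t, x) \<Rightarrow> g t x) \<longlonglongrightarrow>
        (case (R + 0, X R) of (t, x) \<Rightarrow> g t x)"
      by (rule continuous_on_tendsto_compose[OF g])
        (use subI R(1) in_J[OF r d] in \<open>auto intro!: always_eventually\<close>)
    then show ?thesis by simp
  qed
  have "(\<lambda>n. (Q (\<phi> n) b - Q (\<phi> n) a) / h (\<phi> n)) \<longlonglongrightarrow>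
      (b - a) * (Gt R (X R) - st R (X R) * fx R (X R))"
    unfolding Q
    by (intro tendsto_intros field_lim Gt st C1_partialsD(5)[OF f] k l less_imp_le[OF h(1)] order_refl)
  moreover have quot: "(\<lambda>n. Q (\<phi> n) c / h (\<phi> n)) \<longlonglongrightarrow> ft c (X c)" if c: "c \<in> {a..b}" for c
  proof -
    have "((\<lambda>y. (f y (X c) - f c (X c)) / (y - c)) \<longlongrightarrow> ft c (X c)) (at c within J)"
      using C1_partialsD(1)[OF f, of c "X c"] c subI by (auto simp: has_field_derivative_iff)
    moreover have "filterlim (\<lambda>n. c + h (\<phi> n)) (at c within J) sequentially"
      unfolding filterlim_at
    proof (intro conjI always_eventually allI)
      show "c + h (\<phi> n) \<in> J" "c + h (\<phi> n) \<noteq> c" for n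
        using in_J[OF c, of "h (\<phi> n)" "\<phi> n"] h(1)[of "\<phi> n"] by auto
      show "(\<lambda>n. c + h (\<phi> n)) \<longlonglongrightarrow> c"
        using tendsto_add[OF tendsto_const \<phi>0, of c] by simp
    qed
    ultimately have "(\<lambda>n. (f (c + h (\<phi> n)) (X c) - f c (X c)) / (c + h (\<phi> n) - c)) \<longlonglongrightarrow> ft c (X c)"
      by (rule filterlim_compose)
    then show ?thesis by (simp add: Q_def)
  qed
  have "(\<lambda>n. (Q (\<phi> n) b - Q (\<phi> n) a) / h (\<phi> n)) \<longlonglongrightarrow> ft b (X b) - ft a (X a)"
    unfolding diff_divide_distrib by (intro tendsto_diff quot) (use ab in auto)
  ultimately show thesis
    using that[OF R(1)] LIMSEQ_unique by blast
qed

text \<open>Sound waves travel at speeds \<open>\<sigma> c\<close> with \<open>\<sigma> = 1\<close> or \<open>\<sigma> = - 1\<close>.\<close>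

locale sound_field =
  fixes Ts C :: real and c ct cx :: "real \<Rightarrow> real \<Rightarrow> real"
  assumes Ts: "0 < Ts"
    and c: "C1_partials {0..<Ts} c ct cx"
    and c_bound: "\<And>t x. t \<in> {0..<Ts} \<Longrightarrow> 0 < c t x \<and> c t x \<le> C"
    and cx_edge: "\<And>x0. Bfun (case_prod cx) (edge Ts x0)"
begin

lemma speed: "\<sigma> \<in> {1, - 1} \<Longrightarrow> speed_field Ts C (\<lambda>t x. \<sigma> * c t x) (\<lambda>t x. \<sigma> * cx t x)"
proof
  assume \<sigma>: "\<sigma> \<in> {1, - 1}"
  have cont: "continuous_on ({0..<Ts} \<times> UNIV) (\<lambda>(t, x). \<sigma> * g t x)"
    if "continuous_on ({0..<Ts} \<times> UNIV) (\<lambda>(t, x). g t x)" for g :: "real \<Rightarrow> real \<Rightarrow> real"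
    using continuous_on_mult[OF continuous_on_const that, of \<sigma>] by (simp add: case_prod_unfold)
  show "0 < Ts" by (rule Ts)
  show "continuous_on ({0..<Ts} \<times> UNIV) (\<lambda>(t, x). \<sigma> * c t x)"
    "continuous_on ({0..<Ts} \<times> UNIV) (\<lambda>(t, x). \<sigma> * cx t x)"
    by (rule cont[OF C1_partialsD(3)[OF c]] cont[OF C1_partialsD(5)[OF c]])+
  show "((\<lambda>x. \<sigma> * c t x) has_real_derivative \<sigma> * cx t x) (at x)" if "t \<in> {0..<Ts}" for t x
    by (rule DERIV_cmult[OF C1_partialsD(2)[OF c that]])
  show "\<bar>\<sigma> * c t x\<bar> \<le> C" if "t \<in> {0..<Ts}" for t x
    using c_bound[OF that, of x] \<sigma> by (auto simp: abs_mult)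
qed

lemma limit_along_sound_waves:
  assumes "\<sigma> \<in> {1, - 1}"
    and "continuous_on ({0..<Ts} \<times> UNIV) (\<lambda>(t, x). g t x)" and "0 < \<delta>"
    and "\<And>a b X. 0 \<le> a \<Longrightarrow> Ts - \<delta> < a \<Longrightarrow> a \<le> b \<Longrightarrow> b < Ts \<Longrightarrow>
       characteristic (\<lambda>t x. \<sigma> * c t x) a b X \<Longrightarrow>
       (\<And>r. r \<in> {a..b} \<Longrightarrow> \<bar>X r - x0\<bar> < \<delta>) \<Longrightarrow> \<bar>g b (X b) - g a (X a)\<bar> \<le> B * (b - a)"
  shows "\<exists>l :: real. (case_prod g \<longlongrightarrow> l) (edge Ts x0)"
proof (rule speed_field.limit_along_characteristics[OF speed[OF assms(1)] _ assms(2-4)])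
  obtain \<delta> B where "0 < \<delta>" "0 \<le> B"
    "\<And>t x. 0 \<le> t \<Longrightarrow> Ts - \<delta> < t \<Longrightarrow> t < Ts \<Longrightarrow> \<bar>x - x0\<bar> < \<delta> \<Longrightarrow> \<bar>cx t x\<bar> \<le> B"
    using Bfun_edgeD[OF cx_edge] by blast
  then show "Bfun (\<lambda>(t, x). \<sigma> * cx t x) (edge Ts x0)"
    using assms(1) by (intro Bfun_edgeI[of \<delta> _ _ _ B]) (auto simp: abs_mult)
qed

text \<open>Two fields carried by the left- and right-going sound waves at rates at most linear in their
  size stay bounded near \<open>(Ts, x0)\<close>. On a trapezoid that contains the backward characteristics of its
  points and whose height is so small that the waves gain at most half of the maximum, the
  maximum is controlled by its values on the base.\<close>

lemma bounded_along_sound_waves: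
  fixes v :: "real \<Rightarrow> real \<Rightarrow> real \<Rightarrow> real"
  assumes cont: "\<And>\<sigma>. \<sigma> \<in> {1, - 1} \<Longrightarrow> continuous_on ({0..<Ts} \<times> UNIV) (\<lambda>(t, x). v \<sigma> t x)"
    and \<delta>: "0 < \<delta>"
    and rate: "\<And>\<sigma> a b X. \<sigma> \<in> {1, - 1} \<Longrightarrow> 0 \<le> a \<Longrightarrow> Ts - \<delta> < a \<Longrightarrow> a \<le> b \<Longrightarrow> b < Ts \<Longrightarrow>
       characteristic (\<lambda>t x. \<sigma> * c t x) a b X \<Longrightarrow> (\<And>r. r \<in> {a..b} \<Longrightarrow> \<bar>X r - x0\<bar> < \<delta>) \<Longrightarrow>
       \<exists>r\<in>{a..b}. \<bar>v \<sigma> b (X b) - v \<sigma> a (X a)\<bar>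
          \<le> (b - a) * (L * (1 + \<bar>v 1 r (X r)\<bar> + \<bar>v (- 1) r (X r)\<bar>))"
    and \<sigma>: "\<sigma> \<in> {1, - 1}"
  shows "Bfun (case_prod (v \<sigma>)) (edge Ts x0)"
proof -
  interpret pos: speed_field Ts C "\<lambda>t x. 1 * c t x" "\<lambda>t x. 1 * cx t x" by (rule speed) simp
  have C: "0 \<le> C" by (rule pos.C_nonneg)
  define L' where "L' = max L 0"
  have L': "L \<le> L'" "0 \<le> L'" by (auto simp: L'_def)
  define n where "n t x = \<bar>v 1 t x\<bar> + \<bar>v (- 1) t x\<bar>" for t x
  \<comment> \<open>The height of the trapezoid. Over it each family gains at most a quarter of \<open>1\<close> plus the maximum.\<close>
  define \<epsilon> where "\<epsilon> = min (\<delta> / 2) (min (\<delta> / (4 * (C + 1))) (1 / (4 * (L' + 1))))"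
  have \<epsilon>: "0 < \<epsilon>" "\<epsilon> \<le> \<delta> / 2" "C * \<epsilon> < \<delta> / 2" "L' * \<epsilon> \<le> 1 / 4"
  proof -
    show pos: "0 < \<epsilon>" using \<delta> C L' by (simp add: \<epsilon>_def)
    show "\<epsilon> \<le> \<delta> / 2" unfolding \<epsilon>_def by (rule min.cobounded1)
    have "\<epsilon> \<le> \<delta> / (4 * (C + 1))" "\<epsilon> \<le> 1 / (4 * (L' + 1))"
      unfolding \<epsilon>_def by (meson min.cobounded1 min.cobounded2 order_trans)+
    then have "(C + 1) * \<epsilon> \<le> \<delta> / 4" "(L' + 1) * \<epsilon> \<le> 1 / 4"
      using C L'(2) by (simp_all add: field_simps)
    then show "C * \<epsilon> < \<delta> / 2" "L' * \<epsilon> \<le> 1 / 4"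
      using pos \<delta> by (simp_all add: algebra_simps)
  qed
  define t0 where "t0 = max 0 (Ts - \<epsilon>)"
  have t0: "0 \<le> t0" "t0 < Ts" "Ts - t0 \<le> \<epsilon>" "Ts - \<delta> < t0"
    using Ts \<epsilon>(1,2) \<delta> by (auto simp: t0_def)
  define \<rho> where "\<rho> = \<delta> / 2"
  have \<rho>: "0 < \<rho>" "\<rho> + C * (Ts - t0) < \<delta>"
    using \<delta> \<epsilon>(3) mult_left_mono[OF t0(3) C] by (auto simp: \<rho>_def)
  obtain N0 where N0: "\<And>\<sigma> x. \<sigma> \<in> {1, - 1} \<Longrightarrow> \<bar>x - x0\<bar> < \<delta> \<Longrightarrow> \<bar>v \<sigma> t0 x\<bar> \<le> N0"
  proof -
    have sub: "{t0..t0} \<subseteq> {0..<Ts}" using t0 by auto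
    obtain N where N: "\<And>t x. t \<in> {t0..t0} \<Longrightarrow> x \<in> {x0 - \<delta>..x0 + \<delta>} \<Longrightarrow> \<bar>v 1 t x\<bar> \<le> N"
      using field_bounded_on_compact[OF cont sub, of 1] by blast
    obtain N' where N': "\<And>t x. t \<in> {t0..t0} \<Longrightarrow> x \<in> {x0 - \<delta>..x0 + \<delta>} \<Longrightarrow> \<bar>v (- 1) t x\<bar> \<le> N'"
      using field_bounded_on_compact[OF cont sub, of "- 1"] by blast
    show thesis
    proof (rule that[of "max N N'"])
      show "\<bar>v \<sigma> t0 x\<bar> \<le> max N N'" if "\<sigma> \<in> {1, - 1}" "\<bar>x - x0\<bar> < \<delta>" for \<sigma> x
        using that N[of t0 x] N'[of t0 x] by (auto simp: abs_less_iff)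
    qed
  qed
  have bound: "n t1 x1 \<le> 4 * N0 + 1" if t1: "t0 \<le> t1" "t1 < Ts" and x1: "\<bar>x1 - x0\<bar> < \<rho>" for t1 x1
  proof -
    \<comment> \<open>The cross-section shrinks in time at speed \<open>C\<close>, so backward characteristics cannot leave.\<close>
    define D where "D = ({t0..t1} \<times> {x0 - \<delta>..x0 + \<delta>}) \<inter> {p. \<bar>snd p - x0\<bar> \<le> \<rho> + C * (Ts - fst p)}"
    have "closed {p. \<bar>snd p - x0\<bar> \<le> \<rho> + C * (Ts - fst p)}"
      by (intro closed_Collect_le continuous_intros)
    then have "compact D"
      unfolding D_def by (intro compact_Int_closed compact_Times compact_Icc)
    moreover have top: "(t1, x1) \<in> D"
    proof -
      have "0 \<le> C * (Ts - t1)" using C t1 by simp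
      moreover have "x1 - x0 < \<rho>" "- (x1 - x0) < \<rho>" using x1 unfolding abs_less_iff by auto
      ultimately show ?thesis
        using t1 x1 \<delta> by (auto simp: D_def \<rho>_def)
    qed
    moreover from top have "D \<noteq> {}" by blast
    moreover have "continuous_on D (\<lambda>(t, x). n t x)"
    proof -
      have "D \<subseteq> {0..<Ts} \<times> UNIV" using t0 t1 by (auto simp: D_def)
      with cont[of 1] cont[of "- 1"] show ?thesis
        unfolding n_def case_prod_unfold
        by (auto intro!: continuous_intros intro: continuous_on_subset)
    qed

    ultimately obtain p where p: "p \<in> D" "\<forall>q\<in>D. (case q of (t, x) \<Rightarrow> n t x) \<le> (case p of (t, x) \<Rightarrow> n t x)"
      using continuous_attains_sup by blast
    define tm xm where "tm = fst p" and "xm = snd p"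
    have m: "(tm, xm) \<in> D" "n t x \<le> n tm xm" if "(t, x) \<in> D" for t x
      using p(1) bspec[OF p(2) that] by (simp_all add: tm_def xm_def case_prod_unfold)
    have tm: "t0 \<le> tm" "tm \<le> t1" "tm < Ts" and xm: "\<bar>xm - x0\<bar> \<le> \<rho> + C * (Ts - tm)"
      using m(1)[OF top] t1 by (auto simp: D_def)
    have "\<bar>v \<sigma> tm xm\<bar> \<le> N0 + (1 + n tm xm) / 4" if \<sigma>: "\<sigma> \<in> {1, - 1}" for \<sigma>
    proof -
      interpret speed_field Ts C "\<lambda>t x. \<sigma> * c t x" "\<lambda>t x. \<sigma> * cx t x" by (rule speed[OF \<sigma>])
      obtain X where X: "X tm = xm" "characteristic (\<lambda>t x. \<sigma> * c t x) t0 tm X"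
        using backward_characteristic[OF t0(1) tm(1,3)] .
      have in_cone: "\<bar>X r - x0\<bar> \<le> \<rho> + C * (Ts - r)" if r: "r \<in> {t0..tm}" for r
      proof -
        have "\<bar>X r - xm\<bar> \<le> C * (tm - r)"
          using characteristic_near[OF X(2) t0(1) tm(3) r, of tm] r X(1) by auto
        then show ?thesis using xm by (simp add: algebra_simps)
      qed
      have near: "\<bar>X r - x0\<bar> < \<delta>" if r: "r \<in> {t0..tm}" for r
        using in_cone[OF r] mult_left_mono[of "Ts - r" "Ts - t0" C] C r \<rho>(2) by auto
      have in_D: "(r, X r) \<in> D" if r: "r \<in> {t0..tm}" for r
        using in_cone[OF r] near[OF r] r tm by (auto simp: D_def abs_less_iff)
      obtain r where r: "r \<in> {t0..tm}"
        "\<bar>v \<sigma> tm (X tm) - v \<sigma> t0 (X t0)\<bar> \<le> (tm - t0) * (L * (1 + n r (X r)))"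
        using rate[OF \<sigma> t0(1,4) tm(1,3) X(2) near] by (auto simp: n_def add.assoc)
      have n_pos: "0 \<le> n t x" for t x by (simp add: n_def)
      have "(tm - t0) * (L * (1 + n r (X r))) \<le> \<epsilon> * (L' * (1 + n tm xm))"
        using tm t0 L' \<epsilon>(1) m(2)[OF in_D[OF r(1)]] n_pos[of r "X r"]
        by (intro order_trans[OF mult_left_mono[OF mult_mono[OF L'(1)]] mult_right_mono]) auto
      also have "\<dots> = L' * \<epsilon> * (1 + n tm xm)" by simp
      also have "\<dots> \<le> 1 / 4 * (1 + n tm xm)"
        using \<epsilon>(4) n_pos[of tm xm] by (intro mult_right_mono) auto
      finally have "\<bar>v \<sigma> tm (X tm) - v \<sigma> t0 (X t0)\<bar> \<le> (1 + n tm xm) / 4"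
        using r(2) by simp
      moreover have "\<bar>v \<sigma> t0 (X t0)\<bar> \<le> N0"
        using N0[OF \<sigma> near[of t0]] tm by simp
      ultimately show ?thesis
        unfolding X(1) by linarith
    qed
    from add_mono[OF this[of 1] this[of "- 1"]]
    have "n tm xm \<le> (N0 + (1 + n tm xm) / 4) + (N0 + (1 + n tm xm) / 4)"
      unfolding n_def[of tm xm, symmetric] by simp
    then have "n tm xm \<le> 4 * N0 + 1" by (simp add: field_simps)
    then show ?thesis using m(2)[OF top] by simp
  qed
  show ?thesis
  proof (rule Bfun_edgeI)
    show "0 < min \<rho> (Ts - t0)" using \<rho> t0 by simp
    fix t x assume "0 \<le> t" "Ts - min \<rho> (Ts - t0) < t" "t < Ts" "\<bar>x - x0\<bar> < min \<rho> (Ts - t0)"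
    then have "n t x \<le> 4 * N0 + 1" by (intro bound) auto
    then show "\<bar>v \<sigma> t x\<bar> \<le> 4 * N0 + 1" using \<sigma> by (auto simp: n_def)
  qed
qed

end

section \<open>Extension of smooth fields to the final time\<close>

text \<open>At \<open>t = Ts\<close> the value is the limit at the edge. \<open>Lim\<close> is arbitrary if there is no limit; the
  lemmas below therefore assume that limits exist.\<close>

definition extend_to :: "real \<Rightarrow> (real \<Rightarrow> real \<Rightarrow> real) \<Rightarrow> real \<Rightarrow> real \<Rightarrow> real" where
  "extend_to Ts f t x = (if t < Ts then f t x else Lim (edge Ts x) (case_prod f))"

definition edge_limits :: "real \<Rightarrow> (real \<Rightarrow> real \<Rightarrow> real) \<Rightarrow> bool" where
  "edge_limits Ts f \<longleftrightarrow> (\<forall>x0. \<exists>l. (case_prod f \<longlongrightarrow> l) (edge Ts x0))"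

lemma extend_to_less [simp]: "t < Ts \<Longrightarrow> extend_to Ts f t x = f t x"
  by (simp add: extend_to_def)

text \<open>Approaching a point of the final line along that line itself is covered as well, because
  limits at neighbouring points inherit the bounds that define the limit at \<open>(Ts, x0)\<close>.\<close>

lemma extend_to_near:
  assumes Ts: "0 < Ts" and lim: "edge_limits Ts f" and e: "0 < e"
  obtains \<delta> where "0 < \<delta>"
    "\<And>t x. 0 \<le> t \<Longrightarrow> Ts - \<delta> < t \<Longrightarrow> t \<le> Ts \<Longrightarrow> \<bar>x - x0\<bar> < \<delta> \<Longrightarrow>
       \<bar>extend_to Ts f t x - extend_to Ts f Ts x0\<bar> \<le> e"
proof -
  have lims: "(case_prod f \<longlongrightarrow> extend_to Ts f Ts x) (edge Ts x)" for x
    using lim tendsto_Lim[OF edge_neq_bot[OF Ts]] unfolding edge_limits_def extend_to_def by fastforce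
  have "eventually (\<lambda>p. \<bar>case_prod f p - extend_to Ts f Ts x0\<bar> < e) (edge Ts x0)"
    using tendstoD[OF lims e] by (simp add: dist_real_def)
  then obtain \<delta> where \<delta>: "0 < \<delta>"
    "\<And>t x. 0 \<le> t \<Longrightarrow> Ts - \<delta> < t \<Longrightarrow> t < Ts \<Longrightarrow> \<bar>x - x0\<bar> < \<delta> \<Longrightarrow> \<bar>f t x - extend_to Ts f Ts x0\<bar> < e"
    unfolding eventually_edge by auto
  have "\<bar>extend_to Ts f Ts x - extend_to Ts f Ts x0\<bar> \<le> e" if x: "\<bar>x - x0\<bar> < \<delta>" for x
  proof (rule tendsto_upperbound[OF _ _ edge_neq_bot[OF Ts, of x]])
    show "((\<lambda>p. \<bar>case_prod f p - extend_to Ts f Ts x0\<bar>) \<longlongrightarrow>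
        \<bar>extend_to Ts f Ts x - extend_to Ts f Ts x0\<bar>) (edge Ts x)"
      by (intro tendsto_intros lims)
    show "\<forall>\<^sub>F p in edge Ts x. \<bar>case_prod f p - extend_to Ts f Ts x0\<bar> \<le> e"
      unfolding eventually_edge
    proof (intro exI conjI allI impI)
      show "0 < \<delta> - \<bar>x - x0\<bar>" using x by simp
      fix t y assume "0 \<le> t \<and> Ts - (\<delta> - \<bar>x - x0\<bar>) < t \<and> t < Ts \<and> \<bar>y - x\<bar> < \<delta> - \<bar>x - x0\<bar>"
      then have "\<bar>f t y - extend_to Ts f Ts x0\<bar> < e" by (intro \<delta>(2)) linarith+
      then show "\<bar>case_prod f (t, y) - extend_to Ts f Ts x0\<bar> \<le> e" by simp
    qed
  qed
  with \<delta> have "\<bar>extend_to Ts f t x - extend_to Ts f Ts x0\<bar> \<le> e"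
    if "0 \<le> t" "Ts - \<delta> < t" "t \<le> Ts" "\<bar>x - x0\<bar> < \<delta>" for t x
    using that by (cases "t < Ts") (auto intro!: less_imp_le[OF \<delta>(2)])
  then show thesis using that \<delta>(1) by blast
qed

lemma continuous_on_extend_to:
  assumes Ts: "0 < Ts" and lim: "edge_limits Ts f"
    and cont: "continuous_on ({0..<Ts} \<times> UNIV) (\<lambda>(t, x). f t x)"
  shows "continuous_on ({0..Ts} \<times> UNIV) (\<lambda>(t, x). extend_to Ts f t x)"
  unfolding continuous_on_iff
proof (intro ballI allI impI)
  fix p :: "real \<times> real" and e :: real
  assume p: "p \<in> {0..Ts} \<times> UNIV" and e: "0 < e"
  obtain t x where [simp]: "p = (t, x)" by (cases p)
  show "\<exists>d>0. \<forall>q\<in>{0..Ts} \<times> UNIV. dist q p < d \<longrightarrow>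
      dist (case q of (t, x) \<Rightarrow> extend_to Ts f t x) (case p of (t, x) \<Rightarrow> extend_to Ts f t x) < e"
  proof (cases "t < Ts")
    case True
    then obtain d where d: "0 < d" "\<And>q. q \<in> {0..<Ts} \<times> UNIV \<Longrightarrow> dist q p < d \<Longrightarrow>
        dist (case_prod f q) (case_prod f p) < e"
      using cont[unfolded continuous_on_iff, rule_format, of p e] p e by auto
    show ?thesis
    proof (intro exI[of _ "min d (Ts - t)"] conjI ballI impI)
      fix q :: "real \<times> real" assume q: "q \<in> {0..Ts} \<times> UNIV" "dist q p < min d (Ts - t)"
      have "fst q < Ts"
        using q(2) dist_fst_le[of q p] by (auto simp: dist_real_def)
      then show "dist (case q of (t, x) \<Rightarrow> extend_to Ts f t x) (case p of (t, x) \<Rightarrow> extend_to Ts f t x) < e"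
        using d(2)[of q] q True by (auto simp: case_prod_unfold)
    qed (use d True in auto)
  next
    case False
    then have [simp]: "t = Ts" using p by auto
    obtain \<delta> where \<delta>: "0 < \<delta>"
      "\<And>t x'. 0 \<le> t \<Longrightarrow> Ts - \<delta> < t \<Longrightarrow> t \<le> Ts \<Longrightarrow> \<bar>x' - x\<bar> < \<delta> \<Longrightarrow>
         \<bar>extend_to Ts f t x' - extend_to Ts f Ts x\<bar> \<le> e / 2"
      using extend_to_near[OF Ts lim, of "e / 2" x] e by auto
    show ?thesis
    proof (intro exI[of _ \<delta>] conjI ballI impI)
      fix q :: "real \<times> real" assume q: "q \<in> {0..Ts} \<times> UNIV" "dist q p < \<delta>"
      have "\<bar>fst q - Ts\<bar> < \<delta>" "\<bar>snd q - x\<bar> < \<delta>"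
        using q(2) dist_fst_le[of q p] dist_snd_le[of q p] by (auto simp: dist_real_def)
      then have "\<bar>extend_to Ts f (fst q) (snd q) - extend_to Ts f Ts x\<bar> \<le> e / 2"
        using q(1) by (intro \<delta>(2)) auto
      then show "dist (case q of (t, x) \<Rightarrow> extend_to Ts f t x) (case p of (t, x) \<Rightarrow> extend_to Ts f t x) < e"
        using e by (simp add: case_prod_unfold dist_real_def)
    qed (rule \<delta>(1))
  qed
qed

text \<open>In time the extension is the integral of the extended derivative. In space, the bounds
  \<open>\<bar>f(t, x) - f(t, x0) - (x - x0) l\<bar> \<le> e \<bar>x - x0\<bar>\<close> on the slices \<open>t < Ts\<close> pass to the limit.\<close>

lemma C1_partials_extend_to:
  assumes Ts: "0 < Ts" and f: "C1_partials {0..<Ts} f ft fx"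
    and lim: "edge_limits Ts f" "edge_limits Ts ft" "edge_limits Ts fx"
  shows "C1_partials {0..Ts} (extend_to Ts f) (extend_to Ts ft) (extend_to Ts fx)"
proof -
  note cont = continuous_on_extend_to[OF Ts lim(1) C1_partialsD(3)[OF f]]
    continuous_on_extend_to[OF Ts lim(2) C1_partialsD(4)[OF f]]
    continuous_on_extend_to[OF Ts lim(3) C1_partialsD(5)[OF f]]
  have int: "extend_to Ts f t x = f 0 x + integral {0..t} (\<lambda>s. extend_to Ts ft s x)"
    if t: "t \<in> {0..Ts}" for t x
  proof -
    have sub: "{0..t} \<subseteq> {0..Ts}" using t by auto
    have "((\<lambda>s. extend_to Ts ft s x) has_integral extend_to Ts f t x - extend_to Ts f 0 x) {0..t}"
    proof (rule fundamental_theorem_of_calculus_interior)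
      show "continuous_on {0..t} (\<lambda>s. extend_to Ts f s x)"
        by (rule continuous_on_slice[OF cont(1) sub])
      fix s assume s: "s \<in> {0<..<t}"
      then have "at s within {0..<Ts} = at s" using t by (intro at_within_interior) auto
      with C1_partialsD(1)[OF f, of s x] s t
      have "((\<lambda>s. f s x) has_real_derivative ft s x) (at s)" by auto
      then have "((\<lambda>s. extend_to Ts f s x) has_real_derivative ft s x) (at s)"
        by (rule has_field_derivative_transform_within_open[of _ _ _ "{..<Ts}"]) (use s t in auto)
      then show "((\<lambda>s. extend_to Ts f s x) has_vector_derivative extend_to Ts ft s x) (at s)"
        using s t by (simp add: has_real_derivative_iff_has_vector_derivative)
    qed (use t in auto)
    then show ?thesis
      using Ts by (simp add: has_integral_iff)
  qed
  have "((\<lambda>s. extend_to Ts f s x) has_real_derivative extend_to Ts ft t x) (at t within {0..Ts})"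
    if t: "t \<in> {0..Ts}" for t x
  proof (rule has_real_derivative_transform[OF _ t int])
    show "((\<lambda>t. f 0 x + integral {0..t} (\<lambda>s. extend_to Ts ft s x)) has_real_derivative
        extend_to Ts ft t x) (at t within {0..Ts})"
      using DERIV_add[OF DERIV_const
          integral_has_real_derivative[OF continuous_on_slice[OF cont(2) order_refl] t]] by simp
  qed
  moreover have "(extend_to Ts f t has_real_derivative extend_to Ts fx t x) (at x)"
    if t: "t \<in> {0..Ts}" for t x
  proof (cases "t < Ts")
    case True
    then have "extend_to Ts f t = f t" by (auto simp: fun_eq_iff)
    then show ?thesis using True t C1_partialsD(2)[OF f, of t x] by simp
  next
    case False
    then have [simp]: "t = Ts" using t by auto
    define l where "l = extend_to Ts fx Ts x"
    have "\<exists>d>0. \<forall>y. y \<noteq> x \<and> \<bar>y - x\<bar> < d \<longrightarrow>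
        \<bar>(extend_to Ts f Ts y - extend_to Ts f Ts x) / (y - x) - l\<bar> < e" if e: "0 < e" for e
    proof -
      obtain \<delta> where \<delta>: "0 < \<delta>"
        "\<And>t y. 0 \<le> t \<Longrightarrow> Ts - \<delta> < t \<Longrightarrow> t \<le> Ts \<Longrightarrow> \<bar>y - x\<bar> < \<delta> \<Longrightarrow>
           \<bar>extend_to Ts fx t y - l\<bar> \<le> e / 2"
        using extend_to_near[OF Ts lim(3), of "e / 2" x] e unfolding l_def by auto
      have slice: "\<bar>f t y - f t x - (y - x) * l\<bar> \<le> e / 2 * \<bar>y - x\<bar>"
        if t: "0 \<le> t" "Ts - \<delta> < t" "t < Ts" and y: "\<bar>y - x\<bar> < \<delta>" for t y
      proof -
        have "norm ((f t y - y * l) - (f t x - x * l)) \<le> e / 2 * norm (y - x)"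
        proof (rule field_differentiable_bound[where S = "{x - \<delta><..<x + \<delta>}"])
          fix z assume z: "z \<in> {x - \<delta><..<x + \<delta>}"
          show "((\<lambda>y. f t y - y * l) has_real_derivative fx t z - l) (at z within {x - \<delta><..<x + \<delta>})"
            using t has_field_derivative_at_within[OF C1_partialsD(2)[OF f, of t z]]
            by (auto intro!: derivative_eq_intros)
          show "norm (fx t z - l) \<le> e / 2"
            using \<delta>(2)[of t z] t z by (auto simp: abs_less_iff)
        qed (use y \<delta> in \<open>auto simp: abs_less_iff\<close>)
        then show ?thesis by (simp add: algebra_simps)
      qed
      have "\<bar>extend_to Ts f Ts y - extend_to Ts f Ts x - (y - x) * l\<bar> \<le> e / 2 * \<bar>y - x\<bar>"
        if y: "\<bar>y - x\<bar> < \<delta>" for y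
      proof (rule tendsto_upperbound)
        have "((\<lambda>s. extend_to Ts f s z) \<longlongrightarrow> extend_to Ts f Ts z) (at Ts within {0..Ts})" for z
          using continuous_on_slice[OF cont(1) order_refl] Ts by (auto simp: continuous_on_def)
        then show "((\<lambda>s. \<bar>extend_to Ts f s y - extend_to Ts f s x - (y - x) * l\<bar>) \<longlongrightarrow>
           \<bar>extend_to Ts f Ts y - extend_to Ts f Ts x - (y - x) * l\<bar>) (at Ts within {0..Ts})"
          by (intro tendsto_intros)
        show "\<forall>\<^sub>F s in at Ts within {0..Ts}.
            \<bar>extend_to Ts f s y - extend_to Ts f s x - (y - x) * l\<bar> \<le> e / 2 * \<bar>y - x\<bar>"
          unfolding eventually_at
        proof (intro exI[of _ \<delta>] conjI ballI impI)
          fix s assume "s \<in> {0..Ts}" "s \<noteq> Ts \<and> dist s Ts < \<delta>"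
          then show "\<bar>extend_to Ts f s y - extend_to Ts f s x - (y - x) * l\<bar> \<le> e / 2 * \<bar>y - x\<bar>"
            using slice[of s y] y by (auto simp: dist_real_def)
        qed (rule \<delta>(1))
        show "at Ts within {0..Ts} \<noteq> bot"
          using Ts by (simp add: trivial_limit_within)
      qed
      then have "\<bar>(extend_to Ts f Ts y - extend_to Ts f Ts x) / (y - x) - l\<bar> < e"
        if "y \<noteq> x" "\<bar>y - x\<bar> < \<delta>" for y
      proof -
        have "(extend_to Ts f Ts y - extend_to Ts f Ts x) / (y - x) - l
            = (extend_to Ts f Ts y - extend_to Ts f Ts x - (y - x) * l) / (y - x)"
          using that by (simp add: field_simps)
        also have "\<bar>\<dots>\<bar> \<le> e / 2"
          using that \<open>\<bar>y - x\<bar> < \<delta> \<Longrightarrow> _\<close> by (simp add: abs_divide divide_le_eq)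
        finally show ?thesis using e by simp
      qed
      then show ?thesis using \<delta>(1) by blast
    qed
    then show ?thesis
      unfolding has_field_derivative_iff l_def[symmetric] \<open>t = Ts\<close>
      by (intro LIM_I) auto
  qed
  ultimately show ?thesis
    using cont unfolding C1_partials_def by blast
qed

lemma C2_on_extend_to:
  assumes Ts: "0 < Ts" and f: "C2_on {0..<Ts} f" and ft: "Dt {0..<Ts} f = ft" and fx: "Dx f = fx"
    and lim: "edge_limits Ts f" "edge_limits Ts ft" "edge_limits Ts fx"
      "edge_limits Ts (Dt {0..<Ts} ft)" "edge_limits Ts (Dx ft)"
      "edge_limits Ts (Dt {0..<Ts} fx)" "edge_limits Ts (Dx fx)"
  shows "C2_on {0..Ts} (extend_to Ts f)"
proof -
  have nt: "at t within {0..Ts} \<noteq> bot" if "t \<in> {0..Ts}" for t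
    using that Ts by (simp add: trivial_limit_within)
  note C1 = f[unfolded C2_on_def ft fx, THEN conjunct1, THEN C1_on_imp_C1_partials, unfolded ft fx]
    f[unfolded C2_on_def ft fx, THEN conjunct2, THEN conjunct1, THEN C1_on_imp_C1_partials]
    f[unfolded C2_on_def ft fx, THEN conjunct2, THEN conjunct2, THEN C1_on_imp_C1_partials]
  note ext = C1_partials_extend_to[OF Ts C1(1) lim(1-3)]
    C1_partials_extend_to[OF Ts C1(2) lim(2,4,5)] C1_partials_extend_to[OF Ts C1(3) lim(3,6,7)]
  have "Dt {0..Ts} (extend_to Ts f) t x = extend_to Ts ft t x" "Dx (extend_to Ts f) t x = extend_to Ts fx t x"
    if "t \<in> {0..Ts}" for t x
    using C1_partials_Dt[OF ext(1) that nt[OF that]] C1_partials_Dx[OF ext(1) that] .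
  then have "C1_on {0..Ts} (Dt {0..Ts} (extend_to Ts f))" "C1_on {0..Ts} (Dx (extend_to Ts f))"
    using C1_partials_imp_C1_on[OF C1_partials_cong[OF ext(2)] nt]
      C1_partials_imp_C1_on[OF C1_partials_cong[OF ext(3)] nt] by blast+
  then show ?thesis
    using C1_partials_imp_C1_on[OF ext(1) nt] by (simp add: C2_on_def)
qed

section \<open>The Euler equations along sound waves\<close>

lemma C1_partials_cmult:
  "C1_partials J f ft fx \<Longrightarrow> C1_partials J (\<lambda>t x. k * f t x) (\<lambda>t x. k * ft t x) (\<lambda>t x. k * fx t x)"
  using C1_partials_mult[OF C1_partials_const, of J f ft fx k] by simp

lemma C1_partials_diff:
  "C1_partials J f ft fx \<Longrightarrow> C1_partials J g gt gx \<Longrightarrow>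
   C1_partials J (\<lambda>t x. f t x - g t x) (\<lambda>t x. ft t x - gt t x) (\<lambda>t x. fx t x - gx t x)"
  using C1_partials_add[OF _ C1_partials_cmult[of J g gt gx "- 1"]] by simp

lemma C1_partials_divide:
  assumes f: "C1_partials J f ft fx" and g: "C1_partials J g gt gx"
    and pos: "\<And>t x. t \<in> J \<Longrightarrow> 0 < g t x"
  shows "C1_partials J (\<lambda>t x. f t x / g t x) (\<lambda>t x. ft t x / g t x - f t x * gt t x / (g t x)\<^sup>2)
     (\<lambda>t x. fx t x / g t x - f t x * gx t x / (g t x)\<^sup>2)"
proof -
  have "C1_partials J (\<lambda>t x. f t x * g t x powr (- 1))
      (\<lambda>t x. ft t x * g t x powr (- 1) + f t x * (- 1 * g t x powr (- 1 - 1) * gt t x))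
      (\<lambda>t x. fx t x * g t x powr (- 1) + f t x * (- 1 * g t x powr (- 1 - 1) * gx t x))"
    by (intro C1_partials_mult f C1_partials_powr g pos)
  moreover have "y powr (- 1) = 1 / y" "y powr (- 1 - 1) = 1 / y\<^sup>2" if "0 < y" for y :: real
    using that by (simp_all add: powr_minus_divide powr_numeral)
  ultimately show ?thesis
    by (elim C1_partials_cong) (simp_all add: pos abs_of_pos[OF pos])
qed

lemma C1_partials_stationary:
  assumes "\<And>x. (g has_real_derivative g' x) (at x)" and "continuous_on UNIV g'"
  shows "C1_partials J (\<lambda>t x. g x) (\<lambda>t x. 0) (\<lambda>t x. g' x)"
proof -
  have "continuous_on UNIV g"
    using assms(1) DERIV_isCont by (intro continuous_at_imp_continuous_on) blast
  with assms(2) have "continuous_on (J \<times> UNIV) (\<lambda>p. g (snd p))" "continuous_on (J \<times> UNIV) (\<lambda>p. g' (snd p))"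
    by (auto intro!: continuous_on_compose2[of UNIV _ _ snd] continuous_intros)
  then show ?thesis
    using assms(1) by (auto simp: C1_partials_def case_prod_unfold)
qed

lemma C1_partials_unique:
  assumes f: "C1_partials J f ft fx" and g: "C1_partials J g gt gx"
    and eq: "\<And>t x. t \<in> J \<Longrightarrow> f t x = g t x" and t: "t \<in> J" and J: "at t within J \<noteq> bot"
  shows "ft t x = gt t x" "fx t x = gx t x"
proof -
  have "C1_partials J f gt gx"
    by (rule C1_partials_cong[OF g]) (auto simp: eq)
  with f show "ft t x = gt t x" "fx t x = gx t x"
    using C1_partials_Dt[OF _ t J] C1_partials_Dx[OF _ t] by metis+
qed

text \<open>The logarithmic derivatives of \<open>p = K e\<^bsup>S/cv\<^esup> \<tau>\<^bsup>-\<gamma>\<^esup>\<close>.\<close>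

lemma pressure_partials:
  assumes \<tau>: "C1_partials J \<tau> \<tau>t \<tau>x" and S: "C1_partials J S St Sx"
    and pos: "\<And>t x. t \<in> J \<Longrightarrow> 0 < \<tau> t x"
  shows "C1_partials J (pressure K cv \<gamma> \<tau> S)
     (\<lambda>t x. pressure K cv \<gamma> \<tau> S t x * (St t x / cv - \<gamma> * \<tau>t t x / \<tau> t x))
     (\<lambda>t x. pressure K cv \<gamma> \<tau> S t x * (Sx t x / cv - \<gamma> * \<tau>x t x / \<tau> t x))"
proof -
  have *: "K * (exp (1 / cv * s) * (1 / cv * s')) * y powr - \<gamma> + K * exp (1 / cv * s) * (- \<gamma> * y powr (- \<gamma> - 1) * y')
      = K * exp (s / cv) * y powr - \<gamma> * (s' / cv - \<gamma> * y' / y)" if "0 < y" for s s' y y' :: real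
    using that by (simp add: powr_diff algebra_simps)
  show ?thesis
    unfolding pressure_def
    by (rule C1_partials_cong[OF C1_partials_mult[OF C1_partials_cmult[OF C1_partials_exp[OF
              C1_partials_cmult[OF S, of "1 / cv"]], of K] C1_partials_powr[OF \<tau> pos, of "- \<gamma>"]]])
      (assumption, simp, (erule *[OF pos, symmetric])+)
qed

text \<open>For \<open>C\<^sup>1\<close> solutions conservation of energy amounts to \<open>S\<^sub>t = 0\<close>.\<close>

lemma euler_equations_iff:
  assumes u: "C1_partials J u ut ux" and \<tau>: "C1_partials J \<tau> \<tau>t \<tau>x" and S: "C1_partials J S St Sx"
    and pos: "\<And>t x. t \<in> J \<Longrightarrow> 0 < \<tau> t x" and t: "t \<in> J" and J: "at t within J \<noteq> bot"
    and "0 < K" "0 < cv" "1 < \<gamma>"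
  shows "Dt J \<tau> t x - Dx u t x = 0 \<and>
        Dt J u t x + Dx (pressure K cv \<gamma> \<tau> S) t x = 0 \<and>
        Dt J (\<lambda>t x. 1 / 2 * (u t x)\<^sup>2 + internal_energy K cv \<gamma> \<tau> S t x) t x
          + Dx (\<lambda>t x. u t x * pressure K cv \<gamma> \<tau> S t x) t x = 0 \<longleftrightarrow>
      \<tau>t t x = ux t x \<and>
      ut t x = - pressure K cv \<gamma> \<tau> S t x * (Sx t x / cv - \<gamma> * \<tau>x t x / \<tau> t x) \<and> St t x = 0"
proof -
  define p where "p = pressure K cv \<gamma> \<tau> S"
  define pt where "pt = (\<lambda>t x. p t x * (St t x / cv - \<gamma> * \<tau>t t x / \<tau> t x))"
  define px where "px = (\<lambda>t x. p t x * (Sx t x / cv - \<gamma> * \<tau>x t x / \<tau> t x))"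
  have p: "C1_partials J p pt px"
    unfolding p_def pt_def px_def by (rule pressure_partials[OF \<tau> S pos])
  have p_pos: "0 < p t x"
    using \<open>0 < K\<close> pos[OF t, of x] by (simp add: p_def pressure_def)
  have "C1_partials J (\<lambda>t x. 1 / 2 * (u t x * u t x) + 1 / (\<gamma> - 1) * (p t x * \<tau> t x))
     (\<lambda>t x. 1 / 2 * (ut t x * u t x + u t x * ut t x) + 1 / (\<gamma> - 1) * (pt t x * \<tau> t x + p t x * \<tau>t t x))
     (\<lambda>t x. 1 / 2 * (ux t x * u t x + u t x * ux t x) + 1 / (\<gamma> - 1) * (px t x * \<tau> t x + p t x * \<tau>x t x))"
    by (intro C1_partials_add C1_partials_cmult C1_partials_mult u p \<tau>)
  from C1_partials_Dt[OF this t J, of x]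
  have E: "Dt J (\<lambda>t x. 1 / 2 * (u t x)\<^sup>2 + internal_energy K cv \<gamma> \<tau> S t x) t x =
      u t x * ut t x + (pt t x * \<tau> t x + p t x * \<tau>t t x) / (\<gamma> - 1)"
    unfolding internal_energy_def p_def[symmetric] by (simp add: power2_eq_square algebra_simps add_divide_distrib)
  have W: "Dx (\<lambda>t x. u t x * p t x) t x = ux t x * p t x + u t x * px t x"
    by (rule C1_partials_Dx[OF C1_partials_mult[OF u p] t])
  have "u t x * ut t x + (pt t x * \<tau> t x + p t x * \<tau>t t x) / (\<gamma> - 1) + (ux t x * p t x + u t x * px t x)
      = p t x * \<tau> t x / (cv * (\<gamma> - 1)) * St t x" if "\<tau>t t x = ux t x" "ut t x = - px t x"
    using pos[OF t, of x] \<open>0 < cv\<close> \<open>1 < \<gamma>\<close> unfolding pt_def that by (simp add: field_simps)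
  moreover have "p t x * \<tau> t x / (cv * (\<gamma> - 1)) \<noteq> 0"
    using p_pos pos[OF t, of x] \<open>0 < cv\<close> \<open>1 < \<gamma>\<close> by simp
  ultimately show ?thesis
    unfolding E W C1_partials_Dt[OF \<tau> t J] C1_partials_Dt[OF u t J] C1_partials_Dx[OF u t]
      p_def[symmetric] C1_partials_Dx[OF p t]
      mult_minus_left px_def[symmetric, THEN fun_cong, THEN fun_cong]
    by (smt (verit, best) mult_eq_0_iff)
qed

text \<open>The algebra behind the transport equation for \<open>\<alpha>\<close>: here \<open>w = u\<^sub>t / c\<close>.\<close>

lemma riemann_transport_algebra:
  fixes c \<tau> \<gamma> \<sigma> :: real
  assumes "0 < c" "0 < \<tau>" "1 < \<gamma>" "\<sigma> \<in> {1, - 1}"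
    and \<tau>x: "\<tau>x = w / c + 2 * \<tau> * \<mu> / \<gamma>"
    and ct: "ct = - ((\<gamma> + 1) / 2) * c * V / \<tau>" and cx: "cx = c * (\<mu> - (\<gamma> + 1) / 2 * \<tau>x / \<tau>)"
    and Ut: "Ut = c\<^sup>2 * Vx + 2 * c * ct * \<tau>x + 2 * c\<^sup>2 * V * \<mu>"
  shows "(Ux - \<sigma> * (Ut / c - (c * w) * ct / c\<^sup>2)) + \<sigma> * c * (Vx - \<sigma> * (Ux / c - (c * w) * cx / c\<^sup>2)) =
     \<sigma> * c * \<mu> / (2 * \<gamma>) * (3 * (V - \<sigma> * w) + (V + \<sigma> * w))
       + (\<gamma> + 1) / (4 * \<tau>) * (V - \<sigma> * w) * ((V + \<sigma> * w) - (V - \<sigma> * w))"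
proof -
  define a b where "a = (\<gamma> + 1) / (2 * \<tau>)" and "b = \<mu> / \<gamma>"
  have \<mu>: "\<mu> = \<gamma> * b" and \<gamma>: "\<gamma> = 2 * a * \<tau> - 1"
    using assms(2,3) by (simp_all add: a_def b_def field_simps)
  have \<tau>x': "\<tau>x = w / c + 2 * \<tau> * b" using \<tau>x by (simp add: b_def)
  have ct': "ct = - a * c * V" using ct by (simp add: a_def)
  have c\<tau>x: "c * \<tau>x = w + 2 * \<tau> * b * c"
    unfolding \<tau>x' using assms(1) by (simp add: field_simps)
  have "cx = \<gamma> * b * c - a * (c * \<tau>x)" using cx assms(3) by (simp add: a_def b_def algebra_simps)
  then have cx': "cx = - c * b - a * w"
    unfolding c\<tau>x \<gamma> by (simp add: algebra_simps)
  have Ut': "Ut = c\<^sup>2 * Vx - 2 * a * c * V * w - 2 * c\<^sup>2 * V * b"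
  proof -
    have "Ut = c\<^sup>2 * Vx - 2 * a * c * V * (c * \<tau>x) + 2 * c\<^sup>2 * V * \<mu>"
      unfolding Ut ct' by (simp add: power2_eq_square)
    then show ?thesis
      unfolding c\<tau>x \<mu> \<gamma> by (simp add: algebra_simps power2_eq_square)
  qed
  have G: "\<sigma> * c * \<mu> / (2 * \<gamma>) = \<sigma> * c * b / 2" "(\<gamma> + 1) / (4 * \<tau>) = a / 2"
    by (simp_all add: a_def b_def)
  show ?thesis
    unfolding G Ut' cx' ct' using assms(1,4) by (auto simp: field_simps power2_eq_square)
qed

text \<open>Smooth flows on a time interval that contains \<open>0\<close>. The interval is \<open>[0, T)\<close> with \<open>T\<close> possibly
  infinite in the bound on the lifespan, and \<open>[0, Ts)\<close> in the continuation argument.\<close>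

locale gas_flow =
  fixes K cv \<gamma> :: real and J :: "real set" and u \<tau> S :: "real \<Rightarrow> real \<Rightarrow> real"
  assumes K: "0 < K" and cv: "0 < cv" and \<gamma>: "1 < \<gamma>"
    and J_interval: "is_interval J" and J_nontrivial: "\<And>t. t \<in> J \<Longrightarrow> at t within J \<noteq> bot" and zero_J: "0 \<in> J"
    and solution: "smooth_solution K cv \<gamma> J u \<tau> S"
begin

text \<open>The entropy enters through \<open>\<mu> = m\<^sub>x / m\<close> and \<open>\<mu>\<^sub>x\<close>. The fields \<open>ct\<close> and \<open>cx\<close> are the partial
  derivatives of the sound speed \<open>c\<close>, expressed by first derivatives of the solution
  (\<open>c_partials\<close>).\<close>

definition "U = Dt J u"
definition "V = Dx u"
definition "\<tau>x = Dx \<tau>"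
definition "\<mu> t x = Dx S t x / (2 * cv)"
definition "\<mu>x t x = Dx (Dx S) t x / (2 * cv)"
definition "c t x = sqrt (K * \<gamma>) * mvar cv S t x * \<tau> t x powr (- ((\<gamma> + 1) / 2))"
definition "ct t x = - ((\<gamma> + 1) / 2) * c t x * V t x / \<tau> t x"
definition "cx t x = c t x * (\<mu> t x - (\<gamma> + 1) / 2 * \<tau>x t x / \<tau> t x)"

lemma \<tau>_pos: "t \<in> J \<Longrightarrow> 0 < \<tau> t x"
  using solution by (auto simp: smooth_solution_def)

lemma c_pos: "t \<in> J \<Longrightarrow> 0 < c t x"
  using K \<gamma> \<tau>_pos[of t x] by (simp add: c_def mvar_def)

lemma smooth: "C2_on J u" "C2_on J \<tau>" "C2_on J S"
  using solution by (auto simp: smooth_solution_def)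

lemma u_partials: "C1_partials J u U V"
  using smooth(1) unfolding C2_on_def U_def V_def by (blast intro: C1_on_imp_C1_partials)

lemma S_partials: "C1_partials J S (Dt J S) (Dx S)"
  using smooth(3) unfolding C2_on_def by (blast intro: C1_on_imp_C1_partials)

lemma \<tau>_partials_raw: "C1_partials J \<tau> (Dt J \<tau>) \<tau>x"
  using smooth(2) unfolding C2_on_def \<tau>x_def by (blast intro: C1_on_imp_C1_partials)

lemma euler:
  assumes t: "t \<in> J"
  shows "Dt J \<tau> t x = V t x" "Dt J S t x = 0"
    and "U t x = - pressure K cv \<gamma> \<tau> S t x * (Dx S t x / cv - \<gamma> * \<tau>x t x / \<tau> t x)"
  using euler_equations_iff[OF u_partials \<tau>_partials_raw S_partials \<tau>_pos t J_nontrivial[OF t] K cv \<gamma>, of x]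
    solution t unfolding smooth_solution_def by blast+

lemma \<tau>_partials: "C1_partials J \<tau> V \<tau>x"
  by (rule C1_partials_cong[OF \<tau>_partials_raw]) (auto simp: euler)

lemma U_partials: "C1_partials J U (Dt J U) (Dx U)"
  using smooth(1) unfolding C2_on_def U_def by (blast intro: C1_on_imp_C1_partials)

text \<open>In the next two lemmas the symmetry of the mixed derivatives replaces time derivatives by
  space derivatives. In particular \<open>\<tau>\<^sub>x\<^sub>t = u\<^sub>x\<^sub>x\<close>.\<close>

lemma V_partials: "C1_partials J V (Dx U) (Dx V)"
proof (rule C1_partials_cong)
  show V: "C1_partials J V (Dt J V) (Dx V)"
    using smooth(1) unfolding C2_on_def V_def by (blast intro: C1_on_imp_C1_partials)
  show "Dx U t x = Dt J V t x" if "t \<in> J" for t x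
    by (rule mixed_partials_eq[OF u_partials U_partials V J_interval J_nontrivial[OF that] that, symmetric])
qed auto

lemma \<tau>x_partials: "C1_partials J \<tau>x (Dx V) (Dx \<tau>x)"
proof (rule C1_partials_cong)
  show \<tau>x: "C1_partials J \<tau>x (Dt J \<tau>x) (Dx \<tau>x)"
    using smooth(2) unfolding C2_on_def \<tau>x_def by (blast intro: C1_on_imp_C1_partials)
  show "Dx V t x = Dt J \<tau>x t x" if "t \<in> J" for t x
    by (rule mixed_partials_eq[OF \<tau>_partials V_partials \<tau>x J_interval J_nontrivial[OF that] that, symmetric])
qed auto

lemma \<mu>_partials: "C1_partials J \<mu> (\<lambda>t x. 0) \<mu>x"
proof -
  have S: "C1_partials J S (\<lambda>t x. 0) (Dx S)"
    by (rule C1_partials_cong[OF S_partials]) (auto simp: euler)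
  have Sx: "C1_partials J (Dx S) (Dt J (Dx S)) (Dx (Dx S))"
    using smooth(3) unfolding C2_on_def by (blast intro: C1_on_imp_C1_partials)
  have "Dt J (Dx S) t x = 0" if "t \<in> J" for t x
    using mixed_partials_eq[OF S C1_partials_const Sx J_interval J_nontrivial[OF that] that] .
  then show ?thesis
    using C1_partials_cmult[OF Sx, of "1 / (2 * cv)"]
    by (elim C1_partials_cong) (auto simp: \<mu>_def \<mu>x_def)
qed

lemma S_stationary: "t \<in> J \<Longrightarrow> S t x = S 0 x"
proof -
  assume t: "t \<in> J"
  have "((\<lambda>s. S s x) has_real_derivative 0) (at s within J)" if "s \<in> J" for s
    using C1_partialsD(1)[OF S_partials that] euler(2)[OF that] by simp
  then obtain k where "\<And>s. s \<in> J \<Longrightarrow> S s x = k"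
    using has_field_derivative_zero_constant[of J "\<lambda>s. S s x"] is_interval_convex[OF J_interval] by blast
  then show ?thesis using t zero_J by simp
qed

lemma m_partials: "C1_partials J (mvar cv S) (\<lambda>t x. 0) (\<lambda>t x. mvar cv S t x * \<mu> t x)"
  using C1_partials_exp[OF C1_partials_cmult[OF S_partials, of "1 / (2 * cv)"]]
  by (elim C1_partials_cong) (auto simp: mvar_def euler \<mu>_def)

lemma c_partials: "C1_partials J c ct cx"
proof -
  have "C1_partials J (\<lambda>t x. sqrt (K * \<gamma>) * (mvar cv S t x * \<tau> t x powr - ((\<gamma> + 1) / 2)))
    (\<lambda>t x. sqrt (K * \<gamma>) * (0 * \<tau> t x powr - ((\<gamma> + 1) / 2) +
        mvar cv S t x * (- ((\<gamma> + 1) / 2) * \<tau> t x powr (- ((\<gamma> + 1) / 2) - 1) * V t x)))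
    (\<lambda>t x. sqrt (K * \<gamma>) * (mvar cv S t x * \<mu> t x * \<tau> t x powr - ((\<gamma> + 1) / 2) +
        mvar cv S t x * (- ((\<gamma> + 1) / 2) * \<tau> t x powr (- ((\<gamma> + 1) / 2) - 1) * \<tau>x t x)))"
    by (intro C1_partials_cmult C1_partials_mult m_partials C1_partials_powr \<tau>_partials \<tau>_pos)
  moreover have "y powr (- ((\<gamma> + 1) / 2) - 1) = y powr (- ((\<gamma> + 1) / 2)) / y" if "0 < y" for y :: real
    using that by (simp add: powr_diff)
  ultimately show ?thesis
    by (elim C1_partials_cong) (simp_all add: c_def ct_def cx_def \<tau>_pos algebra_simps)
qed

lemma pressure_sound_speed: "t \<in> J \<Longrightarrow> \<gamma> * pressure K cv \<gamma> \<tau> S t x = (c t x)\<^sup>2 * \<tau> t x"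
proof -
  assume t: "t \<in> J"
  have "(exp (S t x / (2 * cv)))\<^sup>2 = exp (S t x / cv)"
    by (simp add: exp_double[symmetric])
  moreover have "(\<tau> t x powr - ((\<gamma> + 1) / 2))\<^sup>2 * \<tau> t x = \<tau> t x powr - \<gamma>"
  proof -
    have "(\<tau> t x powr - ((\<gamma> + 1) / 2))\<^sup>2 = \<tau> t x powr (- \<gamma> - 1)"
    proof -
      have "- ((\<gamma> + 1) / 2) + - ((\<gamma> + 1) / 2) = - \<gamma> - 1" by (simp add: field_simps)
      then show ?thesis by (simp add: power2_eq_square powr_add[symmetric])
    qed
    then show ?thesis
      using \<tau>_pos[OF t, of x] by (simp add: powr_diff)
  qed
  ultimately show ?thesis
    using K \<gamma> by (simp add: pressure_def c_def mvar_def power_mult_distrib mult.assoc)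
qed

text \<open>The momentum equation, with the pressure gradient written out and \<open>\<gamma> p = c\<^sup>2 \<tau>\<close>. Solved for
  \<open>\<tau>\<^sub>x\<close> it shows that \<open>u\<^sub>t\<close>, \<open>u\<^sub>x\<close> and \<open>m\<^sub>x\<close> determine all first derivatives.\<close>

lemma momentum: "t \<in> J \<Longrightarrow> U t x = (c t x)\<^sup>2 * \<tau>x t x - 2 / \<gamma> * ((c t x)\<^sup>2 * (\<tau> t x * \<mu> t x))"
proof -
  assume t: "t \<in> J"
  have p: "pressure K cv \<gamma> \<tau> S t x = (c t x)\<^sup>2 * \<tau> t x / \<gamma>"
    using pressure_sound_speed[OF t, of x] \<gamma> by (simp add: field_simps)
  show ?thesis
    unfolding euler(3)[OF t] p \<mu>_def using \<tau>_pos[OF t, of x] \<gamma> cv by (simp add: field_simps)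
qed

lemma \<tau>x_eq: "t \<in> J \<Longrightarrow> \<tau>x t x = U t x / (c t x)\<^sup>2 + 2 * \<tau> t x * \<mu> t x / \<gamma>"
  using momentum[of t x] c_pos[of t x] \<gamma> by (simp add: field_simps)

text \<open>The wave equation for \<open>u\<close>: the momentum equation differentiated in time. The last term is
  \<open>- 2 p\<^sub>t \<mu>\<close> with \<open>p\<^sub>t = - c\<^sup>2 u\<^sub>x\<close>.\<close>

lemma Ut_eq:
  assumes t: "t \<in> J"
  shows "Dt J U t x = (c t x)\<^sup>2 * Dx V t x + 2 * c t x * ct t x * \<tau>x t x + 2 * (c t x)\<^sup>2 * V t x * \<mu> t x"
proof -
  let ?c2t = "\<lambda>t x. ct t x * c t x + c t x * ct t x" and ?c2x = "\<lambda>t x. cx t x * c t x + c t x * cx t x"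
  have "C1_partials J (\<lambda>t x. (c t x * c t x) * \<tau>x t x - 2 / \<gamma> * ((c t x * c t x) * (\<tau> t x * \<mu> t x)))
     (\<lambda>t x. (?c2t t x * \<tau>x t x + (c t x * c t x) * Dx V t x)
        - 2 / \<gamma> * (?c2t t x * (\<tau> t x * \<mu> t x) + (c t x * c t x) * (V t x * \<mu> t x + \<tau> t x * 0)))
     (\<lambda>t x. (?c2x t x * \<tau>x t x + (c t x * c t x) * Dx \<tau>x t x)
        - 2 / \<gamma> * (?c2x t x * (\<tau> t x * \<mu> t x) + (c t x * c t x) * (\<tau>x t x * \<mu> t x + \<tau> t x * \<mu>x t x)))"
    by (intro C1_partials_diff C1_partials_cmult C1_partials_mult c_partials \<tau>x_partials \<tau>_partials \<mu>_partials)
  from C1_partials_unique(1)[OF U_partials this _ t J_nontrivial[OF t]]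
  have "Dt J U t x = (?c2t t x * \<tau>x t x + (c t x * c t x) * Dx V t x)
        - 2 / \<gamma> * (?c2t t x * (\<tau> t x * \<mu> t x) + (c t x * c t x) * (V t x * \<mu> t x + \<tau> t x * 0))"
    by (simp add: momentum power2_eq_square)
  also have "?c2t t x * (\<tau> t x * \<mu> t x) = - (\<gamma> + 1) * ((c t x)\<^sup>2 * V t x * \<mu> t x)"
    unfolding ct_def using \<tau>_pos[OF t, of x] by (simp add: field_simps power2_eq_square)
  finally show ?thesis
    using \<gamma> by (simp add: field_simps power2_eq_square)
qed

text \<open>The gradient \<open>\<alpha> \<sigma> = u\<^sub>x + \<sigma> p\<^sub>x / c\<close> of the wave family \<open>\<sigma>\<close>. By the momentum equation the pressure
  gradient is \<open>- u\<^sub>t\<close>, and in this form only \<open>u\<close> needs to be differentiated. \<open>G\<close> is the rate of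
  change of \<open>\<alpha> \<sigma>\<close> along the wave (\<open>riemann_transport\<close>).\<close>

definition "\<alpha> \<sigma> t x = V t x - \<sigma> * (U t x / c t x)"
definition "\<alpha>t \<sigma> t x = Dx U t x - \<sigma> * (Dt J U t x / c t x - U t x * ct t x / (c t x)\<^sup>2)"
definition "\<alpha>x \<sigma> t x = Dx V t x - \<sigma> * (Dx U t x / c t x - U t x * cx t x / (c t x)\<^sup>2)"
definition "G \<sigma> t x = \<sigma> * c t x * \<mu> t x / (2 * \<gamma>) * (3 * \<alpha> \<sigma> t x + \<alpha> (- \<sigma>) t x)
   + (\<gamma> + 1) / (4 * \<tau> t x) * \<alpha> \<sigma> t x * (\<alpha> (- \<sigma>) t x - \<alpha> \<sigma> t x)"

lemma \<alpha>_partials: "C1_partials J (\<alpha> \<sigma>) (\<alpha>t \<sigma>) (\<alpha>x \<sigma>)"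
  unfolding \<alpha>_def[abs_def] \<alpha>t_def[abs_def] \<alpha>x_def[abs_def]
  by (intro C1_partials_diff C1_partials_cmult C1_partials_divide V_partials U_partials c_partials c_pos)

lemma riemann_transport:
  assumes t: "t \<in> J" and \<sigma>: "\<sigma> \<in> {1, - 1}"
  shows "\<alpha>t \<sigma> t x + \<sigma> * c t x * \<alpha>x \<sigma> t x = G \<sigma> t x"
proof -
  note c = c_pos[OF t, of x]
  have U: "c t x * (U t x / c t x) = U t x" using c by simp
  have "\<tau>x t x = U t x / c t x / c t x + 2 * \<tau> t x * \<mu> t x / \<gamma>"
    using \<tau>x_eq[OF t, of x] by (simp add: power2_eq_square)
  from riemann_transport_algebra[OF c \<tau>_pos[OF t, of x] \<gamma> \<sigma> this ct_def cx_def Ut_eq[OF t, of x],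
      of "Dx U t x"]
  show ?thesis
    unfolding U \<alpha>t_def \<alpha>x_def G_def \<alpha>_def by simp
qed

end

section \<open>The Riccati equation for the gradient variables\<close>

text \<open>The algebra behind \<open>Y_riccati\<close>, again with \<open>w = u\<^sub>t / c\<close>. The first factor on the left is the
  logarithmic derivative along the wave of the weight of \<open>y\<close> or \<open>q\<close>. In the proof \<open>A\<close> and \<open>B\<close> are
  the gradients of the two wave families; the choice of \<open>e\<close> makes the coefficient of \<open>B\<close> vanish,
  and the power of \<open>m\<close> in the weight makes the remaining terms linear in \<open>A + e\<close> vanish.\<close>

lemma riccati_algebra:
  fixes c \<tau> \<gamma> \<sigma> :: real
  assumes "0 < c" "0 < \<tau>" "1 < \<gamma>" "\<sigma> \<in> {1, - 1}"
    and \<tau>x: "\<tau>x = w / c + 2 * \<tau> * \<mu> / \<gamma>"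
    and ct: "ct = - ((\<gamma> + 1) / 2) * c * V / \<tau>" and cx: "cx = c * (\<mu> - (\<gamma> + 1) / 2 * \<tau>x / \<tau>)"
    and e: "e = 2 / (\<gamma> * (3 * \<gamma> - 1)) * \<sigma> * (c * \<tau> * \<mu>)"
  shows "(- ((\<gamma> + 1) / 4) * V / \<tau> + \<sigma> * c * (- (3 * (3 - \<gamma>) / (2 * (3 * \<gamma> - 1))) * \<mu> - (\<gamma> + 1) / 4 * \<tau>x / \<tau>))
        * (V - \<sigma> * w + e)
      + (\<sigma> * c * \<mu> / (2 * \<gamma>) * (3 * (V - \<sigma> * w) + (V + \<sigma> * w))
         + (\<gamma> + 1) / (4 * \<tau>) * (V - \<sigma> * w) * ((V + \<sigma> * w) - (V - \<sigma> * w)))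
      + (2 / (\<gamma> * (3 * \<gamma> - 1)) * \<sigma> * ((ct * \<tau> + c * V) * \<mu>)
         + \<sigma> * c * (2 / (\<gamma> * (3 * \<gamma> - 1)) * \<sigma> * ((cx * \<tau> + c * \<tau>x) * \<mu> + c * \<tau> * \<mu>x)))
    = - ((\<gamma> + 1) / (4 * \<tau>)) * (V - \<sigma> * w + e)\<^sup>2
      + 2 / (\<gamma> * (3 * \<gamma> - 1)) * c\<^sup>2 * \<tau> * (\<mu>x - 2 / (3 * \<gamma> - 1) * \<mu>\<^sup>2)"
proof -
  define d b where "d = 3 * \<gamma> - 1" and "b = \<mu> / \<gamma>"
  define A B where "A = V - \<sigma> * w" and "B = V + \<sigma> * w"
  define s q where "s = (\<gamma> + 1) / (4 * \<tau>)" and "q = \<sigma> * b * c"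
  define k where "k = 2 / (\<gamma> * d) * c\<^sup>2 * \<tau> * \<mu>x"
  have d: "0 < d" "\<gamma> * 3 = d + 1" and \<mu>: "\<mu> = \<gamma> * b" and \<sigma>\<sigma>: "\<sigma> * \<sigma> = 1"
    using assms(3,4) by (auto simp: d_def b_def)
  have c\<tau>x: "c * \<tau>x = w + 2 * \<tau> * b * c"
    unfolding \<tau>x b_def using assms(1) by (simp add: field_simps)
  have cx': "cx * \<tau> = - c * \<tau> * b - (\<gamma> + 1) / 2 * w"
  proof -
    have "cx * \<tau> = c * \<tau> * \<gamma> * b - (\<gamma> + 1) / 2 * (c * \<tau>x)"
      unfolding cx \<mu> using assms(2) by (simp add: field_simps)
    then show ?thesis unfolding c\<tau>x by (simp add: field_simps)
  qed
  have ct': "ct * \<tau> = - ((\<gamma> + 1) / 2) * c * V"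
    unfolding ct using assms(2) by simp
  have e': "e = 2 / d * \<sigma> * (c * \<tau> * b)"
    unfolding e \<mu> d_def[symmetric] using assms(3) by simp
  have se: "s * e = q * (\<gamma> + 1) / (2 * d)"
    unfolding s_def e' q_def using assms(2) d(1) by (simp add: field_simps)
  have qe: "c\<^sup>2 * \<tau> * b\<^sup>2 = q * e * d / 2"
    unfolding q_def e' using d(1) \<sigma>\<sigma> by (simp add: power2_eq_square)
  define h where "h = 3 * (3 - \<gamma>) / (2 * d) * \<gamma> + (\<gamma> + 1) / 2"
  have h: "h = 3 / 2 + (\<gamma> + 1) / d" "h = 1 + (\<gamma> + 1) / (2 * d) + 2 * \<gamma> / d"
  proof -
    have gam: "\<gamma> = (d + 1) / 3" using d(2) by simp
    show "h = 3 / 2 + (\<gamma> + 1) / d" "h = 1 + (\<gamma> + 1) / (2 * d) + 2 * \<gamma> / d"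
      unfolding h_def gam using d(1) by (simp_all add: field_simps)
  qed
  have W: "- ((\<gamma> + 1) / 4) * V / \<tau> + \<sigma> * c * (- (3 * (3 - \<gamma>) / (2 * d)) * \<mu> - (\<gamma> + 1) / 4 * \<tau>x / \<tau>)
      = - s * B - q * h"
  proof -
    have 1: "\<sigma> * c * (- (3 * (3 - \<gamma>) / (2 * d)) * \<mu> - (\<gamma> + 1) / 4 * \<tau>x / \<tau>)
        = - (3 * (3 - \<gamma>) / (2 * d)) * \<gamma> * q - s * (\<sigma> * (c * \<tau>x))"
      unfolding \<mu> q_def s_def by (simp add: algebra_simps)
    have 2: "s * (\<sigma> * (c * \<tau>x)) = s * (\<sigma> * w) + (\<gamma> + 1) / 2 * q"
      unfolding c\<tau>x s_def q_def using assms(2) by (simp add: field_simps)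
    have 3: "- ((\<gamma> + 1) / 4) * V / \<tau> = - s * V"
      by (simp add: s_def)
    have "- s * V + (- P * \<gamma> * q - (s * (\<sigma> * w) + R * q)) = - s * (V + \<sigma> * w) - q * (P * \<gamma> + R)" for P R
      by (simp add: algebra_simps)
    then show ?thesis
      unfolding 3 1 2 B_def h_def .
  qed
  have E: "2 / (\<gamma> * d) * \<sigma> * ((ct * \<tau> + c * V) * \<mu>)
      + \<sigma> * c * (2 / (\<gamma> * d) * \<sigma> * ((cx * \<tau> + c * \<tau>x) * \<mu> + c * \<tau> * \<mu>x))
     = q * (1 - \<gamma>) / d * B + q * e + k"
  proof -
    have 1: "2 / (\<gamma> * d) * \<sigma> * ((ct * \<tau> + c * V) * \<mu>) = q * (1 - \<gamma>) / d * V"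
      unfolding ct' \<mu> q_def using assms(3) d(1) by (simp add: field_simps)
    have "\<sigma> * c * (2 / (\<gamma> * d) * \<sigma> * ((cx * \<tau> + c * \<tau>x) * \<mu> + c * \<tau> * \<mu>x))
        = (\<sigma> * \<sigma>) * (2 / (\<gamma> * d) * c * ((cx * \<tau> + c * \<tau>x) * \<mu>) + k)"
      by (simp add: k_def power2_eq_square algebra_simps)
    also have "\<dots> = 2 / (\<gamma> * d) * c * ((cx * \<tau> + c * \<tau>x) * \<mu>) + k"
      unfolding \<sigma>\<sigma> by simp
    also have "2 / (\<gamma> * d) * c * ((cx * \<tau> + c * \<tau>x) * \<mu>) = (1 - \<gamma>) / d * (b * c * w) + 2 / d * (c\<^sup>2 * \<tau> * b\<^sup>2)"
      unfolding cx' c\<tau>x \<mu> using assms(3) d(1) by (simp add: field_simps power2_eq_square)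
    also have "b * c * w = q * (\<sigma> * w)"
      using \<sigma>\<sigma> by (simp add: q_def)
    also have "2 / d * (c\<^sup>2 * \<tau> * b\<^sup>2) = q * e"
      unfolding qe using d(1) by simp
    finally show ?thesis
      unfolding 1 B_def by (simp add: algebra_simps add_divide_distrib diff_divide_distrib)
  qed
  have G: "\<sigma> * c * \<mu> / (2 * \<gamma>) = q / 2"
    unfolding q_def b_def by (simp add: ac_simps)
  have "2 / (\<gamma> * d) * c\<^sup>2 * \<tau> * (\<mu>x - 2 / d * \<mu>\<^sup>2) = k - 4 * \<gamma> / d\<^sup>2 * (c\<^sup>2 * \<tau> * b\<^sup>2)"
    unfolding k_def \<mu> using assms(3) d(1) by (simp add: field_simps power2_eq_square)
  also have "4 * \<gamma> / d\<^sup>2 * (c\<^sup>2 * \<tau> * b\<^sup>2) = 2 * \<gamma> / d * (q * e)"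
    unfolding qe using d(1) by (simp add: field_simps power2_eq_square)
  finally have N: "2 / (\<gamma> * d) * c\<^sup>2 * \<tau> * (\<mu>x - 2 / d * \<mu>\<^sup>2) = k - 2 * \<gamma> / d * (q * e)" .
  have "(- s * B - q * h) * (A + e) + (q / 2 * (3 * A + B) + s * A * (B - A))
      + (q * (1 - \<gamma>) / d * B + q * e + k)
    = - (s * e) * B + (q / 2 + q * (1 - \<gamma>) / d) * B + q * (3 / 2 - h) * A + q * e * (1 - h) - s * A\<^sup>2 + k"
    by (simp add: algebra_simps power2_eq_square)
  also have "- (s * e) * B + (q / 2 + q * (1 - \<gamma>) / d) * B = 0"
  proof -
    have X: "q * (\<gamma> + 1) / (2 * d) = q / 2 + q * (1 - \<gamma>) / d"
    proof -
      have gam: "\<gamma> = (d + 1) / 3" using d(2) by simp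
      show ?thesis unfolding gam using d(1) by (simp add: field_simps)
    qed
    show ?thesis unfolding se X[symmetric] by (simp only: mult_minus_left left_minus)
  qed
  also have "q * (3 / 2 - h) * A = - 2 * (s * e) * A"
    unfolding se h(1) using d(1) by (simp add: field_simps)
  also have "q * e * (1 - h) = - (s * e) * e - 2 * \<gamma> / d * (q * e)"
    unfolding se h(2) by (simp add: algebra_simps add_divide_distrib)
  finally have "(- s * B - q * h) * (A + e) + (q / 2 * (3 * A + B) + s * A * (B - A))
      + (q * (1 - \<gamma>) / d * B + q * e + k) = - s * (A + e)\<^sup>2 + (k - 2 * \<gamma> / d * (q * e))"
    by (simp add: algebra_simps power2_eq_square)
  then show ?thesis
    unfolding d_def[symmetric] W E G N s_def[symmetric] A_def[symmetric] B_def[symmetric] .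
qed

text \<open>A solution of \<open>Y' \<le> - A Y\<^sup>2\<close> with \<open>Y(0) < 0\<close> would reach \<open>- \<infinity>\<close> at time
  \<open>- 1 / (A Y(0))\<close> at the latest, since \<open>1 / Y - A t\<close> increases.\<close>

lemma riccati_blowup:
  fixes Y :: "real \<Rightarrow> real"
  assumes Y: "\<And>t. t \<in> {0..b} \<Longrightarrow> (Y has_real_derivative Y' t) (at t within {0..b})"
    and le: "\<And>t. t \<in> {0..b} \<Longrightarrow> Y' t \<le> - A * (Y t)\<^sup>2" and A: "0 < A" and Y0: "Y 0 < 0" and b: "0 \<le> b"
  shows "b < - (1 / (Y 0 * A))"
proof -
  have neg: "Y t < 0" if t: "t \<in> {0..b}" for t
  proof -
    have sub: "{0..t} \<subseteq> {0..b}" using t by auto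
    have "0 \<le> t" using t by simp
    from mvt_within[OF this DERIV_subset[OF Y sub]] sub
    obtain \<xi> where "\<xi> \<in> {0..t}" "Y t - Y 0 = (t - 0) * Y' \<xi>" by blast
    moreover have "Y' \<xi> \<le> 0" if "\<xi> \<in> {0..t}" for \<xi>
      using le[of \<xi>] sub that A by (auto intro: order_trans simp: mult_nonneg_nonneg)
    ultimately show ?thesis
      using Y0 mult_nonneg_nonpos[of t "Y' \<xi>"] t by auto
  qed
  have "((\<lambda>t. 1 / Y t - A * t) has_real_derivative - Y' t / (Y t)\<^sup>2 - A) (at t within {0..b})"
    if t: "t \<in> {0..b}" for t
    using Y[OF t] neg[OF t] by (auto intro!: derivative_eq_intros simp: power2_eq_square)
  from mvt_within[OF b this]
  obtain \<xi> where \<xi>: "\<xi> \<in> {0..b}"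
    "(1 / Y b - A * b) - (1 / Y 0 - A * 0) = (b - 0) * (- Y' \<xi> / (Y \<xi>)\<^sup>2 - A)" by blast
  have "0 \<le> - Y' \<xi> / (Y \<xi>)\<^sup>2 - A"
    using le[OF \<xi>(1)] neg[OF \<xi>(1)] by (simp add: field_simps)
  then have "0 \<le> (1 / Y b - A * b) - 1 / Y 0"
    using \<xi>(2) b by simp
  moreover have "1 / Y b < 0" using neg[of b] b by simp
  ultimately have "A * b < - (1 / Y 0)" by linarith
  then have "b < - (1 / Y 0) / A"
    using A by (simp only: pos_less_divide_eq mult.commute)
  then show ?thesis by simp
qed

context gas_flow
begin

text \<open>\<open>Y 1\<close> is \<open>y\<close> and \<open>Y (- 1)\<close> is \<open>q\<close> (\<open>yvar_eq\<close>, \<open>qvar_eq\<close>); \<open>e\<close> is the difference between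
  \<open>\<alpha>\<close> and the unweighted gradient variable.\<close>

definition "z = zvar K \<gamma> \<tau>"
definition "weight t x = mvar cv S t x powr (- (3 * (3 - \<gamma>) / (2 * (3 * \<gamma> - 1)))) * z t x powr ((\<gamma> + 1) / (2 * (\<gamma> - 1)))"
definition "e \<sigma> t x = 2 / (\<gamma> * (3 * \<gamma> - 1)) * \<sigma> * (c t x * \<tau> t x * \<mu> t x)"
definition "Y \<sigma> t x = weight t x * (\<alpha> \<sigma> t x + e \<sigma> t x)"

lemma m_pos: "0 < mvar cv S t x"
  by (simp add: mvar_def)

lemma z_pos: "t \<in> J \<Longrightarrow> 0 < z t x"
  using K \<gamma> \<tau>_pos[of t x] by (simp add: z_def zvar_def)

lemma mz_eq: "t \<in> J \<Longrightarrow> mvar cv S t x * z t x = 2 / (\<gamma> - 1) * (c t x * \<tau> t x)"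
proof -
  assume t: "t \<in> J"
  have "- ((\<gamma> + 1) / 2) + 1 = - ((\<gamma> - 1) / 2)" by (simp add: field_simps)
  then have "\<tau> t x powr (- ((\<gamma> - 1) / 2)) = \<tau> t x powr (- ((\<gamma> + 1) / 2)) * \<tau> t x powr 1"
    by (simp only: powr_add[symmetric])
  then show ?thesis
    using \<tau>_pos[OF t, of x] by (simp add: z_def zvar_def c_def)
qed

lemma gradient_variable_eq:
  assumes t: "t \<in> J"
  shows "V t x + \<sigma> * (2 / (\<gamma> - 1) * (cx t x * \<tau> t x + c t x * \<tau>x t x))
      - \<sigma> * (2 / (3 * \<gamma> - 1) * (mvar cv S t x * \<mu> t x * z t x)) = \<alpha> \<sigma> t x + e \<sigma> t x"
proof -
  have c: "c t x * \<tau>x t x = U t x / c t x + 2 * (c t x * \<tau> t x * \<mu> t x) / \<gamma>"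
    using \<tau>x_eq[OF t, of x] c_pos[OF t, of x] \<gamma> by (simp add: field_simps power2_eq_square)
  have cx: "cx t x * \<tau> t x = c t x * \<tau> t x * \<mu> t x - (\<gamma> + 1) / 2 * (c t x * \<tau>x t x)"
    unfolding cx_def using \<tau>_pos[OF t, of x] by (simp add: field_simps)
  have mz: "mvar cv S t x * \<mu> t x * z t x = 2 / (\<gamma> - 1) * (c t x * \<tau> t x * \<mu> t x)"
  proof -
    have "mvar cv S t x * \<mu> t x * z t x = (mvar cv S t x * z t x) * \<mu> t x" by simp
    then show ?thesis unfolding mz_eq[OF t] by simp
  qed
  define f where "f = c t x * \<tau> t x * \<mu> t x"
  have d: "3 * \<gamma> - 1 \<noteq> 0" "\<gamma> - 1 \<noteq> 0" "\<gamma> \<noteq> 0" using \<gamma> by auto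
  have H: "2 / (\<gamma> - 1) * (cx t x * \<tau> t x + c t x * \<tau>x t x) - 2 / (3 * \<gamma> - 1) * (2 / (\<gamma> - 1) * f)
      = - (U t x / c t x) + 2 / (\<gamma> * (3 * \<gamma> - 1)) * f"
    unfolding cx c f_def[symmetric] using d by (simp add: divide_simps) (simp add: algebra_simps)
  have factor: "V t x + \<sigma> * a - \<sigma> * b = V t x + \<sigma> * (a - b)" for a b
    by (simp add: algebra_simps)
  show ?thesis
    unfolding mz f_def[symmetric] factor H unfolding \<alpha>_def e_def f_def[symmetric] by (simp add: algebra_simps)
qed

lemma mz_derivative:
  assumes t: "t \<in> J"
  shows "((\<lambda>y. mvar cv S t y * zvar K \<gamma> \<tau> t y) has_real_derivative
     2 / (\<gamma> - 1) * (cx t x * \<tau> t x + c t x * \<tau>x t x)) (at x)"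
  using C1_partialsD(2)[OF C1_partials_cmult[OF C1_partials_mult[OF c_partials \<tau>_partials], of "2 / (\<gamma> - 1)"] t, of x]
  by (simp add: mz_eq[OF t, unfolded z_def])

lemma yvar_eq: "t \<in> J \<Longrightarrow> yvar K cv \<gamma> u \<tau> S t x = Y 1 t x"
proof -
  assume t: "t \<in> J"
  have "Dx (\<lambda>t x. u t x + mvar cv S t x * zvar K \<gamma> \<tau> t x) t x
      = V t x + 2 / (\<gamma> - 1) * (cx t x * \<tau> t x + c t x * \<tau>x t x)"
    by (rule Dx_eqI, rule DERIV_add[OF C1_partialsD(2)[OF u_partials t] mz_derivative[OF t]])
  then show ?thesis
    unfolding yvar_def Y_def gradient_variable_eq[OF t, symmetric] C1_partials_Dx[OF m_partials t]
    by (simp add: weight_def z_def mult.assoc)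
qed

lemma qvar_eq: "t \<in> J \<Longrightarrow> qvar K cv \<gamma> u \<tau> S t x = Y (- 1) t x"
proof -
  assume t: "t \<in> J"
  have "Dx (\<lambda>t x. u t x - mvar cv S t x * zvar K \<gamma> \<tau> t x) t x
      = V t x - 2 / (\<gamma> - 1) * (cx t x * \<tau> t x + c t x * \<tau>x t x)"
    by (rule Dx_eqI, rule DERIV_diff[OF C1_partialsD(2)[OF u_partials t] mz_derivative[OF t]])
  then show ?thesis
    unfolding qvar_def Y_def gradient_variable_eq[OF t, symmetric] C1_partials_Dx[OF m_partials t]
    by (simp add: weight_def z_def mult.assoc) (simp add: diff_divide_distrib add_divide_distrib)
qed

lemma weight_partials:
  "C1_partials J weight (\<lambda>t x. weight t x * (- ((\<gamma> + 1) / 4) * V t x / \<tau> t x))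
     (\<lambda>t x. weight t x * (- (3 * (3 - \<gamma>) / (2 * (3 * \<gamma> - 1))) * \<mu> t x - (\<gamma> + 1) / 4 * \<tau>x t x / \<tau> t x))"
proof -
  define a b where "a = - (3 * (3 - \<gamma>) / (2 * (3 * \<gamma> - 1)))" and "b = (\<gamma> + 1) / (2 * (\<gamma> - 1))"
  have b: "b * - ((\<gamma> - 1) / 2) = - ((\<gamma> + 1) / 4)" using \<gamma> by (simp add: b_def field_simps)
  have "C1_partials J (\<lambda>t x. 2 * sqrt (K * \<gamma>) / (\<gamma> - 1) * \<tau> t x powr - ((\<gamma> - 1) / 2))
     (\<lambda>t x. 2 * sqrt (K * \<gamma>) / (\<gamma> - 1) * (- ((\<gamma> - 1) / 2) * \<tau> t x powr (- ((\<gamma> - 1) / 2) - 1) * V t x))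
     (\<lambda>t x. 2 * sqrt (K * \<gamma>) / (\<gamma> - 1) * (- ((\<gamma> - 1) / 2) * \<tau> t x powr (- ((\<gamma> - 1) / 2) - 1) * \<tau>x t x))"
    by (intro C1_partials_cmult C1_partials_powr \<tau>_partials \<tau>_pos)
  then have z: "C1_partials J z (\<lambda>t x. - ((\<gamma> - 1) / 2) * z t x * V t x / \<tau> t x)
     (\<lambda>t x. - ((\<gamma> - 1) / 2) * z t x * \<tau>x t x / \<tau> t x)"
    by (elim C1_partials_cong) (simp_all add: z_def zvar_def powr_diff less_imp_le[OF \<tau>_pos] abs_of_pos[OF \<tau>_pos])
  have raw: "C1_partials J (\<lambda>t x. mvar cv S t x powr a * z t x powr b)
      (\<lambda>t x. a * mvar cv S t x powr (a - 1) * 0 * z t x powr b + mvar cv S t x powr a *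
         (b * z t x powr (b - 1) * (- ((\<gamma> - 1) / 2) * z t x * V t x / \<tau> t x)))
      (\<lambda>t x. a * mvar cv S t x powr (a - 1) * (mvar cv S t x * \<mu> t x) * z t x powr b + mvar cv S t x powr a *
         (b * z t x powr (b - 1) * (- ((\<gamma> - 1) / 2) * z t x * \<tau>x t x / \<tau> t x)))"
    by (intro C1_partials_mult C1_partials_powr m_partials m_pos z z_pos)
  have pow: "y powr (r - 1) * y = y powr r" if "0 < y" for y r :: real
    using that by (simp add: powr_diff)
  have z_deriv: "b * z t x powr (b - 1) * (- ((\<gamma> - 1) / 2) * z t x * f / g)
      = z t x powr b * (- ((\<gamma> + 1) / 4) * f / g)" if "t \<in> J" for t x f g
  proof -
    have "b * z t x powr (b - 1) * (- ((\<gamma> - 1) / 2) * z t x * f / g)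
      = (b * - ((\<gamma> - 1) / 2)) * (z t x powr (b - 1) * z t x) * f / g" by simp
    then show ?thesis unfolding b pow[OF z_pos[OF that]] by simp
  qed
  have m_deriv: "a * mvar cv S t x powr (a - 1) * (mvar cv S t x * f) = mvar cv S t x powr a * (a * f)" for t x f
    using pow[OF m_pos, of t x a] by (simp add: mult.assoc[symmetric])
  show ?thesis
    unfolding weight_def[abs_def] a_def[symmetric] b_def[symmetric]
    by (rule C1_partials_cong[OF raw]) (unfold z_deriv m_deriv, simp_all add: algebra_simps)
qed

lemma weight_pos: "t \<in> J \<Longrightarrow> 0 < weight t x"
  using m_pos[of t x] z_pos[of t x] by (simp add: weight_def)

text \<open>The product is independent of the entropy: the powers of \<open>m\<close> cancel, those of \<open>z\<close> combine to
  \<open>K\<^sub>\<tau> / \<tau>\<close>, and \<open>K\<^sub>c K\<^sub>\<tau> = (\<gamma> - 1) / 2\<close>. Thus \<open>a\<^sub>2 Y\<^sup>2\<close> is the weight times the quadratic term of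
  \<open>riccati_algebra\<close>.\<close>

lemma a2_weight:
  assumes t: "t \<in> J"
  shows "a2 K \<gamma> (z t x) (mvar cv S t x) * weight t x = - ((\<gamma> + 1) / (4 * \<tau> t x))"
proof -
  define k where "k = 2 * sqrt (K * \<gamma>) / (\<gamma> - 1)"
  have k: "0 < k" using K \<gamma> by (simp add: k_def)
  note z = z_pos[OF t, of x] and m = m_pos[of t x] and \<tau> = \<tau>_pos[OF t, of x]
  define a b where "a = 3 * (3 - \<gamma>) / (2 * (3 * \<gamma> - 1))" and "b = (\<gamma> + 1) / (2 * (\<gamma> - 1))"
  have "z t x powr (b - 1) * z t x powr b = z t x powr (2 / (\<gamma> - 1))"
  proof -
    define g where "g = \<gamma> - 1"
    have "g \<noteq> 0" "\<gamma> = g + 1" using \<gamma> by (simp_all add: g_def)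
    then have "b - 1 + b = 2 / (\<gamma> - 1)" by (simp add: b_def field_simps)
    then show ?thesis by (simp add: powr_add[symmetric])
  qed
  also have "\<dots> = k powr (2 / (\<gamma> - 1)) / \<tau> t x"
  proof -
    have "- ((\<gamma> - 1) / 2) * (2 / (\<gamma> - 1)) = - 1" using \<gamma> by (simp add: field_simps)
    then have "(\<tau> t x powr (- ((\<gamma> - 1) / 2))) powr (2 / (\<gamma> - 1)) = \<tau> t x powr (- 1)"
      by (simp only: powr_powr)
    also have "\<dots> = 1 / \<tau> t x"
      using \<tau> by (simp add: powr_minus_divide)
    finally have "(\<tau> t x powr (- ((\<gamma> - 1) / 2))) powr (2 / (\<gamma> - 1)) = 1 / \<tau> t x" .
    then show ?thesis
      using k \<tau> unfolding z_def zvar_def k_def[symmetric] by (simp add: powr_mult)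
  qed
  finally have z_pow: "z t x powr (b - 1) * z t x powr b = K_tau K \<gamma> / \<tau> t x"
    by (simp add: K_tau_def k_def)
  have "K_tau K \<gamma> powr (- ((\<gamma> + 1) / 2)) * K_tau K \<gamma> = 1 / k"
  proof -
    have "K_tau K \<gamma> powr (- ((\<gamma> + 1) / 2)) * K_tau K \<gamma> powr 1 = K_tau K \<gamma> powr (- ((\<gamma> + 1) / 2) + 1)"
      by (simp only: powr_add)
    also have "- ((\<gamma> + 1) / 2) + 1 = - ((\<gamma> - 1) / 2)" by (simp add: field_simps)
    also have "K_tau K \<gamma> powr (- ((\<gamma> - 1) / 2)) = k powr (2 / (\<gamma> - 1) * - ((\<gamma> - 1) / 2))"
      by (simp only: K_tau_def k_def powr_powr)
    also have "2 / (\<gamma> - 1) * - ((\<gamma> - 1) / 2) = - 1" using \<gamma> by (simp add: field_simps)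
    finally show ?thesis using k by (simp add: powr_minus_divide K_tau_def)
  qed
  then have Kc: "K_c K \<gamma> * K_tau K \<gamma> = (\<gamma> - 1) / 2"
    using K \<gamma> by (simp add: K_c_def mult.assoc k_def)
  have "mvar cv S t x powr a * mvar cv S t x powr (- a) = 1"
    using m by (simp add: powr_add[symmetric])
  then have "a2 K \<gamma> (z t x) (mvar cv S t x) * weight t x
      = - K_c K \<gamma> * b * (z t x powr (b - 1) * z t x powr b)"
    unfolding a2_def weight_def a_def[symmetric] b_def[symmetric] by (simp add: algebra_simps)
  also have "\<dots> = - (K_c K \<gamma> * K_tau K \<gamma>) * b / \<tau> t x"
    unfolding z_pow by simp
  also have "\<dots> = - ((\<gamma> + 1) / (4 * \<tau> t x))"
    unfolding Kc b_def using \<gamma> \<tau> by (simp add: field_simps)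
  finally show ?thesis .
qed

text \<open>Besides \<open>- \<alpha>\<^sup>2\<close> the rate of \<open>\<alpha>\<close> contains its product with the gradient of the other wave family
  and terms linear in both gradients. The summand \<open>e\<close> and the weight are chosen such that all of
  these cancel.\<close>

lemma Y_riccati:
  assumes t: "t \<in> I" and I: "I \<subseteq> J" and \<sigma>: "\<sigma> \<in> {1, - 1}"
    and X: "(X has_real_derivative \<sigma> * c t (X t)) (at t within I)"
  shows "((\<lambda>r. Y \<sigma> r (X r)) has_real_derivative
     a2 K \<gamma> (z t (X t)) (mvar cv S t (X t)) * (Y \<sigma> t (X t))\<^sup>2
       + weight t (X t) * (2 / (\<gamma> * (3 * \<gamma> - 1)) * (c t (X t))\<^sup>2 * \<tau> t (X t)
          * (\<mu>x t (X t) - 2 / (3 * \<gamma> - 1) * (\<mu> t (X t))\<^sup>2))) (at t within I)"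
proof -
  have tJ: "t \<in> J" using t I by auto
  define x where "x = X t"
  let ?k = "2 / (\<gamma> * (3 * \<gamma> - 1))"
  have e: "C1_partials J (e \<sigma>) (\<lambda>t x. ?k * \<sigma> * ((ct t x * \<tau> t x + c t x * V t x) * \<mu> t x + c t x * \<tau> t x * 0))
     (\<lambda>t x. ?k * \<sigma> * ((cx t x * \<tau> t x + c t x * \<tau>x t x) * \<mu> t x + c t x * \<tau> t x * \<mu>x t x))"
    unfolding e_def[abs_def] by (intro C1_partials_cmult C1_partials_mult c_partials \<tau>_partials \<mu>_partials)
  note Y = C1_partials_along[OF C1_partials_mult[OF weight_partials C1_partials_add[OF \<alpha>_partials e]] I t X,
      folded x_def, of \<sigma>]
  note c = c_pos[OF tJ, of x]
  have U: "c t x * (U t x / c t x) = U t x" using c by simp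
  have \<tau>x: "\<tau>x t x = U t x / c t x / c t x + 2 * \<tau> t x * \<mu> t x / \<gamma>"
    using \<tau>x_eq[OF tJ, of x] by (simp add: power2_eq_square)
  have \<alpha>: "V t x - \<sigma> * (U t x / c t x) = \<alpha> \<sigma> t x" "V t x + \<sigma> * (U t x / c t x) = \<alpha> (- \<sigma>) t x"
    by (simp_all add: \<alpha>_def)
  note alg = riccati_algebra[OF c \<tau>_pos[OF tJ, of x] \<gamma> \<sigma> \<tau>x ct_def cx_def e_def, of "\<mu>x t x",
      unfolded \<alpha> G_def[of \<sigma> t x, symmetric] riemann_transport[OF tJ \<sigma>, symmetric]]
  have "weight t x * (- ((\<gamma> + 1) / 4) * V t x / \<tau> t x) * (\<alpha> \<sigma> t x + e \<sigma> t x)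
      + weight t x * (\<alpha>t \<sigma> t x + ?k * \<sigma> * ((ct t x * \<tau> t x + c t x * V t x) * \<mu> t x + c t x * \<tau> t x * 0))
      + \<sigma> * c t x * (weight t x * (- (3 * (3 - \<gamma>) / (2 * (3 * \<gamma> - 1))) * \<mu> t x - (\<gamma> + 1) / 4 * \<tau>x t x / \<tau> t x)
            * (\<alpha> \<sigma> t x + e \<sigma> t x)
          + weight t x * (\<alpha>x \<sigma> t x + ?k * \<sigma> * ((cx t x * \<tau> t x + c t x * \<tau>x t x) * \<mu> t x + c t x * \<tau> t x * \<mu>x t x)))
     = weight t x * (- ((\<gamma> + 1) / (4 * \<tau> t x)) * (\<alpha> \<sigma> t x + e \<sigma> t x)\<^sup>2
         + ?k * (c t x)\<^sup>2 * \<tau> t x * (\<mu>x t x - 2 / (3 * \<gamma> - 1) * (\<mu> t x)\<^sup>2))"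
    unfolding alg[symmetric] by (simp add: algebra_simps add_divide_distrib)
  also have "\<dots> = a2 K \<gamma> (z t x) (mvar cv S t x) * (Y \<sigma> t x)\<^sup>2
       + weight t x * (?k * (c t x)\<^sup>2 * \<tau> t x * (\<mu>x t x - 2 / (3 * \<gamma> - 1) * (\<mu> t x)\<^sup>2))"
    unfolding a2_weight[OF tJ, symmetric] Y_def by (simp add: power2_eq_square algebra_simps)
  finally show ?thesis
    using Y unfolding Y_def x_def by simp
qed

end

section \<open>First derivatives up to the final time\<close>

text \<open>Bounds and limits at all points of the final line. Both properties are preserved by
  arithmetic operations. Positive limits are treated separately, since they permit division and
  real powers.\<close>

definition edge_bounded :: "real \<Rightarrow> (real \<Rightarrow> real \<Rightarrow> real) \<Rightarrow> bool" where
  "edge_bounded Ts f \<longleftrightarrow> (\<forall>x0. Bfun (case_prod f) (edge Ts x0))"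

definition edge_limits_pos :: "real \<Rightarrow> (real \<Rightarrow> real \<Rightarrow> real) \<Rightarrow> bool" where
  "edge_limits_pos Ts f \<longleftrightarrow> (\<forall>x0. \<exists>l>0. (case_prod f \<longlongrightarrow> l) (edge Ts x0))"

lemma eventually_edge_time: "0 < Ts \<Longrightarrow> eventually (\<lambda>p. fst p \<in> {0..<Ts}) (edge Ts x0)"
  unfolding eventually_edge by (intro exI[of _ Ts]) auto

lemma edge_limits_cong:
  assumes "0 < Ts" and "edge_limits Ts f" and "\<And>t x. t \<in> {0..<Ts} \<Longrightarrow> g t x = f t x"
  shows "edge_limits Ts g"
proof -
  have "eventually (\<lambda>p. case_prod g p = case_prod f p) (edge Ts x0)" for x0
    using eventually_edge_time[OF assms(1)] by eventually_elim (use assms(3) in \<open>auto simp: case_prod_unfold\<close>)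
  from filterlim_cong[OF refl refl this] show ?thesis
    using assms(2) unfolding edge_limits_def by blast
qed

lemma edge_limits_const: "edge_limits Ts (\<lambda>t x. k)"
  by (auto simp: edge_limits_def case_prod_unfold intro: exI[of _ k])

lemma edge_limits_binary:
  assumes "edge_limits Ts f" "edge_limits Ts g"
    and op: "\<And>l k F. (case_prod f \<longlongrightarrow> l) F \<Longrightarrow> (case_prod g \<longlongrightarrow> k) F \<Longrightarrow>
      ((\<lambda>p. h (case_prod f p) (case_prod g p)) \<longlongrightarrow> h l k) F"
  shows "edge_limits Ts (\<lambda>t x. h (f t x) (g t x))"
  unfolding edge_limits_def
proof
  fix x0
  obtain l k where "(case_prod f \<longlongrightarrow> l) (edge Ts x0)" "(case_prod g \<longlongrightarrow> k) (edge Ts x0)"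
    using assms(1,2) unfolding edge_limits_def by blast
  from op[OF this] show "\<exists>l. ((\<lambda>(t, x). h (f t x) (g t x)) \<longlongrightarrow> l) (edge Ts x0)"
    by (auto simp: case_prod_unfold)
qed

lemma edge_limits_add: "edge_limits Ts f \<Longrightarrow> edge_limits Ts g \<Longrightarrow> edge_limits Ts (\<lambda>t x. f t x + g t x)"
  by (rule edge_limits_binary[where h = "(+)", OF _ _ tendsto_add])

lemma edge_limits_diff: "edge_limits Ts f \<Longrightarrow> edge_limits Ts g \<Longrightarrow> edge_limits Ts (\<lambda>t x. f t x - g t x)"
  by (rule edge_limits_binary[where h = "(-)", OF _ _ tendsto_diff])

lemma edge_limits_mult: "edge_limits Ts f \<Longrightarrow> edge_limits Ts g \<Longrightarrow> edge_limits Ts (\<lambda>t x. f t x * g t x)"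
  by (rule edge_limits_binary[where h = "(*)", OF _ _ tendsto_mult])

lemma edge_limits_divide:
  assumes "edge_limits Ts f" "edge_limits_pos Ts g"
  shows "edge_limits Ts (\<lambda>t x. f t x / g t x)"
  unfolding edge_limits_def
proof
  fix x0
  obtain l k where "(case_prod f \<longlongrightarrow> l) (edge Ts x0)" "(case_prod g \<longlongrightarrow> k) (edge Ts x0)" "0 < k"
    using assms unfolding edge_limits_def edge_limits_pos_def by blast
  then have "((\<lambda>p. case_prod f p / case_prod g p) \<longlongrightarrow> l / k) (edge Ts x0)"
    by (intro tendsto_divide) auto
  then show "\<exists>l. ((\<lambda>(t, x). f t x / g t x) \<longlongrightarrow> l) (edge Ts x0)"
    by (auto simp: case_prod_unfold)
qed

lemma edge_limits_pos_imp: "edge_limits_pos Ts f \<Longrightarrow> edge_limits Ts f"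
  unfolding edge_limits_def edge_limits_pos_def by blast

lemma edge_limits_pos_const: "0 < k \<Longrightarrow> edge_limits_pos Ts (\<lambda>t x. k)"
  by (auto simp: edge_limits_pos_def case_prod_unfold intro: exI[of _ k])

lemma edge_limits_pos_mult:
  "edge_limits_pos Ts f \<Longrightarrow> edge_limits_pos Ts g \<Longrightarrow> edge_limits_pos Ts (\<lambda>t x. f t x * g t x)"
  unfolding edge_limits_pos_def
proof
  fix x0
  assume "\<forall>x0. \<exists>l>0. (case_prod f \<longlongrightarrow> l) (edge Ts x0)" "\<forall>x0. \<exists>l>0. (case_prod g \<longlongrightarrow> l) (edge Ts x0)"
  then obtain l k where "(case_prod f \<longlongrightarrow> l) (edge Ts x0)" "(case_prod g \<longlongrightarrow> k) (edge Ts x0)" "0 < l" "0 < k"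
    by meson
  then have "((\<lambda>p. case_prod f p * case_prod g p) \<longlongrightarrow> l * k) (edge Ts x0)" "0 < l * k"
    by (simp_all add: tendsto_mult)
  then show "\<exists>l>0. ((\<lambda>(t, x). f t x * g t x) \<longlongrightarrow> l) (edge Ts x0)"
    by (auto simp: case_prod_unfold)
qed

lemma edge_limits_pos_powr: "edge_limits_pos Ts f \<Longrightarrow> edge_limits_pos Ts (\<lambda>t x. f t x powr r)"
  unfolding edge_limits_pos_def
proof
  fix x0
  assume "\<forall>x0. \<exists>l>0. (case_prod f \<longlongrightarrow> l) (edge Ts x0)"
  then obtain l where "(case_prod f \<longlongrightarrow> l) (edge Ts x0)" "0 < l"
    by blast
  moreover from this have "((\<lambda>p. case_prod f p powr r) \<longlongrightarrow> l powr r) (edge Ts x0)"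
    by (simp add: tendsto_powr)
  ultimately show "\<exists>l>0. ((\<lambda>(t, x). f t x powr r) \<longlongrightarrow> l) (edge Ts x0)"
    by (intro exI[of _ "l powr r"]) (simp add: case_prod_unfold)
qed

lemma edge_limits_stationary:
  assumes "continuous_on UNIV g"
  shows "((\<lambda>(t, x). g x) \<longlongrightarrow> (g x0 :: real)) (edge Ts x0)"
proof -
  have "isCont g x0" using assms by (simp add: continuous_on_eq_continuous_at)
  moreover have "(snd \<longlongrightarrow> snd (Ts, x0)) (edge Ts x0)"
    unfolding edge_def by (intro tendsto_snd tendsto_ident_at)
  ultimately show ?thesis
    unfolding case_prod_unfold by (intro isCont_tendsto_compose[of x0 g]) simp_all
qed

lemma edge_bounded_of_limits: "edge_limits Ts f \<Longrightarrow> edge_bounded Ts f"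
proof -
  have "Bfun f F" if f: "(f \<longlongrightarrow> l) F" for f :: "real \<times> real \<Rightarrow> real" and l F
  proof (rule BfunI)
    show "\<forall>\<^sub>F x in F. norm (f x) \<le> \<bar>l\<bar> + 1"
      using tendstoD[OF f, of 1] by (auto simp: dist_real_def elim!: eventually_mono)
  qed
  then show "edge_limits Ts f \<Longrightarrow> edge_bounded Ts f"
    unfolding edge_limits_def edge_bounded_def by blast
qed

lemma edge_bounded_cong:
  assumes "0 < Ts" and "edge_bounded Ts f" and "\<And>t x. t \<in> {0..<Ts} \<Longrightarrow> g t x = f t x"
  shows "edge_bounded Ts g"
  unfolding edge_bounded_def
proof
  fix x0
  obtain B where "B > 0" "eventually (\<lambda>p. norm (case_prod f p) \<le> B) (edge Ts x0)"
    using assms(2) unfolding edge_bounded_def by (blast elim: BfunE)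
  from eventually_conj[OF this(2) eventually_edge_time[OF assms(1)]]
  have "eventually (\<lambda>p. norm (case_prod g p) \<le> B) (edge Ts x0)"
    by eventually_elim (use assms(3) in \<open>auto simp: case_prod_unfold\<close>)
  then show "Bfun (case_prod g) (edge Ts x0)" by (rule BfunI)
qed

lemma edge_bounded_add:
  assumes "edge_bounded Ts f" "edge_bounded Ts g"
  shows "edge_bounded Ts (\<lambda>t x. f t x + g t x)"
  unfolding edge_bounded_def
proof
  fix x0
  obtain A where "eventually (\<lambda>p. norm (case_prod f p) \<le> A) (edge Ts x0)"
    using assms(1) unfolding edge_bounded_def by (blast elim: BfunE)
  moreover obtain B where "eventually (\<lambda>p. norm (case_prod g p) \<le> B) (edge Ts x0)"
    using assms(2) unfolding edge_bounded_def by (blast elim: BfunE)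
  ultimately have "eventually (\<lambda>p. norm (case p of (t, x) \<Rightarrow> f t x + g t x) \<le> A + B) (edge Ts x0)"
    by eventually_elim (auto simp: case_prod_unfold)
  then show "Bfun (\<lambda>(t, x). f t x + g t x) (edge Ts x0)" by (rule BfunI)
qed

lemma edge_bounded_mult:
  assumes "edge_bounded Ts f" "edge_bounded Ts g"
  shows "edge_bounded Ts (\<lambda>t x. f t x * g t x)"
  unfolding edge_bounded_def
proof
  fix x0
  obtain A where "eventually (\<lambda>p. norm (case_prod f p) \<le> A) (edge Ts x0)"
    using assms(1) unfolding edge_bounded_def by (blast elim: BfunE)
  moreover obtain B where "eventually (\<lambda>p. norm (case_prod g p) \<le> B) (edge Ts x0)"
    using assms(2) unfolding edge_bounded_def by (blast elim: BfunE)
  ultimately have "eventually (\<lambda>p. norm (case p of (t, x) \<Rightarrow> f t x * g t x) \<le> \<bar>A\<bar> * \<bar>B\<bar>) (edge Ts x0)"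
    by eventually_elim (auto simp: case_prod_unfold abs_mult intro!: mult_mono)
  then show "Bfun (\<lambda>(t, x). f t x * g t x) (edge Ts x0)" by (rule BfunI)
qed

lemma edge_bounded_diff:
  "edge_bounded Ts f \<Longrightarrow> edge_bounded Ts g \<Longrightarrow> edge_bounded Ts (\<lambda>t x. f t x - g t x)"
  using edge_bounded_add[OF _ edge_bounded_mult[OF edge_bounded_of_limits[OF edge_limits_const]], of Ts f g "- 1"]
  by simp

lemma edge_boundedD:
  assumes "edge_bounded Ts f"
  obtains \<delta> B where "0 < \<delta>" "0 \<le> B"
    "\<And>t x. 0 \<le> t \<Longrightarrow> Ts - \<delta> < t \<Longrightarrow> t < Ts \<Longrightarrow> \<bar>x - x0\<bar> < \<delta> \<Longrightarrow> \<bar>f t x\<bar> \<le> B"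
  using assms Bfun_edgeD unfolding edge_bounded_def by blast

lemma not_blows_up_imp_edge_bounded: "\<not> blows_up_at Ts f \<Longrightarrow> edge_bounded Ts f"
  unfolding blows_up_at_def edge_bounded_def using Bfun_edgeI by (metis not_less)

text \<open>For speed \<open>0\<close> the characteristics are the lines \<open>x = const\<close>.\<close>

lemma edge_limits_of_bounded_time_derivative:
  assumes Ts: "0 < Ts" and f: "C1_partials {0..<Ts} f ft fx" and ft: "edge_bounded Ts ft"
  shows "edge_limits Ts f"
  unfolding edge_limits_def
proof
  fix x0
  interpret speed_field Ts 0 "\<lambda>t x. 0" "\<lambda>t x. 0"
    by unfold_locales (use Ts in auto)
  obtain \<delta> B where \<delta>: "0 < \<delta>" "0 \<le> B"
    "\<And>t x. 0 \<le> t \<Longrightarrow> Ts - \<delta> < t \<Longrightarrow> t < Ts \<Longrightarrow> \<bar>x - x0\<bar> < \<delta> \<Longrightarrow> \<bar>ft t x\<bar> \<le> B"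
    using edge_boundedD[OF ft] by blast
  show "\<exists>l. (case_prod f \<longlongrightarrow> l) (edge Ts x0)"
  proof (rule limit_along_characteristics[OF _ C1_partialsD(3)[OF f] \<delta>(1)])
    show "Bfun (\<lambda>(t, x). 0 :: real) (edge Ts x0)" by (simp add: case_prod_unfold)
    fix a b :: real and X
    assume ab: "0 \<le> a" "Ts - \<delta> < a" "a \<le> b" "b < Ts" and X: "characteristic (\<lambda>t x. 0) a b X"
      and near: "\<And>r. r \<in> {a..b} \<Longrightarrow> \<bar>X r - x0\<bar> < \<delta>"
    have "X b = X a"
      using characteristic_near[OF X ab(1,4), of b a] ab(3) by simp
    have "((\<lambda>s. f s (X a)) has_real_derivative ft t (X a)) (at t within {a..b})" if "t \<in> {a..b}" for t
      by (rule DERIV_subset[OF C1_partialsD(1)[OF f]]) (use ab that in auto)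
    from mvt_within[OF ab(3) this]
    obtain \<xi> where \<xi>: "\<xi> \<in> {a..b}" "f b (X a) - f a (X a) = (b - a) * ft \<xi> (X a)" by blast
    have "\<bar>ft \<xi> (X a)\<bar> \<le> B"
      using \<delta>(3)[of \<xi> "X a"] \<xi>(1) ab near[of a] by auto
    then show "\<bar>f b (X b) - f a (X a)\<bar> \<le> B * (b - a)"
      unfolding \<open>X b = X a\<close> \<xi>(2) abs_mult mult.commute[of B] using ab(3) by (simp add: mult_left_mono)
  qed
qed

lemma zero_at_end:
  fixes g :: "real \<Rightarrow> real"
  assumes "0 < Ts" "continuous_on {0..Ts} g" "\<And>t. t \<in> {0..<Ts} \<Longrightarrow> g t = 0" "t \<in> {0..Ts}"
  shows "g t = 0"
proof (cases "t = Ts")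
  case True
  have "(g \<longlongrightarrow> g Ts) (at Ts within {0..Ts})"
    using assms(1,2) by (auto simp: continuous_on_def)
  moreover have "(g \<longlongrightarrow> 0) (at Ts within {0..Ts})"
    by (rule tendsto_eventually) (auto simp: eventually_at assms(3) intro!: exI[of _ 1])
  moreover have "at Ts within {0..Ts} \<noteq> bot"
    using assms(1) by (simp add: trivial_limit_within)
  ultimately show ?thesis
    using True tendsto_unique by blast
qed (use assms in auto)

lemma (in gas_flow) sound_speed_eq: "t \<in> J \<Longrightarrow> sound_speed K cv \<gamma> \<tau> S t x = c t x"
proof -
  assume t: "t \<in> J"
  have "(c t x)\<^sup>2 * \<tau> t x = (K * \<gamma> * exp (S t x / cv) * \<tau> t x powr (- \<gamma> - 1)) * \<tau> t x"
    unfolding pressure_sound_speed[OF t, symmetric] pressure_def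
    using \<tau>_pos[OF t, of x] by (simp add: powr_diff)
  then have "(c t x)\<^sup>2 = K * \<gamma> * exp (S t x / cv) * \<tau> t x powr (- \<gamma> - 1)"
    using \<tau>_pos[OF t, of x] by simp
  then show ?thesis
    unfolding sound_speed_def using c_pos[OF t, of x] by (intro real_sqrt_unique) auto
qed

text \<open>The flows for which neither \<open>u\<^sub>x\<close> nor \<open>\<tau>\<^sub>x\<close> blows up at \<open>Ts\<close>. They are shown to extend smoothly to
  the time \<open>Ts\<close> (\<open>smooth_continuation\<close>).\<close>

locale bounded_gradient_flow = gas_flow K cv \<gamma> "{0..<Ts}" u \<tau> S
  for K cv \<gamma> Ts :: real and u \<tau> S :: "real \<Rightarrow> real \<Rightarrow> real" +
  fixes C :: real
  assumes Ts: "0 < Ts" and c_le: "\<And>t x. t \<in> {0..<Ts} \<Longrightarrow> c t x \<le> C"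
    and V_bounded: "edge_bounded Ts V" and \<tau>x_bounded: "edge_bounded Ts \<tau>x"
begin

lemma continuous_slice:
  assumes "continuous_on ({0..<Ts} \<times> UNIV) (\<lambda>(t, x). f t x)"
  shows "continuous_on UNIV (f 0)"
proof -
  have "continuous_on UNIV (\<lambda>x. case (0, x) of (t, x) \<Rightarrow> f t x)"
    by (rule continuous_on_compose2[OF assms]) (use Ts in \<open>auto intro!: continuous_intros\<close>)
  then show ?thesis by simp
qed

lemma slice_S: "t \<in> {0..<Ts} \<Longrightarrow> S t = S 0"
  by (rule ext) (rule S_stationary)

lemma stationary: "t \<in> {0..<Ts} \<Longrightarrow> mvar cv S t x = mvar cv S 0 x"
  "t \<in> {0..<Ts} \<Longrightarrow> \<mu> t x = \<mu> 0 x" "t \<in> {0..<Ts} \<Longrightarrow> \<mu>x t x = \<mu>x 0 x"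
proof -
  assume t: "t \<in> {0..<Ts}"
  note S = slice_S[OF t]
  have Sx: "Dx S t = Dx S 0" by (rule ext) (simp only: Dx_def S)
  show "mvar cv S t x = mvar cv S 0 x" "\<mu> t x = \<mu> 0 x" "\<mu>x t x = \<mu>x 0 x"
    by (simp_all only: mvar_def \<mu>_def \<mu>x_def Dx_def[of "Dx S"] S Sx)
qed

lemma m_limit: "edge_limits_pos Ts (mvar cv S)"
  unfolding edge_limits_pos_def
proof
  fix x0
  have "((\<lambda>(t, x). mvar cv S 0 x) \<longlongrightarrow> mvar cv S 0 x0) (edge Ts x0)"
    by (rule edge_limits_stationary[OF continuous_slice[OF C1_partialsD(3)[OF m_partials]]])
  moreover have "eventually (\<lambda>p. case_prod (mvar cv S) p = (case p of (t, x) \<Rightarrow> mvar cv S 0 x)) (edge Ts x0)"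
    using eventually_edge_time[OF Ts]
    by eventually_elim (simp only: case_prod_unfold stationary(1))
  ultimately have "(case_prod (mvar cv S) \<longlongrightarrow> mvar cv S 0 x0) (edge Ts x0)"
    by (simp add: filterlim_cong)
  then show "\<exists>l>0. (case_prod (mvar cv S) \<longlongrightarrow> l) (edge Ts x0)"
    using m_pos by blast
qed

lemma \<mu>_limit: "edge_limits Ts \<mu>"
  by (rule edge_limits_cong[OF Ts _ stationary(2)])
    (use edge_limits_stationary[OF continuous_slice[OF C1_partialsD(3)[OF \<mu>_partials]]]
      in \<open>auto simp: edge_limits_def\<close>)

lemma \<mu>x_limit: "edge_limits Ts \<mu>x"
  by (rule edge_limits_cong[OF Ts _ stationary(3)])
    (use edge_limits_stationary[OF continuous_slice[OF C1_partialsD(5)[OF \<mu>_partials]]]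
      in \<open>auto simp: edge_limits_def\<close>)

text \<open>The bound on the sound speed keeps the gas from being compressed to \<open>\<tau> = 0\<close>.\<close>

lemma \<tau>_limit: "edge_limits_pos Ts \<tau>"
  unfolding edge_limits_pos_def
proof
  fix x0
  obtain l where l: "(case_prod \<tau> \<longlongrightarrow> l) (edge Ts x0)"
    using edge_limits_of_bounded_time_derivative[OF Ts \<tau>_partials V_bounded] by (auto simp: edge_limits_def)
  obtain k where k: "0 < k" "(case_prod (mvar cv S) \<longlongrightarrow> k) (edge Ts x0)"
    using m_limit by (auto simp: edge_limits_pos_def)
  have l0: "0 \<le> l"
    by (rule tendsto_lowerbound[OF l _ edge_neq_bot[OF Ts]], rule eventually_mono[OF eventually_edge_time[OF Ts]])
      (auto simp: case_prod_unfold less_imp_le[OF \<tau>_pos])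
  have ev: "eventually (\<lambda>p. sqrt (K * \<gamma>) * case_prod (mvar cv S) p \<le> C * case_prod \<tau> p powr ((\<gamma> + 1) / 2)) (edge Ts x0)"
    using eventually_edge_time[OF Ts]
  proof eventually_elim
    case (elim p)
    define t x where "t = fst p" and "x = snd p"
    have "0 < \<tau> t x" using \<tau>_pos elim by (simp add: t_def)
    then have "sqrt (K * \<gamma>) * mvar cv S t x = c t x * \<tau> t x powr ((\<gamma> + 1) / 2)"
      by (simp add: c_def powr_minus field_simps)
    then show ?case
      using mult_right_mono[OF c_le[of t x], of "\<tau> t x powr ((\<gamma> + 1) / 2)"] elim
      by (simp add: case_prod_unfold t_def x_def)
  qed
  have "((\<lambda>p. case_prod \<tau> p powr ((\<gamma> + 1) / 2)) \<longlongrightarrow> l powr ((\<gamma> + 1) / 2)) (edge Ts x0)"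
    using \<gamma> l0 eventually_edge_time[OF Ts, of x0]
    by (intro tendsto_powr'[OF l tendsto_const])
      (auto elim!: eventually_mono simp: case_prod_unfold less_imp_le[OF \<tau>_pos])
  then have "sqrt (K * \<gamma>) * k \<le> C * l powr ((\<gamma> + 1) / 2)"
    by (intro tendsto_le[OF edge_neq_bot[OF Ts] _ _ ev] tendsto_mult tendsto_const k(2))
  moreover have "0 < sqrt (K * \<gamma>) * k" using K \<gamma> k(1) by simp
  ultimately have "l \<noteq> 0" by auto
  then show "\<exists>l>0. (case_prod \<tau> \<longlongrightarrow> l) (edge Ts x0)"
    using l l0 by (intro exI[of _ l]) auto
qed

lemma c_limit: "edge_limits_pos Ts c"
  unfolding c_def[abs_def] using K \<gamma>
  by (intro edge_limits_pos_mult edge_limits_pos_const m_limit edge_limits_pos_powr \<tau>_limit) auto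

lemmas limits = edge_limits_const edge_limits_add edge_limits_diff edge_limits_mult edge_limits_divide
  edge_limits_pos_const edge_limits_pos_mult edge_limits_pos_imp[OF c_limit] edge_limits_pos_imp[OF \<tau>_limit] c_limit \<tau>_limit \<mu>_limit \<mu>x_limit

lemma cx_bounded: "edge_bounded Ts cx"
proof (rule edge_bounded_cong[OF Ts])
  show "edge_bounded Ts (\<lambda>t x. c t x * \<mu> t x - (c t x * ((\<gamma> + 1) / 2) / \<tau> t x) * \<tau>x t x)"
    by (intro edge_bounded_diff edge_bounded_mult[OF _ \<tau>x_bounded]; intro edge_bounded_of_limits limits)
qed (simp add: cx_def algebra_simps)

lemma U_bounded: "edge_bounded Ts U"
proof (rule edge_bounded_cong[OF Ts])
  show "edge_bounded Ts (\<lambda>t x. (c t x * c t x) * \<tau>x t x - 2 / \<gamma> * ((c t x * c t x) * (\<tau> t x * \<mu> t x)))"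
    by (intro edge_bounded_diff edge_bounded_mult[OF _ \<tau>x_bounded];
        intro edge_bounded_of_limits limits)
qed (simp add: momentum power2_eq_square)

lemma u_limit: "edge_limits Ts u"
  by (rule edge_limits_of_bounded_time_derivative[OF Ts u_partials U_bounded])

sublocale sound_field Ts C c ct cx
  by unfold_locales (use Ts c_partials c_pos c_le cx_bounded in \<open>auto simp: edge_bounded_def\<close>)

lemma \<alpha>_bounded: "edge_bounded Ts (\<alpha> \<sigma>)"
proof (rule edge_bounded_cong[OF Ts])
  show "edge_bounded Ts (\<lambda>t x. V t x - U t x * (\<sigma> / c t x))"
    by (intro edge_bounded_diff edge_bounded_mult V_bounded U_bounded;
        intro edge_bounded_of_limits limits)
qed (simp add: \<alpha>_def)

text \<open>The rate of change \<open>G\<close> of \<open>\<alpha> \<sigma>\<close> along a wave contains first derivatives only and is therefore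
  bounded near the final line.\<close>

lemma \<alpha>_limit:
  assumes \<sigma>: "\<sigma> \<in> {1, - 1}"
  shows "edge_limits Ts (\<alpha> \<sigma>)"
  unfolding edge_limits_def
proof
  fix x0
  have "edge_bounded Ts (\<lambda>t x. (\<sigma> / (2 * \<gamma>) * c t x * \<mu> t x) * (\<alpha> \<sigma> t x + \<alpha> \<sigma> t x + \<alpha> \<sigma> t x + \<alpha> (- \<sigma>) t x)
     + (((\<gamma> + 1) / 4 / \<tau> t x) * \<alpha> \<sigma> t x) * (\<alpha> (- \<sigma>) t x - \<alpha> \<sigma> t x))"
    by (intro edge_bounded_add edge_bounded_mult[OF _ edge_bounded_add] edge_bounded_mult[OF _ edge_bounded_diff]
        edge_bounded_mult[OF _ \<alpha>_bounded] \<alpha>_bounded; intro edge_bounded_of_limits limits)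
  then have "edge_bounded Ts (G \<sigma>)"
    by (rule edge_bounded_cong[OF Ts]) (simp add: G_def)
  then obtain \<delta> B where \<delta>: "0 < \<delta>" "0 \<le> B"
    "\<And>t x. 0 \<le> t \<Longrightarrow> Ts - \<delta> < t \<Longrightarrow> t < Ts \<Longrightarrow> \<bar>x - x0\<bar> < \<delta> \<Longrightarrow> \<bar>G \<sigma> t x\<bar> \<le> B"
    using edge_boundedD by blast
  show "\<exists>l. (case_prod (\<alpha> \<sigma>) \<longlongrightarrow> l) (edge Ts x0)"
  proof (rule limit_along_sound_waves[OF \<sigma> C1_partialsD(3)[OF \<alpha>_partials] \<delta>(1)])
    fix a b :: real and X
    assume ab: "0 \<le> a" "Ts - \<delta> < a" "a \<le> b" "b < Ts"
      and X: "characteristic (\<lambda>t x. \<sigma> * c t x) a b X" and near: "\<And>r. r \<in> {a..b} \<Longrightarrow> \<bar>X r - x0\<bar> < \<delta>"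
    have sub: "{a..b} \<subseteq> {0..<Ts}" using ab by auto
    have "((\<lambda>r. \<alpha> \<sigma> r (X r)) has_real_derivative G \<sigma> t (X t)) (at t within {a..b})" if t: "t \<in> {a..b}" for t
      using C1_partials_along[OF \<alpha>_partials[of \<sigma>] sub t characteristicD[OF X t]]
      by (simp add: riemann_transport[OF subsetD[OF sub t] \<sigma>])
    from mvt_within[OF ab(3) this]
    obtain \<xi> where \<xi>: "\<xi> \<in> {a..b}" "\<alpha> \<sigma> b (X b) - \<alpha> \<sigma> a (X a) = (b - a) * G \<sigma> \<xi> (X \<xi>)" by blast
    have "\<bar>G \<sigma> \<xi> (X \<xi>)\<bar> \<le> B"
      using \<delta>(3)[of \<xi> "X \<xi>"] \<xi>(1) ab near[of \<xi>] by auto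
    then show "\<bar>\<alpha> \<sigma> b (X b) - \<alpha> \<sigma> a (X a)\<bar> \<le> B * (b - a)"
      unfolding \<xi>(2) abs_mult mult.commute[of B] using ab(3) by (simp add: mult_left_mono)
  qed
qed

lemma \<alpha>_limits: "edge_limits Ts (\<alpha> 1)" "edge_limits Ts (\<alpha> (- 1))"
  by (rule \<alpha>_limit, simp)+

text \<open>The first derivatives of the solution are algebraic expressions in \<open>\<alpha> 1\<close> and \<open>\<alpha> (- 1)\<close>.\<close>

lemma V_limit: "edge_limits Ts V"
proof (rule edge_limits_cong[OF Ts])
  show "edge_limits Ts (\<lambda>t x. 1 / 2 * (\<alpha> 1 t x + \<alpha> (- 1) t x))"
    by (intro limits \<alpha>_limits)
qed (simp add: \<alpha>_def)

lemma U_limit: "edge_limits Ts U"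
proof (rule edge_limits_cong[OF Ts])
  show "edge_limits Ts (\<lambda>t x. 1 / 2 * c t x * (\<alpha> (- 1) t x - \<alpha> 1 t x))"
    by (intro limits \<alpha>_limits)
  show "U t x = 1 / 2 * c t x * (\<alpha> (- 1) t x - \<alpha> 1 t x)" if "t \<in> {0..<Ts}" for t x
    using c_pos[OF that, of x] by (simp add: \<alpha>_def)
qed

lemma \<tau>x_limit: "edge_limits Ts \<tau>x"
proof (rule edge_limits_cong[OF Ts])
  show "edge_limits Ts (\<lambda>t x. U t x / (c t x * c t x) + 2 * \<tau> t x * \<mu> t x / \<gamma>)"
    using \<gamma> by (intro limits U_limit) auto
qed (simp add: \<tau>x_eq power2_eq_square)

lemma ct_limit: "edge_limits Ts ct"
  unfolding ct_def[abs_def] by (intro limits V_limit)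

lemma G_limit: "\<sigma> \<in> {1, - 1} \<Longrightarrow> edge_limits Ts (G \<sigma>)"
  unfolding G_def[abs_def] using \<gamma> by (intro limits \<alpha>_limit) auto

end

section \<open>Second derivatives and smooth continuation\<close>

context gas_flow
begin

text \<open>The time derivative of the rate \<open>G\<close>. Since \<open>\<mu>\<close> is stationary, it contains no derivative of the
  entropy beyond \<open>\<mu>\<close>.\<close>

definition "Gt \<sigma> t x =
  \<sigma> / (2 * \<gamma>) * ((ct t x * \<mu> t x) * (3 * \<alpha> \<sigma> t x + \<alpha> (- \<sigma>) t x)
      + (c t x * \<mu> t x) * (3 * \<alpha>t \<sigma> t x + \<alpha>t (- \<sigma>) t x))
  + (\<gamma> + 1) / 4 * ((\<alpha>t \<sigma> t x * (\<alpha> (- \<sigma>) t x - \<alpha> \<sigma> t x) + \<alpha> \<sigma> t x * (\<alpha>t (- \<sigma>) t x - \<alpha>t \<sigma> t x)) / \<tau> t x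
      - \<alpha> \<sigma> t x * (\<alpha> (- \<sigma>) t x - \<alpha> \<sigma> t x) * V t x / (\<tau> t x)\<^sup>2)"

lemma G_partials: "\<exists>Gx. C1_partials J (G \<sigma>) (Gt \<sigma>) Gx"
proof -
  have "\<exists>Gx. C1_partials J (\<lambda>t x. \<sigma> / (2 * \<gamma>) * ((c t x * \<mu> t x) * (3 * \<alpha> \<sigma> t x + \<alpha> (- \<sigma>) t x))
        + (\<gamma> + 1) / 4 * ((\<alpha> \<sigma> t x * (\<alpha> (- \<sigma>) t x - \<alpha> \<sigma> t x)) / \<tau> t x))
      (\<lambda>t x. \<sigma> / (2 * \<gamma>) * ((ct t x * \<mu> t x + c t x * 0) * (3 * \<alpha> \<sigma> t x + \<alpha> (- \<sigma>) t x)
          + (c t x * \<mu> t x) * (3 * \<alpha>t \<sigma> t x + \<alpha>t (- \<sigma>) t x))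
        + (\<gamma> + 1) / 4 * ((\<alpha>t \<sigma> t x * (\<alpha> (- \<sigma>) t x - \<alpha> \<sigma> t x) + \<alpha> \<sigma> t x * (\<alpha>t (- \<sigma>) t x - \<alpha>t \<sigma> t x)) / \<tau> t x
          - \<alpha> \<sigma> t x * (\<alpha> (- \<sigma>) t x - \<alpha> \<sigma> t x) * V t x / (\<tau> t x)\<^sup>2)) Gx"
    (is "\<exists>Gx. C1_partials J ?G ?Gt Gx")
    by (rule exI, (rule C1_partials_add C1_partials_cmult C1_partials_mult C1_partials_diff C1_partials_divide
        c_partials \<mu>_partials \<alpha>_partials \<tau>_partials \<tau>_pos | assumption)+)
  then obtain Gx where "C1_partials J ?G ?Gt Gx" by blast
  then have "C1_partials J (G \<sigma>) (Gt \<sigma>) Gx"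
    by (rule C1_partials_cong) (simp_all add: G_def Gt_def)
  then show ?thesis by blast
qed

text \<open>Along a wave \<open>\<alpha>\<^sub>t\<close> grows at a rate that is affine in \<open>\<alpha>\<^sub>t\<close> itself, with coefficients
  containing first derivatives only.\<close>

definition "H0 \<sigma> t x = \<sigma> / (2 * \<gamma>) * (ct t x * \<mu> t x * (3 * \<alpha> \<sigma> t x + \<alpha> (- \<sigma>) t x))
  - (\<gamma> + 1) / 4 * (\<alpha> \<sigma> t x * (\<alpha> (- \<sigma>) t x - \<alpha> \<sigma> t x) * V t x / (\<tau> t x * \<tau> t x)) - ct t x * G \<sigma> t x / c t x"
definition "H1 \<sigma> t x = 3 * (\<sigma> / (2 * \<gamma>)) * (c t x * \<mu> t x)
  + (\<gamma> + 1) / 4 * ((\<alpha> (- \<sigma>) t x - \<alpha> \<sigma> t x - \<alpha> \<sigma> t x) / \<tau> t x) + ct t x / c t x"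
definition "H2 \<sigma> t x = \<sigma> / (2 * \<gamma>) * (c t x * \<mu> t x) + (\<gamma> + 1) / 4 * (\<alpha> \<sigma> t x / \<tau> t x)"

lemma \<alpha>x_eq:
  assumes t: "t \<in> J" and \<sigma>: "\<sigma> \<in> {1, - 1}"
  shows "\<alpha>x \<sigma> t x = \<sigma> * (G \<sigma> t x - \<alpha>t \<sigma> t x) / c t x"
  using riemann_transport[OF t \<sigma>, of x] c_pos[OF t, of x] \<sigma> by (auto simp: field_simps)

lemma \<alpha>t_rate:
  assumes t: "t \<in> J" and \<sigma>: "\<sigma> \<in> {1, - 1}"
  shows "Gt \<sigma> t x - \<sigma> * ct t x * \<alpha>x \<sigma> t x = H0 \<sigma> t x + H1 \<sigma> t x * \<alpha>t \<sigma> t x + H2 \<sigma> t x * \<alpha>t (- \<sigma>) t x"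
proof -
  have "\<sigma> * ct t x * \<alpha>x \<sigma> t x = (\<sigma> * \<sigma>) * (ct t x * G \<sigma> t x / c t x - ct t x / c t x * \<alpha>t \<sigma> t x)"
    unfolding \<alpha>x_eq[OF t \<sigma>] by (simp add: algebra_simps diff_divide_distrib)
  also have "\<sigma> * \<sigma> = 1" using \<sigma> by auto
  finally have 1: "\<sigma> * ct t x * \<alpha>x \<sigma> t x = ct t x * G \<sigma> t x / c t x - ct t x / c t x * \<alpha>t \<sigma> t x" by simp
  define s where "s = \<sigma> / (2 * \<gamma>)"
  define r where "r = 1 / \<tau> t x"
  have div: "y / \<tau> t x = y * r" "y / (\<tau> t x)\<^sup>2 = y * (r * r)" "y / (\<tau> t x * \<tau> t x) = y * (r * r)" for y
    by (simp_all add: r_def power2_eq_square)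
  show ?thesis
    unfolding 1 Gt_def H0_def H1_def H2_def s_def[symmetric] div
    by (simp add: algebra_simps add_divide_distrib)
qed

end

context bounded_gradient_flow
begin

lemma H_limits:
  assumes "\<sigma> \<in> {1, - 1}"
  shows "edge_limits Ts (H0 \<sigma>)" "edge_limits Ts (H1 \<sigma>)" "edge_limits Ts (H2 \<sigma>)"
proof -
  have "- \<sigma> \<in> {1, - 1}" using assms by auto
  note lims = limits V_limit ct_limit G_limit[OF assms] \<alpha>_limit[OF assms] \<alpha>_limit[OF this]
  show "edge_limits Ts (H0 \<sigma>)" "edge_limits Ts (H1 \<sigma>)" "edge_limits Ts (H2 \<sigma>)"
    unfolding H0_def[abs_def] H1_def[abs_def] H2_def[abs_def]
    by (intro lims)+
qed

lemma \<alpha>t_along_wave: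
  assumes \<sigma>: "\<sigma> \<in> {1, - 1}" and ab: "0 \<le> a" "a \<le> b" "b < Ts"
    and X: "characteristic (\<lambda>t x. \<sigma> * c t x) a b X"
  obtains r where "r \<in> {a..b}" "\<alpha>t \<sigma> b (X b) - \<alpha>t \<sigma> a (X a) =
    (b - a) * (H0 \<sigma> r (X r) + H1 \<sigma> r (X r) * \<alpha>t \<sigma> r (X r) + H2 \<sigma> r (X r) * \<alpha>t (- \<sigma>) r (X r))"
proof -
  obtain Gx where G: "C1_partials {0..<Ts} (G \<sigma>) (Gt \<sigma>) Gx" using G_partials by blast
  note s = C1_partials_cmult[OF c_partials, of \<sigma>]
  have "b + (Ts - b) / 2 < Ts" using ab by (simp add: field_simps)
  then have sub: "{a..b + (Ts - b) / 2} \<subseteq> {0..<Ts}" and pos: "0 < (Ts - b) / 2" using ab by auto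
  from time_derivative_along_characteristic[OF \<alpha>_partials C1_partialsD(1)[OF s] C1_partialsD(4)[OF s]
      C1_partialsD(1)[OF G] C1_partialsD(4)[OF G] riemann_transport[OF _ \<sigma>] ab(2) pos sub X]
  obtain r where r: "r \<in> {a..b}"
    "\<alpha>t \<sigma> b (X b) - \<alpha>t \<sigma> a (X a) = (b - a) * (Gt \<sigma> r (X r) - \<sigma> * ct r (X r) * \<alpha>x \<sigma> r (X r))"
    by blast
  have "r \<in> {0..<Ts}" using r(1) ab by auto
  from r(2)[unfolded \<alpha>t_rate[OF this \<sigma>]] show thesis using that[OF r(1)] by blast
qed

text \<open>The coefficients of the affine rate have limits by the results on first derivatives, so they
  are bounded near \<open>(Ts, x0)\<close>, and \<open>bounded_along_sound_waves\<close> applies to the pair \<open>\<alpha>\<^sub>t 1\<close>,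
  \<open>\<alpha>\<^sub>t (- 1)\<close>.\<close>

lemma \<alpha>t_bounded: "\<sigma> \<in> {1, - 1} \<Longrightarrow> edge_bounded Ts (\<alpha>t \<sigma>)"
  unfolding edge_bounded_def
proof
  fix x0
  assume \<sigma>: "\<sigma> \<in> {1, - 1}"
  have ex: "\<exists>\<delta> B. 0 < \<delta> \<and> 0 \<le> B \<and> (\<forall>t x. 0 \<le> t \<and> Ts - \<delta> < t \<and> t < Ts \<and> \<bar>x - x0\<bar> < \<delta> \<longrightarrow>
      \<bar>H0 \<sigma> t x\<bar> \<le> B \<and> \<bar>H1 \<sigma> t x\<bar> \<le> B \<and> \<bar>H2 \<sigma> t x\<bar> \<le> B)" if \<sigma>: "\<sigma> \<in> {1, - 1}" for \<sigma>
  proof -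
    note b = H_limits[OF \<sigma>, THEN edge_bounded_of_limits]
    obtain d0 B0 where 0: "0 < d0" "0 \<le> B0"
      "\<And>t x. 0 \<le> t \<Longrightarrow> Ts - d0 < t \<Longrightarrow> t < Ts \<Longrightarrow> \<bar>x - x0\<bar> < d0 \<Longrightarrow> \<bar>H0 \<sigma> t x\<bar> \<le> B0"
      using edge_boundedD[OF b(1)] by blast
    obtain d1 B1 where 1: "0 < d1" "0 \<le> B1"
      "\<And>t x. 0 \<le> t \<Longrightarrow> Ts - d1 < t \<Longrightarrow> t < Ts \<Longrightarrow> \<bar>x - x0\<bar> < d1 \<Longrightarrow> \<bar>H1 \<sigma> t x\<bar> \<le> B1"
      using edge_boundedD[OF b(2)] by blast
    obtain d2 B2 where 2: "0 < d2" "0 \<le> B2"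
      "\<And>t x. 0 \<le> t \<Longrightarrow> Ts - d2 < t \<Longrightarrow> t < Ts \<Longrightarrow> \<bar>x - x0\<bar> < d2 \<Longrightarrow> \<bar>H2 \<sigma> t x\<bar> \<le> B2"
      using edge_boundedD[OF b(3)] by blast
    show ?thesis
    proof (rule exI[of _ "min d0 (min d1 d2)"], rule exI[of _ "B0 + B1 + B2"], intro conjI allI impI)
      fix t x assume "0 \<le> t \<and> Ts - min d0 (min d1 d2) < t \<and> t < Ts \<and> \<bar>x - x0\<bar> < min d0 (min d1 d2)"
      then have "\<bar>H0 \<sigma> t x\<bar> \<le> B0" "\<bar>H1 \<sigma> t x\<bar> \<le> B1" "\<bar>H2 \<sigma> t x\<bar> \<le> B2"
        by (auto intro!: 0(3) 1(3) 2(3))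
      then show "\<bar>H0 \<sigma> t x\<bar> \<le> B0 + B1 + B2" "\<bar>H1 \<sigma> t x\<bar> \<le> B0 + B1 + B2" "\<bar>H2 \<sigma> t x\<bar> \<le> B0 + B1 + B2"
        using 0(2) 1(2) 2(2) by linarith+
    qed (use 0 1 2 in auto)
  qed
  obtain d B d' B' where d: "0 < d" "0 \<le> B" "0 < d'" "0 \<le> B'"
    "\<And>t x. 0 \<le> t \<and> Ts - d < t \<and> t < Ts \<and> \<bar>x - x0\<bar> < d \<Longrightarrow> \<bar>H0 1 t x\<bar> \<le> B \<and> \<bar>H1 1 t x\<bar> \<le> B \<and> \<bar>H2 1 t x\<bar> \<le> B"
    "\<And>t x. 0 \<le> t \<and> Ts - d' < t \<and> t < Ts \<and> \<bar>x - x0\<bar> < d' \<Longrightarrow>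
       \<bar>H0 (- 1) t x\<bar> \<le> B' \<and> \<bar>H1 (- 1) t x\<bar> \<le> B' \<and> \<bar>H2 (- 1) t x\<bar> \<le> B'"
    using ex[of 1] ex[of "- 1"] by auto
  define L where "L = max B B'"
  have bounds: "\<bar>H0 \<sigma> t x\<bar> \<le> L \<and> \<bar>H1 \<sigma> t x\<bar> \<le> L \<and> \<bar>H2 \<sigma> t x\<bar> \<le> L"
    if "\<sigma> \<in> {1, - 1}" "0 \<le> t" "Ts - min d d' < t" "t < Ts" "\<bar>x - x0\<bar> < min d d'" for \<sigma> t x
  proof -
    have "Ts - d < t" "Ts - d' < t"
      using that(3) min.cobounded1[of d d'] min.cobounded2[of d d'] by linarith+
    then show ?thesis
      using d(5)[of t x] d(6)[of t x] that by (auto simp: L_def le_max_iff_disj)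
  qed
  show "Bfun (case_prod (\<alpha>t \<sigma>)) (edge Ts x0)"
  proof (rule bounded_along_sound_waves[OF C1_partialsD(4)[OF \<alpha>_partials] _ _ \<sigma>, where \<delta> = "min d d'" and L = L])
    show "0 < min d d'" using d by simp
    fix \<sigma> a b :: real and X
    assume \<sigma>: "\<sigma> \<in> {1, - 1}" and ab: "0 \<le> a" "Ts - min d d' < a" "a \<le> b" "b < Ts"
      and X: "characteristic (\<lambda>t x. \<sigma> * c t x) a b X" and near: "\<And>r. r \<in> {a..b} \<Longrightarrow> \<bar>X r - x0\<bar> < min d d'"
    obtain r where r: "r \<in> {a..b}" "\<alpha>t \<sigma> b (X b) - \<alpha>t \<sigma> a (X a) =
      (b - a) * (H0 \<sigma> r (X r) + H1 \<sigma> r (X r) * \<alpha>t \<sigma> r (X r) + H2 \<sigma> r (X r) * \<alpha>t (- \<sigma>) r (X r))"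
      using \<alpha>t_along_wave[OF \<sigma> ab(1,3,4) X] .
    have H: "\<bar>H0 \<sigma> r (X r)\<bar> \<le> L" "\<bar>H1 \<sigma> r (X r)\<bar> \<le> L" "\<bar>H2 \<sigma> r (X r)\<bar> \<le> L"
      using bounds[OF \<sigma> _ _ _ near[OF r(1)]] r(1) ab by auto
    have "\<bar>H0 \<sigma> r (X r) + H1 \<sigma> r (X r) * \<alpha>t \<sigma> r (X r) + H2 \<sigma> r (X r) * \<alpha>t (- \<sigma>) r (X r)\<bar>
        \<le> \<bar>H0 \<sigma> r (X r)\<bar> + \<bar>H1 \<sigma> r (X r) * \<alpha>t \<sigma> r (X r)\<bar> + \<bar>H2 \<sigma> r (X r) * \<alpha>t (- \<sigma>) r (X r)\<bar>"
      by (rule order_trans[OF abs_triangle_ineq add_right_mono[OF abs_triangle_ineq]])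
    also have "\<dots> \<le> L + L * \<bar>\<alpha>t \<sigma> r (X r)\<bar> + L * \<bar>\<alpha>t (- \<sigma>) r (X r)\<bar>"
      unfolding abs_mult by (intro add_mono mult_right_mono H) auto
    also have "\<dots> = L * (1 + \<bar>\<alpha>t 1 r (X r)\<bar> + \<bar>\<alpha>t (- 1) r (X r)\<bar>)"
      using \<sigma> by (auto simp: algebra_simps)
    finally show "\<exists>r\<in>{a..b}. \<bar>\<alpha>t \<sigma> b (X b) - \<alpha>t \<sigma> a (X a)\<bar>
          \<le> (b - a) * (L * (1 + \<bar>\<alpha>t 1 r (X r)\<bar> + \<bar>\<alpha>t (- 1) r (X r)\<bar>))"
      using r ab(3) by (intro bexI[of _ r]) (auto simp: abs_mult intro!: mult_left_mono)
  qed
qed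

lemma \<alpha>t_limit:
  assumes \<sigma>: "\<sigma> \<in> {1, - 1}"
  shows "edge_limits Ts (\<alpha>t \<sigma>)"
  unfolding edge_limits_def
proof
  fix x0
  have "- \<sigma> \<in> {1, - 1}" using \<sigma> by auto
  then have "edge_bounded Ts (\<lambda>t x. H0 \<sigma> t x + H1 \<sigma> t x * \<alpha>t \<sigma> t x + H2 \<sigma> t x * \<alpha>t (- \<sigma>) t x)"
    by (intro edge_bounded_add edge_bounded_mult \<alpha>t_bounded \<sigma> edge_bounded_of_limits[OF H_limits(1)]
        edge_bounded_of_limits[OF H_limits(2)] edge_bounded_of_limits[OF H_limits(3)])
  then obtain \<delta> B where \<delta>: "0 < \<delta>" "0 \<le> B"
    "\<And>t x. 0 \<le> t \<Longrightarrow> Ts - \<delta> < t \<Longrightarrow> t < Ts \<Longrightarrow> \<bar>x - x0\<bar> < \<delta> \<Longrightarrow>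
       \<bar>H0 \<sigma> t x + H1 \<sigma> t x * \<alpha>t \<sigma> t x + H2 \<sigma> t x * \<alpha>t (- \<sigma>) t x\<bar> \<le> B"
    using edge_boundedD by blast
  show "\<exists>l. (case_prod (\<alpha>t \<sigma>) \<longlongrightarrow> l) (edge Ts x0)"
  proof (rule limit_along_sound_waves[OF \<sigma> C1_partialsD(4)[OF \<alpha>_partials] \<delta>(1)])
    fix a b :: real and X
    assume ab: "0 \<le> a" "Ts - \<delta> < a" "a \<le> b" "b < Ts"
      and X: "characteristic (\<lambda>t x. \<sigma> * c t x) a b X" and near: "\<And>r. r \<in> {a..b} \<Longrightarrow> \<bar>X r - x0\<bar> < \<delta>"
    obtain r where r: "r \<in> {a..b}" "\<alpha>t \<sigma> b (X b) - \<alpha>t \<sigma> a (X a) =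
      (b - a) * (H0 \<sigma> r (X r) + H1 \<sigma> r (X r) * \<alpha>t \<sigma> r (X r) + H2 \<sigma> r (X r) * \<alpha>t (- \<sigma>) r (X r))"
      using \<alpha>t_along_wave[OF \<sigma> ab(1,3,4) X] .
    have "\<bar>H0 \<sigma> r (X r) + H1 \<sigma> r (X r) * \<alpha>t \<sigma> r (X r) + H2 \<sigma> r (X r) * \<alpha>t (- \<sigma>) r (X r)\<bar> \<le> B"
      using r(1) ab near[OF r(1)] by (intro \<delta>(3)) auto
    then show "\<bar>\<alpha>t \<sigma> b (X b) - \<alpha>t \<sigma> a (X a)\<bar> \<le> B * (b - a)"
      unfolding r(2) abs_mult mult.commute[of B] using ab(3) by (simp add: mult_left_mono)
  qed
qed

text \<open>From here on second derivatives are expressed by \<open>\<alpha>\<^sub>t\<close>: first \<open>\<alpha>\<^sub>x\<close> by the transport equation, then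
  \<open>u\<^sub>t\<^sub>x\<close> and \<open>u\<^sub>x\<^sub>x\<close> as means over both families, \<open>u\<^sub>t\<^sub>t\<close> by the wave equation and \<open>\<tau>\<^sub>x\<^sub>x\<close> by the momentum
  equation.\<close>

lemma \<alpha>x_limit:
  assumes \<sigma>: "\<sigma> \<in> {1, - 1}"
  shows "edge_limits Ts (\<alpha>x \<sigma>)"
  by (rule edge_limits_cong[OF Ts _ \<alpha>x_eq[OF _ \<sigma>]], assumption?) (intro limits G_limit \<alpha>t_limit \<sigma>)

lemma Ux_limit: "edge_limits Ts (Dx U)"
proof (rule edge_limits_cong[OF Ts])
  show "edge_limits Ts (\<lambda>t x. 1 / 2 * (\<alpha>t 1 t x + \<alpha>t (- 1) t x))"
    by (intro limits \<alpha>t_limit) auto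
qed (simp add: \<alpha>t_def)

lemma Vx_limit: "edge_limits Ts (Dx V)"
proof (rule edge_limits_cong[OF Ts])
  show "edge_limits Ts (\<lambda>t x. 1 / 2 * (\<alpha>x 1 t x + \<alpha>x (- 1) t x))"
    by (intro limits \<alpha>x_limit) auto
qed (simp add: \<alpha>x_def)

lemma Ut_limit: "edge_limits Ts (Dt {0..<Ts} U)"
proof (rule edge_limits_cong[OF Ts])
  show "edge_limits Ts (\<lambda>t x. c t x * c t x * Dx V t x + 2 * c t x * ct t x * \<tau>x t x + 2 * (c t x * c t x) * V t x * \<mu> t x)"
    by (intro limits Vx_limit ct_limit \<tau>x_limit V_limit)
qed (simp add: Ut_eq power2_eq_square)

lemma cx_limit: "edge_limits Ts cx"
  unfolding cx_def[abs_def] by (intro limits \<tau>x_limit)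

lemma \<tau>xx_limit: "edge_limits Ts (Dx \<tau>x)"
proof (rule edge_limits_cong[OF Ts])
  let ?r = "\<lambda>t x. Dx U t x / (c t x * c t x) - U t x * (cx t x * c t x + c t x * cx t x) / (c t x * c t x)\<^sup>2
    + 2 / \<gamma> * (\<tau>x t x * \<mu> t x + \<tau> t x * \<mu>x t x)"
  show "edge_limits Ts ?r"
    unfolding power2_eq_square by (intro limits Ux_limit U_limit cx_limit \<tau>x_limit)
  fix t x assume t: "t \<in> {0..<Ts}"
  have "\<exists>r. C1_partials {0..<Ts} (\<lambda>t x. U t x / (c t x * c t x) + 2 / \<gamma> * (\<tau> t x * \<mu> t x)) r ?r"
    by (rule exI, (rule C1_partials_add C1_partials_cmult C1_partials_mult C1_partials_divide
        c_partials \<mu>_partials U_partials \<tau>_partials mult_pos_pos c_pos | assumption)+)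
  then obtain r where r: "C1_partials {0..<Ts} (\<lambda>t x. U t x / (c t x * c t x) + 2 / \<gamma> * (\<tau> t x * \<mu> t x)) r ?r"
    by blast
  show "Dx \<tau>x t x = ?r t x"
    by (rule C1_partials_unique(2)[OF \<tau>x_partials r _ t J_nontrivial[OF t]])
      (simp add: \<tau>x_eq power2_eq_square)
qed

lemma extension_smooth: "C2_on {0..Ts} (extend_to Ts u)" "C2_on {0..Ts} (extend_to Ts \<tau>)"
  "C2_on {0..Ts} (\<lambda>t x. S 0 x)"
proof -
  have Vt: "edge_limits Ts (Dt {0..<Ts} V)"
    by (rule edge_limits_cong[OF Ts Ux_limit]) (rule C1_partials_Dt[OF V_partials _ J_nontrivial])
  show "C2_on {0..Ts} (extend_to Ts u)"
    by (rule C2_on_extend_to[OF Ts smooth(1) U_def[symmetric] V_def[symmetric]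
        u_limit U_limit V_limit Ut_limit Ux_limit Vt Vx_limit])
  have \<tau>t: "C1_partials {0..<Ts} (Dt {0..<Ts} \<tau>) (Dx U) (Dx V)"
    by (rule C1_partials_cong[OF V_partials]) (auto simp: euler)
  have "edge_limits Ts (Dt {0..<Ts} \<tau>)"
    by (rule edge_limits_cong[OF Ts V_limit]) (rule euler(1))
  moreover have "edge_limits Ts (Dt {0..<Ts} (Dt {0..<Ts} \<tau>))"
    by (rule edge_limits_cong[OF Ts Ux_limit]) (rule C1_partials_Dt[OF \<tau>t _ J_nontrivial])
  moreover have "edge_limits Ts (Dx (Dt {0..<Ts} \<tau>))"
    by (rule edge_limits_cong[OF Ts Vx_limit]) (rule C1_partials_Dx[OF \<tau>t])
  moreover have "edge_limits Ts (Dt {0..<Ts} \<tau>x)"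
    by (rule edge_limits_cong[OF Ts Vx_limit]) (rule C1_partials_Dt[OF \<tau>x_partials _ J_nontrivial])
  ultimately show "C2_on {0..Ts} (extend_to Ts \<tau>)"
    by (intro C2_on_extend_to[OF Ts smooth(2) refl \<tau>x_def[symmetric]]
        edge_limits_pos_imp[OF \<tau>_limit] \<tau>x_limit \<tau>xx_limit)
  have nt: "at t within {0..Ts} \<noteq> bot" if "t \<in> {0..Ts}" for t
    using that Ts by (simp add: trivial_limit_within)
  have Sx: "C1_partials {0..<Ts} (Dx S) (Dt {0..<Ts} (Dx S)) (Dx (Dx S))"
    using smooth(3) unfolding C2_on_def by (blast intro: C1_on_imp_C1_partials)
  have zero: "0 \<in> {0..<Ts}" using Ts by simp
  have 1: "C1_partials {0..Ts} (\<lambda>t x. S 0 x) (\<lambda>t x. 0) (\<lambda>t x. Dx S 0 x)"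
    by (rule C1_partials_stationary[OF C1_partialsD(2)[OF S_partials zero] continuous_slice[OF C1_partialsD(5)[OF S_partials]]])
  have 2: "C1_partials {0..Ts} (\<lambda>t x. Dx S 0 x) (\<lambda>t x. 0) (\<lambda>t x. Dx (Dx S) 0 x)"
    by (rule C1_partials_stationary[OF C1_partialsD(2)[OF Sx zero] continuous_slice[OF C1_partialsD(5)[OF Sx]]])
  have "C1_on {0..Ts} (Dt {0..Ts} (\<lambda>t x. S 0 x))"
    by (rule C1_partials_imp_C1_on[OF C1_partials_cong[OF C1_partials_const] nt])
      (use C1_partials_Dt[OF 1 _ nt] in auto)
  moreover have "C1_on {0..Ts} (Dx (\<lambda>t x. S 0 x))"
    by (rule C1_partials_imp_C1_on[OF C1_partials_cong[OF 2] nt])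
      (use C1_partials_Dx[OF 1] in auto)
  ultimately show "C2_on {0..Ts} (\<lambda>t x. S 0 x)"
    using C1_partials_imp_C1_on[OF 1 nt] by (simp add: C2_on_def)
qed

text \<open>The equations hold at time \<open>Ts\<close> by continuity.\<close>

lemma smooth_continuation: "smooth_up_to K cv \<gamma> Ts u \<tau> S"
proof -
  define u' \<tau>' S' where "u' = extend_to Ts u" and "\<tau>' = extend_to Ts \<tau>" and "S' = (\<lambda>t :: real. S 0)"
  have nt: "at t within {0..Ts} \<noteq> bot" if "t \<in> {0..Ts}" for t
    using that Ts by (simp add: trivial_limit_within)
  have u': "C1_partials {0..Ts} u' (extend_to Ts U) (extend_to Ts V)"
    unfolding u'_def by (rule C1_partials_extend_to[OF Ts u_partials u_limit U_limit V_limit])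
  have \<tau>': "C1_partials {0..Ts} \<tau>' (extend_to Ts V) (extend_to Ts \<tau>x)"
    unfolding \<tau>'_def
    by (rule C1_partials_extend_to[OF Ts \<tau>_partials edge_limits_pos_imp[OF \<tau>_limit] V_limit \<tau>x_limit])
  have S': "C1_partials {0..Ts} S' (\<lambda>t x. 0) (\<lambda>t x. Dx S 0 x)"
    unfolding S'_def using Ts
    by (intro C1_partials_stationary C1_partialsD(2)[OF S_partials] continuous_slice[OF C1_partialsD(5)[OF S_partials]]) auto
  have pos: "0 < \<tau>' t x" if "t \<in> {0..Ts}" for t x
  proof (cases "t < Ts")
    case False
    obtain l where "0 < l" "(case_prod \<tau> \<longlongrightarrow> l) (edge Ts x)"
      using \<tau>_limit by (auto simp: edge_limits_pos_def)
    then show ?thesis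
      using False tendsto_Lim[OF edge_neq_bot[OF Ts]] by (auto simp: \<tau>'_def extend_to_def)
  qed (use that \<tau>_pos in \<open>auto simp: \<tau>'_def\<close>)
  define p' where "p' = pressure K cv \<gamma> \<tau>' S'"
  have cont_p': "continuous_on {0..Ts} (\<lambda>t. p' t x)" for x
    unfolding p'_def by (rule continuous_on_slice[OF C1_partialsD(3)[OF pressure_partials[OF \<tau>' S' pos]] order_refl])
  have momentum': "extend_to Ts U t x + p' t x * (Dx S 0 x / cv - \<gamma> * extend_to Ts \<tau>x t x / \<tau>' t x) = 0"
    if t: "t \<in> {0..Ts}" for t x
  proof (rule zero_at_end[OF Ts _ _ t])
    show "continuous_on {0..Ts} (\<lambda>t. extend_to Ts U t x + p' t x * (Dx S 0 x / cv - \<gamma> * extend_to Ts \<tau>x t x / \<tau>' t x))"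
      by (intro continuous_intros cont_p' continuous_on_slice[OF C1_partialsD(4)[OF u'] order_refl]
          continuous_on_slice[OF C1_partialsD(5)[OF \<tau>'] order_refl] continuous_on_slice[OF C1_partialsD(3)[OF \<tau>'] order_refl])
        (use less_imp_neq[OF pos, THEN not_sym] in auto)
    fix t assume t: "t \<in> {0..<Ts}"
    have "p' t x = pressure K cv \<gamma> \<tau> S t x"
      using t S_stationary[OF t, of x] by (simp add: p'_def pressure_def \<tau>'_def S'_def)
    moreover have "Dx S t x = Dx S 0 x"
      by (simp only: Dx_def slice_S[OF t])
    ultimately show "extend_to Ts U t x + p' t x * (Dx S 0 x / cv - \<gamma> * extend_to Ts \<tau>x t x / \<tau>' t x) = 0"
      using euler(3)[OF t, of x] t by (simp add: \<tau>'_def)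
  qed
  have eqs: "Dt {0..Ts} \<tau>' t x - Dx u' t x = 0 \<and>
        Dt {0..Ts} u' t x + Dx (pressure K cv \<gamma> \<tau>' S') t x = 0 \<and>
        Dt {0..Ts} (\<lambda>t x. 1 / 2 * (u' t x)\<^sup>2 + internal_energy K cv \<gamma> \<tau>' S' t x) t x
          + Dx (\<lambda>t x. u' t x * pressure K cv \<gamma> \<tau>' S' t x) t x = 0" if t: "t \<in> {0..Ts}" for t x
    by (rule iffD2[OF euler_equations_iff[OF u' \<tau>' S' pos t nt[OF t] K cv \<gamma>]])
      (use momentum'[OF t, of x] in \<open>auto simp: p'_def add_eq_0_iff2\<close>)
  have "smooth_solution K cv \<gamma> {0..Ts} u' \<tau>' S'"
    unfolding smooth_solution_def
    using extension_smooth pos eqs by (simp add: u'_def \<tau>'_def S'_def)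
  moreover have "\<forall>t\<in>{0..<Ts}. \<forall>x. u' t x = u t x \<and> \<tau>' t x = \<tau> t x \<and> S' t x = S t x"
    by (auto simp: u'_def \<tau>'_def S'_def intro: S_stationary[symmetric])
  ultimately show ?thesis
    unfolding smooth_up_to_def by blast
qed

end

section \<open>Blow-up\<close>

lemma K_c_pos: "0 < K \<Longrightarrow> 1 < \<gamma> \<Longrightarrow> 0 < K_c K \<gamma>"
  by (simp add: K_c_def K_tau_def)

lemma neg_a2_pos: "0 < K \<Longrightarrow> 1 < \<gamma> \<Longrightarrow> 0 < z \<Longrightarrow> 0 < m \<Longrightarrow> 0 < - a2 K \<gamma> z m"
  using K_c_pos[of K \<gamma>] by (simp add: a2_def)

lemma neg_a2_3: "0 < z \<Longrightarrow> 0 < m \<Longrightarrow> - a2 K 3 z m = K_c K 3"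
  by (simp add: a2_def)

text \<open>The exponents of \<open>m\<close> and \<open>z\<close> in \<open>a\<^sub>2\<close> both have the sign of \<open>3 - \<gamma>\<close>.\<close>

lemma neg_a2_mono:
  assumes "0 < K" "1 < \<gamma>" "0 < z" "z \<le> z'" "0 < m" "m \<le> m'"
  shows "\<gamma> \<le> 3 \<Longrightarrow> - a2 K \<gamma> z m \<le> - a2 K \<gamma> z' m'" and "3 \<le> \<gamma> \<Longrightarrow> - a2 K \<gamma> z' m' \<le> - a2 K \<gamma> z m"
proof -
  define k where "k = K_c K \<gamma> * ((\<gamma> + 1) / (2 * (\<gamma> - 1)))"
  define p r where "p = 3 * (3 - \<gamma>) / (2 * (3 * \<gamma> - 1))" and "r = (\<gamma> + 1) / (2 * (\<gamma> - 1)) - 1"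
  have k: "0 \<le> k" using K_c_pos[OF assms(1,2)] assms(2) by (simp add: k_def)
  have a2: "- a2 K \<gamma> z m = k * (m powr p * z powr r)" for z m
    by (simp add: a2_def k_def p_def r_def)
  have r: "r = (3 - \<gamma>) / (2 * (\<gamma> - 1))" using assms(2) by (simp add: r_def field_simps)
  show "- a2 K \<gamma> z m \<le> - a2 K \<gamma> z' m'" if "\<gamma> \<le> 3"
  proof -
    have "0 \<le> p" "0 \<le> r" using that assms(2) by (simp_all add: p_def r)
    then show ?thesis
      unfolding a2 using assms by (intro mult_left_mono[OF mult_mono k] powr_mono2) auto
  qed
  show "- a2 K \<gamma> z' m' \<le> - a2 K \<gamma> z m" if "3 \<le> \<gamma>"
  proof -
    have "p \<le> 0" "r \<le> 0" using that assms(2) by (simp_all add: p_def r divide_nonpos_pos)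
    then show ?thesis
      unfolding a2 using assms by (intro mult_left_mono[OF mult_mono k] powr_mono2') auto
  qed
qed

lemma min_neg_a2_eq:
  assumes "0 < K" "1 < \<gamma>" "0 < ZL" "ZL \<le> ZU" "0 < M1" "M1 \<le> M2"
  shows "\<gamma> \<le> 3 \<Longrightarrow> min_neg_a2 K \<gamma> ZL ZU M1 M2 = - a2 K \<gamma> ZL M1"
    and "3 \<le> \<gamma> \<Longrightarrow> min_neg_a2 K \<gamma> ZL ZU M1 M2 = - a2 K \<gamma> ZU M2"
proof -
  show "min_neg_a2 K \<gamma> ZL ZU M1 M2 = - a2 K \<gamma> ZL M1" if "\<gamma> \<le> 3"
    unfolding min_neg_a2_def
  proof (rule cInf_eq_minimum)
    show "- a2 K \<gamma> ZL M1 \<in> (\<lambda>(z, m). - a2 K \<gamma> z m) ` ({ZL..ZU} \<times> {M1..M2})"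
      by (rule image_eqI[of _ _ "(ZL, M1)"]) (use assms in auto)
    fix y assume "y \<in> (\<lambda>(z, m). - a2 K \<gamma> z m) ` ({ZL..ZU} \<times> {M1..M2})"
    then obtain z m where "y = - a2 K \<gamma> z m" "ZL \<le> z" "M1 \<le> m" by auto
    then show "- a2 K \<gamma> ZL M1 \<le> y"
      using neg_a2_mono(1)[of K \<gamma> ZL z M1 m] that assms by simp
  qed
  show "min_neg_a2 K \<gamma> ZL ZU M1 M2 = - a2 K \<gamma> ZU M2" if "3 \<le> \<gamma>"
    unfolding min_neg_a2_def
  proof (rule cInf_eq_minimum)
    show "- a2 K \<gamma> ZU M2 \<in> (\<lambda>(z, m). - a2 K \<gamma> z m) ` ({ZL..ZU} \<times> {M1..M2})"
      by (rule image_eqI[of _ _ "(ZU, M2)"]) (use assms in auto)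
    fix y assume "y \<in> (\<lambda>(z, m). - a2 K \<gamma> z m) ` ({ZL..ZU} \<times> {M1..M2})"
    then obtain z m where "y = - a2 K \<gamma> z m" "ZL \<le> z" "z \<le> ZU" "M1 \<le> m" "m \<le> M2" by auto
    then show "- a2 K \<gamma> ZU M2 \<le> y"
      using neg_a2_mono(2)[of K \<gamma> z ZU m M2] that assms by simp
  qed
qed

lemma min_neg_a2_le:
  assumes "0 < K" "1 < \<gamma>" "0 < ZL" "0 < M1" "z \<in> {ZL..ZU}" "m \<in> {M1..M2}"
  shows "min_neg_a2 K \<gamma> ZL ZU M1 M2 \<le> - a2 K \<gamma> z m"
proof -
  have le: "ZL \<le> z" "z \<le> ZU" "M1 \<le> m" "m \<le> M2" "0 < z" "0 < m" "ZL \<le> ZU" "M1 \<le> M2"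
    using assms by auto
  note eq = min_neg_a2_eq[OF assms(1-3) le(7) assms(4) le(8)]
  show ?thesis
  proof (cases "\<gamma> \<le> 3")
    case True
    then show ?thesis
      using neg_a2_mono(1)[OF assms(1-3) le(1) assms(4) le(3)] eq(1) by simp
  next
    case False
    then show ?thesis
      using neg_a2_mono(2)[OF assms(1,2) le(5,2,6,4)] eq(2) by simp
  qed
qed

lemma zero_in_lifespan: "0 < T \<Longrightarrow> 0 \<in> lifespan T"
  by (simp add: lifespan_def zero_ereal_def[symmetric])

lemma lifespan_ereal: "lifespan (ereal Ts) = {0..<Ts}"
  by (auto simp: lifespan_def)

lemma gas_flow_lifespan:
  assumes "0 < K" "0 < cv" "1 < \<gamma>" "0 < T" "smooth_solution K cv \<gamma> (lifespan T) u \<tau> S"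
  shows "gas_flow K cv \<gamma> (lifespan T) u \<tau> S"
proof
  show "is_interval (lifespan T)"
    unfolding is_interval_1
  proof (intro ballI allI impI)
    fix r s t assume "r \<in> lifespan T" "s \<in> lifespan T" "r \<le> t \<and> t \<le> s"
    then show "t \<in> lifespan T"
      using order_le_less_trans[of "ereal t" "ereal s" T] by (simp add: lifespan_def)
  qed
  show "at t within lifespan T \<noteq> bot" if t: "t \<in> lifespan T" for t
  proof -
    obtain t' where t': "t < t'" "ereal t' < T"
      using ereal_dense2[of "ereal t" T] t unfolding lifespan_def mem_Collect_eq less_ereal.simps(1) by blast
    have "{t..t'} \<subseteq> lifespan T"
    proof
      fix s assume "s \<in> {t..t'}"
      then show "s \<in> lifespan T"
        using t t'(2) order_le_less_trans[of "ereal s" "ereal t'" T] by (simp add: lifespan_def)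
    qed
    then have "t islimpt lifespan T"
      by (rule islimpt_subset[rotated]) (use t'(1) in simp)
    then show ?thesis by (simp add: trivial_limit_within)
  qed
qed (use assms zero_in_lifespan in auto)

context gas_flow
begin

text \<open>With \<open>k = 2 / (3 \<gamma> - 1)\<close> this is
  \<open>(m\<^bsup>-k\<^esup>)\<^sub>x\<^sub>x = - k m\<^bsup>-k\<^esup> (\<mu>\<^sub>x - k \<mu>\<^sup>2)\<close>: up to a negative factor the zeroth order term of the Riccati
  equation.\<close>

lemma entropy_xx_eq:
  "entropy_xx cv \<gamma> S x = - (2 / (3 * \<gamma> - 1)) * mvar cv S 0 x powr (- (2 / (3 * \<gamma> - 1)))
     * (\<mu>x 0 x - 2 / (3 * \<gamma> - 1) * (\<mu> 0 x)\<^sup>2)"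
proof -
  define k where "k = 2 / (3 * \<gamma> - 1)"
  define F where "F = (\<lambda>t x. mvar cv S t x powr (- k))"
  have "C1_partials J F (\<lambda>t x. - k * mvar cv S t x powr (- k - 1) * 0)
      (\<lambda>t x. - k * mvar cv S t x powr (- k - 1) * (mvar cv S t x * \<mu> t x))"
    unfolding F_def by (rule C1_partials_powr[OF m_partials m_pos])
  then have F: "C1_partials J F (\<lambda>t x. 0) (\<lambda>t x. - k * (F t x * \<mu> t x))"
    by (rule C1_partials_cong) (simp_all add: F_def powr_diff abs_of_pos[OF m_pos] less_imp_le[OF m_pos] less_imp_neq[OF m_pos, THEN not_sym])
  have "Dx F 0 = (\<lambda>y. - k * (F 0 y * \<mu> 0 y))"
    by (rule ext) (rule C1_partials_Dx[OF F zero_J])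
  moreover have "((\<lambda>y. - k * (F 0 y * \<mu> 0 y)) has_real_derivative
      - k * (- k * (F 0 x * \<mu> 0 x) * \<mu> 0 x + F 0 x * \<mu>x 0 x)) (at x)"
    by (rule C1_partialsD(2)[OF C1_partials_cmult[OF C1_partials_mult[OF F \<mu>_partials]] zero_J])
  ultimately have "Dx (Dx F) 0 x = - k * (- k * (F 0 x * \<mu> 0 x) * \<mu> 0 x + F 0 x * \<mu>x 0 x)"
    by (intro Dx_eqI) simp
  then show ?thesis
    unfolding entropy_xx_def k_def[symmetric] F_def[symmetric]
    by (simp add: F_def power2_eq_square algebra_simps)
qed

text \<open>Waves of the family \<open>\<sigma>\<close> move in direction \<open>\<sigma>\<close> and so remain in the half-line on which the
  entropy profile makes the zeroth order term of the Riccati equation nonpositive.\<close>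

lemma lifespan_bound:
  assumes \<sigma>: "\<sigma> \<in> {1, - 1}" and C: "\<And>t x. t \<in> J \<Longrightarrow> c t x \<le> C"
    and a2_le: "\<And>t x. t \<in> J \<Longrightarrow> a \<le> - a2 K \<gamma> (z t x) (mvar cv S t x)" and a: "0 < a"
    and entropy: "\<And>x. 0 < \<sigma> * (x - x1) \<Longrightarrow> 0 \<le> entropy_xx cv \<gamma> S x" and x0: "0 < \<sigma> * (x0 - x1)"
    and Y0: "Y \<sigma> 0 x0 < 0" and b: "0 \<le> b" and sub: "{0..b} \<subseteq> J"
  shows "b < - (1 / (Y \<sigma> 0 x0 * a))"
proof -
  have subJ: "{0..b} \<times> UNIV \<subseteq> J \<times> (UNIV :: real set)" using sub by auto
  note s = C1_partials_cmult[OF c_partials, of \<sigma>]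
  have bound: "\<bar>\<sigma> * c t x\<bar> \<le> C" if "t \<in> {0..b}" for t x
    using C[of t x] c_pos[of t x] that sub \<sigma> by (auto simp: abs_mult)
  obtain X where X0: "X 0 = x0"
    and X: "\<And>t. t \<in> {0..b} \<Longrightarrow> (X has_real_derivative \<sigma> * c t (X t)) (at t within {0..b})"
    by (rule characteristic_forward[OF continuous_on_subset[OF C1_partialsD(3)[OF s] subJ]
          C1_partialsD(2)[OF s subsetD[OF sub]] continuous_on_subset[OF C1_partialsD(5)[OF s] subJ] bound b, of x0])
      blast+
  have ahead: "0 < \<sigma> * (X t - x1)" if t: "t \<in> {0..b}" for t
  proof -
    have sub': "{0..t} \<subseteq> {0..b}" and "0 \<le> t" using t by auto
    from mvt_within[OF this(2) DERIV_subset[OF X sub']] sub'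
    obtain r where r: "r \<in> {0..t}" "X t - X 0 = (t - 0) * (\<sigma> * c r (X r))" by blast
    have "r \<in> J" using r(1) sub' sub by auto
    have "\<sigma> * (X t - x1) = t * (\<sigma> * \<sigma> * c r (X r)) + \<sigma> * (x0 - x1)"
      using r(2) X0 by (simp add: algebra_simps)
    also have "\<sigma> * \<sigma> = 1" using \<sigma> by auto
    finally show ?thesis
      using x0 t c_pos[OF \<open>r \<in> J\<close>, of "X r"] by (simp add: add_nonneg_pos)
  qed
  have entropy_sign: "\<mu>x t x - 2 / (3 * \<gamma> - 1) * (\<mu> t x)\<^sup>2 \<le> 0" if t: "t \<in> J" and x: "0 < \<sigma> * (x - x1)" for t x
  proof -
    have S: "S t = S 0" by (rule ext) (rule S_stationary[OF t])
    have Sx: "Dx S t = Dx S 0" by (rule ext) (simp only: Dx_def S)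
    have "\<mu> t x = \<mu> 0 x" "\<mu>x t x = \<mu>x 0 x"
      by (simp_all only: \<mu>_def \<mu>x_def Dx_def[of "Dx S"] Sx)
    moreover have "0 < 2 / (3 * \<gamma> - 1) * mvar cv S 0 x powr (- (2 / (3 * \<gamma> - 1)))"
      using \<gamma> m_pos[of 0 x] by simp
    moreover have "2 / (3 * \<gamma> - 1) * mvar cv S 0 x powr (- (2 / (3 * \<gamma> - 1)))
        * (\<mu>x 0 x - 2 / (3 * \<gamma> - 1) * (\<mu> 0 x)\<^sup>2) \<le> 0"
      using entropy[OF x] unfolding entropy_xx_eq mult_minus_left neg_0_le_iff_le .
    ultimately show ?thesis
      by (metis mult_pos_pos not_less)
  qed
  define Y' where "Y' t = a2 K \<gamma> (z t (X t)) (mvar cv S t (X t)) * (Y \<sigma> t (X t))\<^sup>2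
       + weight t (X t) * (2 / (\<gamma> * (3 * \<gamma> - 1)) * (c t (X t))\<^sup>2 * \<tau> t (X t)
          * (\<mu>x t (X t) - 2 / (3 * \<gamma> - 1) * (\<mu> t (X t))\<^sup>2))" for t
  have "b < - (1 / (Y \<sigma> 0 (X 0) * a))"
  proof (rule riccati_blowup[OF _ _ a _ b])
    fix t assume t: "t \<in> {0..b}"
    then have tJ: "t \<in> J" using sub by auto
    show "((\<lambda>t. Y \<sigma> t (X t)) has_real_derivative Y' t) (at t within {0..b})"
      unfolding Y'_def by (rule Y_riccati[OF t sub \<sigma> X[OF t]])
    have "weight t (X t) * (2 / (\<gamma> * (3 * \<gamma> - 1)) * (c t (X t))\<^sup>2 * \<tau> t (X t)
          * (\<mu>x t (X t) - 2 / (3 * \<gamma> - 1) * (\<mu> t (X t))\<^sup>2)) \<le> 0"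
      using weight_pos[OF tJ, of "X t"] \<tau>_pos[OF tJ, of "X t"] \<gamma> entropy_sign[OF tJ ahead[OF t]]
      by (intro mult_nonneg_nonpos) auto
    moreover have "a2 K \<gamma> (z t (X t)) (mvar cv S t (X t)) * (Y \<sigma> t (X t))\<^sup>2 \<le> - a * (Y \<sigma> t (X t))\<^sup>2"
      using a2_le[OF tJ, of "X t"] by (intro mult_right_mono) auto
    ultimately show "Y' t \<le> - a * (Y \<sigma> t (X t))\<^sup>2"
      unfolding Y'_def by linarith
  qed (use Y0 X0 in simp)
  then show ?thesis by (simp only: X0)
qed

end

text \<open>If the time \<open>- 1 / (y a)\<close> belonged to the lifespan, it would have to be smaller than itself
  by \<open>lifespan_bound\<close>; hence the lifespan is finite, and the continuation result applies at its
  end.\<close>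

lemma gradient_blowup:
  fixes T :: ereal
  assumes flow: "gas_flow K cv \<gamma> (lifespan T) u \<tau> S" and T: "0 < T" and \<sigma>: "\<sigma> \<in> {1, - 1}"
    and C: "\<And>t x. t \<in> lifespan T \<Longrightarrow> sound_speed K cv \<gamma> \<tau> S t x \<le> C"
    and a: "0 < a" "\<And>t x. t \<in> lifespan T \<Longrightarrow> a \<le> - a2 K \<gamma> (zvar K \<gamma> \<tau> t x) (mvar cv S t x)"
    and entropy: "\<And>x. 0 < \<sigma> * (x - x1) \<Longrightarrow> 0 \<le> entropy_xx cv \<gamma> S x" and x0: "0 < \<sigma> * (x0 - x1)"
    and y: "y = gas_flow.Y K cv \<gamma> (lifespan T) u \<tau> S \<sigma> 0 x0" "y < 0"
  shows "gradient_blowup_by K cv \<gamma> T u \<tau> S (- (1 / (y * a)))"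
proof -
  interpret gas_flow K cv \<gamma> "lifespan T" u \<tau> S by (rule flow)
  have C': "c t x \<le> C" if "t \<in> lifespan T" for t x
    using C[OF that, of x] sound_speed_eq[OF that, of x] by simp
  have "T \<le> ereal (- (1 / (y * a)))"
  proof (rule ccontr)
    assume "\<not> T \<le> ereal (- (1 / (y * a)))"
    then have less: "ereal (- (1 / (y * a))) < T" by simp
    have "{0..- (1 / (y * a))} \<subseteq> lifespan T"
    proof
      fix t assume "t \<in> {0..- (1 / (y * a))}"
      then show "t \<in> lifespan T"
        using order_le_less_trans[OF _ less, of "ereal t"] by (simp add: lifespan_def)
    qed
    moreover have "0 \<le> - (1 / (y * a))"
      using y(2) a(1) by (simp add: mult_neg_pos less_imp_le)
    ultimately have "- (1 / (y * a)) < - (1 / (y * a))"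
      using lifespan_bound[OF \<sigma> C' _ a(1) entropy x0, of "- (1 / (y * a))"] a(2) y
      by (simp add: z_def)
    then show False by simp
  qed
  moreover from this T obtain Ts where Ts: "T = ereal Ts" "0 < Ts"
    by (cases T) auto
  moreover have "blows_up_at Ts (Dx u) \<or> blows_up_at Ts (Dx \<tau>)"
    if "\<not> smooth_up_to K cv \<gamma> Ts u \<tau> S"
  proof (rule ccontr)
    assume "\<not> (blows_up_at Ts (Dx u) \<or> blows_up_at Ts (Dx \<tau>))"
    then have "edge_bounded Ts (Dx u)" "edge_bounded Ts (Dx \<tau>)"
      by (auto intro: not_blows_up_imp_edge_bounded)
    then have "bounded_gradient_flow K cv \<gamma> Ts u \<tau> S C"
      using flow C' Ts(2)
      unfolding Ts(1) lifespan_ereal bounded_gradient_flow_def bounded_gradient_flow_axioms_def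
      by (simp add: gas_flow.V_def gas_flow.\<tau>x_def)
    then show False
      using bounded_gradient_flow.smooth_continuation that by blast
  qed
  ultimately show ?thesis
    unfolding gradient_blowup_by_def by auto
qed

theorem theorem1p5:
  fixes K cv \<gamma> :: real and T :: ereal and u \<tau> S :: "real \<Rightarrow> real \<Rightarrow> real"
  assumes "0 < K" and "0 < cv" and "1 < \<gamma>" and "0 < T"
    and "smooth_solution K cv \<gamma> (lifespan T) u \<tau> S"
  shows
    "(\<forall>ZL ZU M1 M2 M3 M4. bounds K cv \<gamma> T \<tau> S ZL ZU M1 M2 M3 M4 \<longrightarrow>
        0 < min_neg_a2 K \<gamma> ZL ZU M1 M2 \<and>
        (\<gamma> < 3 \<longrightarrow> min_neg_a2 K \<gamma> ZL ZU M1 M2 = - a2 K \<gamma> ZL M1) \<and>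
        (\<gamma> > 3 \<longrightarrow> min_neg_a2 K \<gamma> ZL ZU M1 M2 = - a2 K \<gamma> ZU M2) \<and>
        (\<gamma> = 3 \<longrightarrow> min_neg_a2 K \<gamma> ZL ZU M1 M2 = K_c K \<gamma>) \<and>
        (\<forall>A Astar. (\<forall>x>A. 0 \<le> entropy_xx cv \<gamma> S x) \<and> A < Astar \<and>
           yvar K cv \<gamma> u \<tau> S 0 Astar < 0 \<longrightarrow>
           gradient_blowup_by K cv \<gamma> T u \<tau> S
             (- (1 / (yvar K cv \<gamma> u \<tau> S 0 Astar * min_neg_a2 K \<gamma> ZL ZU M1 M2)))) \<and>
        (\<forall>A Astar. (\<forall>x<A. 0 \<le> entropy_xx cv \<gamma> S x) \<and> Astar < A \<and>
           qvar K cv \<gamma> u \<tau> S 0 Astar < 0 \<longrightarrow>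
           gradient_blowup_by K cv \<gamma> T u \<tau> S
             (- (1 / (qvar K cv \<gamma> u \<tau> S 0 Astar * min_neg_a2 K \<gamma> ZL ZU M1 M2))))) \<and>
     (\<gamma> = 3 \<longrightarrow>
        0 < K_c K \<gamma> \<and> (\<forall>z>0. \<forall>m>0. - a2 K \<gamma> z m = K_c K \<gamma>) \<and>
        ((\<exists>C. \<forall>t\<in>lifespan T. \<forall>x. sound_speed K cv \<gamma> \<tau> S t x \<le> C) \<longrightarrow>
          (\<forall>A Astar. (\<forall>x>A. 0 \<le> entropy_xx cv \<gamma> S x) \<and> A < Astar \<and>
             yvar K cv \<gamma> u \<tau> S 0 Astar < 0 \<longrightarrow>
             gradient_blowup_by K cv \<gamma> T u \<tau> S
               (- (1 / (yvar K cv \<gamma> u \<tau> S 0 Astar * K_c K \<gamma>)))) \<and>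
          (\<forall>A Astar. (\<forall>x<A. 0 \<le> entropy_xx cv \<gamma> S x) \<and> Astar < A \<and>
             qvar K cv \<gamma> u \<tau> S 0 Astar < 0 \<longrightarrow>
             gradient_blowup_by K cv \<gamma> T u \<tau> S
               (- (1 / (qvar K cv \<gamma> u \<tau> S 0 Astar * K_c K \<gamma>))))))"
proof -
  interpret gas_flow K cv \<gamma> "lifespan T" u \<tau> S
    by (rule gas_flow_lifespan[OF assms])
  note zero = zero_in_lifespan[OF assms(4)]
  define blows_up where "blows_up a \<longleftrightarrow>
     (\<forall>A Astar. (\<forall>x>A. 0 \<le> entropy_xx cv \<gamma> S x) \<and> A < Astar \<and>
        yvar K cv \<gamma> u \<tau> S 0 Astar < 0 \<longrightarrow>
        gradient_blowup_by K cv \<gamma> T u \<tau> S (- (1 / (yvar K cv \<gamma> u \<tau> S 0 Astar * a)))) \<and>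
     (\<forall>A Astar. (\<forall>x<A. 0 \<le> entropy_xx cv \<gamma> S x) \<and> Astar < A \<and>
        qvar K cv \<gamma> u \<tau> S 0 Astar < 0 \<longrightarrow>
        gradient_blowup_by K cv \<gamma> T u \<tau> S (- (1 / (qvar K cv \<gamma> u \<tau> S 0 Astar * a))))" for a
  have blowup: "blows_up a"
    if C: "\<And>t x. t \<in> lifespan T \<Longrightarrow> sound_speed K cv \<gamma> \<tau> S t x \<le> C"
      and a: "0 < a" "\<And>t x. t \<in> lifespan T \<Longrightarrow> a \<le> - a2 K \<gamma> (zvar K \<gamma> \<tau> t x) (mvar cv S t x)" for C a
    unfolding blows_up_def
  proof (intro conjI allI impI)
    fix A Astar :: real
    assume *: "(\<forall>x>A. 0 \<le> entropy_xx cv \<gamma> S x) \<and> A < Astar \<and> yvar K cv \<gamma> u \<tau> S 0 Astar < 0"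
    show "gradient_blowup_by K cv \<gamma> T u \<tau> S (- (1 / (yvar K cv \<gamma> u \<tau> S 0 Astar * a)))"
      by (rule gradient_blowup[OF gas_flow_axioms assms(4) _ C a, where \<sigma> = 1 and ?x1.0 = A and ?x0.0 = Astar])
        (use * yvar_eq[OF zero] in auto)
  next
    fix A Astar :: real
    assume *: "(\<forall>x<A. 0 \<le> entropy_xx cv \<gamma> S x) \<and> Astar < A \<and> qvar K cv \<gamma> u \<tau> S 0 Astar < 0"
    show "gradient_blowup_by K cv \<gamma> T u \<tau> S (- (1 / (qvar K cv \<gamma> u \<tau> S 0 Astar * a)))"
      by (rule gradient_blowup[OF gas_flow_axioms assms(4) _ C a, where \<sigma> = "- 1" and ?x1.0 = A and ?x0.0 = Astar])
        (use * qvar_eq[OF zero] in auto)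
  qed
  have m: "mvar cv S t x = mvar cv S 0 x" if "t \<in> lifespan T" for t x
    unfolding mvar_def S_stationary[OF that, of x] ..
  have bounded: "0 < min_neg_a2 K \<gamma> ZL ZU M1 M2 \<and>
        (\<gamma> < 3 \<longrightarrow> min_neg_a2 K \<gamma> ZL ZU M1 M2 = - a2 K \<gamma> ZL M1) \<and>
        (\<gamma> > 3 \<longrightarrow> min_neg_a2 K \<gamma> ZL ZU M1 M2 = - a2 K \<gamma> ZU M2) \<and>
        (\<gamma> = 3 \<longrightarrow> min_neg_a2 K \<gamma> ZL ZU M1 M2 = K_c K \<gamma>)"
    "\<And>t x. t \<in> lifespan T \<Longrightarrow> min_neg_a2 K \<gamma> ZL ZU M1 M2 \<le> - a2 K \<gamma> (zvar K \<gamma> \<tau> t x) (mvar cv S t x)"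
    "\<exists>C. \<forall>t\<in>lifespan T. \<forall>x. sound_speed K cv \<gamma> \<tau> S t x \<le> C"
    if bounds: "bounds K cv \<gamma> T \<tau> S ZL ZU M1 M2 M3 M4" for ZL ZU M1 M2 M3 M4
  proof -
    have pos: "0 < ZL" "0 < ZU" "0 < M1" "0 < M2"
      and z_bounds: "\<And>t x. t \<in> lifespan T \<Longrightarrow> ZL < zvar K \<gamma> \<tau> t x \<and> zvar K \<gamma> \<tau> t x < ZU"
      and m_bounds: "\<And>t x. t \<in> lifespan T \<Longrightarrow> M1 < mvar cv S t x \<and> mvar cv S t x < M2"
      using bounds m by (auto simp: bounds_def)
    have le: "ZL \<le> ZU" "M1 \<le> M2"
      using z_bounds[OF zero, of 0] m_bounds[OF zero, of 0] by linarith+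
    note eq = min_neg_a2_eq[OF assms(1,3) pos(1) le(1) pos(3) le(2)]
    show "0 < min_neg_a2 K \<gamma> ZL ZU M1 M2 \<and>
        (\<gamma> < 3 \<longrightarrow> min_neg_a2 K \<gamma> ZL ZU M1 M2 = - a2 K \<gamma> ZL M1) \<and>
        (\<gamma> > 3 \<longrightarrow> min_neg_a2 K \<gamma> ZL ZU M1 M2 = - a2 K \<gamma> ZU M2) \<and>
        (\<gamma> = 3 \<longrightarrow> min_neg_a2 K \<gamma> ZL ZU M1 M2 = K_c K \<gamma>)"
      using eq neg_a2_pos[OF assms(1,3) pos(1,3)] neg_a2_pos[OF assms(1,3) pos(2,4)] neg_a2_3[OF pos(1,3)]
      by (cases "\<gamma> \<le> 3") auto
    show "min_neg_a2 K \<gamma> ZL ZU M1 M2 \<le> - a2 K \<gamma> (zvar K \<gamma> \<tau> t x) (mvar cv S t x)" if "t \<in> lifespan T" for t x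
      by (rule min_neg_a2_le[OF assms(1,3) pos(1,3)])
        (use z_bounds[OF that, of x] m_bounds[OF that, of x] in auto)
    \<comment> \<open>With the entropy bounded, an upper bound on \<open>z\<close> is an upper bound on the sound speed.\<close>
    define k where "k = 2 * sqrt (K * \<gamma>) / (\<gamma> - 1)"
    define s where "s = (\<gamma> + 1) / (\<gamma> - 1)"
    have k: "0 < k" and s: "0 \<le> s" using assms(1,3) by (simp_all add: k_def s_def)
    show "\<exists>C. \<forall>t\<in>lifespan T. \<forall>x. sound_speed K cv \<gamma> \<tau> S t x \<le> C"
    proof (intro exI ballI allI)
      fix t x assume t: "t \<in> lifespan T"
      have "- ((\<gamma> - 1) / 2) * s = - ((\<gamma> + 1) / 2)" using assms(3) by (simp add: s_def field_simps)
      then have "\<tau> t x powr (- ((\<gamma> + 1) / 2)) = (\<tau> t x powr (- ((\<gamma> - 1) / 2))) powr s"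
        by (simp only: powr_powr)
      also have "\<tau> t x powr (- ((\<gamma> - 1) / 2)) = zvar K \<gamma> \<tau> t x / k"
        unfolding zvar_def k_def[symmetric] using k by simp
      also have "(zvar K \<gamma> \<tau> t x / k) powr s \<le> (ZU / k) powr s"
        using z_bounds[OF t, of x] pos(1) k s by (intro powr_mono2 divide_right_mono) auto
      finally show "sound_speed K cv \<gamma> \<tau> S t x \<le> sqrt (K * \<gamma>) * M2 * (ZU / k) powr s"
        unfolding sound_speed_eq[OF t] c_def
        using m_bounds[OF t, of x] pos(3) assms(1,3) by (intro mult_mono) auto
    qed
  qed
  have bounded_case: "blows_up (min_neg_a2 K \<gamma> ZL ZU M1 M2)"
    if B: "bounds K cv \<gamma> T \<tau> S ZL ZU M1 M2 M3 M4" for ZL ZU M1 M2 M3 M4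
  proof -
    obtain C where C: "\<And>t x. t \<in> lifespan T \<Longrightarrow> sound_speed K cv \<gamma> \<tau> S t x \<le> C"
      using bounded(3)[OF B] by blast
    show ?thesis
      by (rule blowup[OF C _ bounded(2)[OF B]]) (use bounded(1)[OF B] in auto)
  qed
  have a2_const: "- a2 K \<gamma> z m = K_c K \<gamma>" if "\<gamma> = 3" "0 < z" "0 < m" for z m
    unfolding \<open>\<gamma> = 3\<close> by (rule neg_a2_3[OF that(2,3)])
  have "blows_up (K_c K \<gamma>)"
    if gamma_3: "\<gamma> = 3" and bounded: "\<exists>C. \<forall>t\<in>lifespan T. \<forall>x. sound_speed K cv \<gamma> \<tau> S t x \<le> C"
  proof -
    obtain C where C: "\<And>t x. t \<in> lifespan T \<Longrightarrow> sound_speed K cv \<gamma> \<tau> S t x \<le> C"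
      using bounded by blast
    show ?thesis
    proof (rule blowup[OF C K_c_pos[OF assms(1,3)]])
      show "K_c K \<gamma> \<le> - a2 K \<gamma> (zvar K \<gamma> \<tau> t x) (mvar cv S t x)" if "t \<in> lifespan T" for t x
        using a2_const[OF gamma_3 z_pos[OF that, of x, unfolded z_def] m_pos, of t x] by simp
    qed
  qed
  with bounded(1) bounded_case K_c_pos[OF assms(1,3)] a2_const show ?thesis
    unfolding blows_up_def[symmetric] by blast
qed

end
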